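(* Let $X$, $Y$ be compact metrizable spaces and let $E\subseteq X\times Y$ be a closed set. If $E$ is a set of $\mu\times\nu$-synthesis (operator synthesis) for every pair $(\mu,\nu)$ of finite Borel measures $\mu\in M(X)$, $\nu\in M(Y)$, then $E$ is a set of spectral synthesis for the Varopoulos algebra $V(X,Y)$.
   Context: $V(X,Y)=C(X)\hat\otimes C(Y)$ is the algebra of functions $\Phi\in C(X\times Y)$ with a representation $\Phi(x,y)=\sum_i f_i(x)g_i(y)$, $f_i\in C(X)$, $g_i\in C(Y)$, $\sum_i\|f_i\|\|g_i\|<\infty$ (sup norms), with norm the infimum of such sums. A closed set $E\subseteq X\times Y$ is a set of spectral synthesis for $V(X,Y)$ if every $\Phi\in V(X,Y)$ vanishing on $E$ is a norm limit in $V(X,Y)$ of elements of $V(X,Y)$ each vanishing in a neighbourhood of $E$. Operator synthesis. Let $\mu,\nu$ be finite (positive) Borel measures on $X,Y$. A subset of $X\times Y$ is marginally null if it is contained in $(N\times Y)\cup(X\times M)$ with $\mu(N)=\nu(M)=0$; "m.a.e." means outside a marginally null set. A set is pseudo-open if, up to a marginally null set, it is a countable union of measurable rectangles; pseudo-closed sets are complements of pseudo-open sets. $\Gamma(X,Y)=L_2(X,\mu)\hat\otimes L_2(Y,\nu)$ is the space of functions (identified when equal m.a.e.) $F(x,y)=\sum_{n}f_n(x)g_n(y)$ with $f_n\in L_2(X,\mu)$, $g_n\in L_2(Y,\nu)$, $\sum_n\|f_n\|\|g_n\|<\infty$, normed by $\|F\|_\Gamma=\inf\sum_n\|f_n\|\|g_n\|$.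 $F$ vanishes on $K$ if $F\chi_K=0$ m.a.e. $\Phi(K)$ is the set of $F\in\Gamma(X,Y)$ vanishing on $K$; $\Phi_0(K)$ is the norm closure of the set of $F\in\Gamma(X,Y)$ vanishing on some pseudo-open set containing $K$. A pseudo-closed set $K$ is a set of $\mu\times\nu$-synthesis if $\Phi_0(K)=\Phi(K)$. *)

theory Defs
  imports "HOL-Analysis.Analysis"
begin

text \<open>All function spaces are complex-valued. The spaces \<open>X\<close>, \<open>Y\<close> are the
  underlying types; on a compact type the library type of bounded continuous functions, with its
  supremum norm, is \<open>C(X)\<close>. Finite sums are covered by series padded with zeros.\<close>

definition varopoulos_rep ::
    "(nat \<Rightarrow> 'a::topological_space \<Rightarrow>\<^sub>C complex) \<Rightarrow> (nat \<Rightarrow> 'b::topological_space \<Rightarrow>\<^sub>C complex)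
      \<Rightarrow> (('a \<times> 'b) \<Rightarrow>\<^sub>C complex) \<Rightarrow> bool" where
  "varopoulos_rep f g \<Phi> \<longleftrightarrow>
     summable (\<lambda>i. norm (f i) * norm (g i)) \<and>
     (\<forall>x y. (\<lambda>i. apply_bcontfun (f i) x * apply_bcontfun (g i) y) sums apply_bcontfun \<Phi> (x, y))"

definition varopoulos_algebra ::
    "(('a::topological_space \<times> 'b::topological_space) \<Rightarrow>\<^sub>C complex) set" where
  "varopoulos_algebra = {\<Phi>. \<exists>f g. varopoulos_rep f g \<Phi>}"

definition varopoulos_norm ::
    "(('a::topological_space \<times> 'b::topological_space) \<Rightarrow>\<^sub>C complex) \<Rightarrow> real" where
  "varopoulos_norm \<Phi> =
     Inf {s. \<exists>f g. varopoulos_rep f g \<Phi> \<and> s = (\<Sum>i. norm (f i) * norm (g i))}"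

definition spectral_synthesis ::
    "('a::topological_space \<times> 'b::topological_space) set \<Rightarrow> bool" where
  "spectral_synthesis E \<longleftrightarrow> closed E \<and>
     (\<forall>\<Phi> \<in> varopoulos_algebra. (\<forall>p\<in>E. apply_bcontfun \<Phi> p = 0) \<longrightarrow>
        (\<exists>\<Psi>. (\<forall>n. \<Psi> n \<in> varopoulos_algebra \<and>
                    (\<exists>U. open U \<and> E \<subseteq> U \<and> (\<forall>p\<in>U. apply_bcontfun (\<Psi> n) p = 0))) \<and>
              (\<lambda>n. varopoulos_norm (\<Phi> - \<Psi> n)) \<longlonglongrightarrow> 0))"

definition marginally_null :: "'a measure \<Rightarrow> 'b measure \<Rightarrow> ('a \<times> 'b) set \<Rightarrow> bool" where
  "marginally_null \<mu> \<nu> S \<longleftrightarrow>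
     (\<exists>N \<in> null_sets \<mu>. \<exists>M \<in> null_sets \<nu>. S \<subseteq> (N \<times> space \<nu>) \<union> (space \<mu> \<times> M))"

definition mae :: "'a measure \<Rightarrow> 'b measure \<Rightarrow> ('a \<times> 'b \<Rightarrow> bool) \<Rightarrow> bool" where
  "mae \<mu> \<nu> P \<longleftrightarrow> marginally_null \<mu> \<nu> {p \<in> space \<mu> \<times> space \<nu>. \<not> P p}"

definition pseudo_open :: "'a measure \<Rightarrow> 'b measure \<Rightarrow> ('a \<times> 'b) set \<Rightarrow> bool" where
  "pseudo_open \<mu> \<nu> U \<longleftrightarrow> U \<subseteq> space \<mu> \<times> space \<nu> \<and>
     (\<exists>A B. range A \<subseteq> sets \<mu> \<and> range B \<subseteq> sets \<nu> \<and>
        marginally_null \<mu> \<nu> (sym_diff U (\<Union>n::nat. A n \<times> B n)))"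

definition pseudo_closed :: "'a measure \<Rightarrow> 'b measure \<Rightarrow> ('a \<times> 'b) set \<Rightarrow> bool" where
  "pseudo_closed \<mu> \<nu> K \<longleftrightarrow> K \<subseteq> space \<mu> \<times> space \<nu> \<and>
     pseudo_open \<mu> \<nu> (space \<mu> \<times> space \<nu> - K)"

text \<open>Square-integrable functions are not quotiented by a.e. equality, so \<open>L2_norm\<close> is only
  a seminorm on \<open>L2_fun\<close>. Likewise the elements of \<open>\<Gamma>(X, Y)\<close> below are functions, and
  m.a.e. equality is built into their representations: \<open>L2_tensor\<close>, \<open>L2_tensor_norm\<close> and
  vanishing on a set do not distinguish functions that agree m.a.e.\<close>

definition L2_fun :: "'a measure \<Rightarrow> ('a \<Rightarrow> complex) set" where
  "L2_fun \<mu> = {f \<in> borel_measurable \<mu>. integrable \<mu> (\<lambda>x. (cmod (f x))\<^sup>2)}"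

definition L2_norm :: "'a measure \<Rightarrow> ('a \<Rightarrow> complex) \<Rightarrow> real" where
  "L2_norm \<mu> f = sqrt (\<integral>x. (cmod (f x))\<^sup>2 \<partial>\<mu>)"

definition L2_tensor_rep ::
    "'a measure \<Rightarrow> 'b measure \<Rightarrow> (nat \<Rightarrow> 'a \<Rightarrow> complex) \<Rightarrow> (nat \<Rightarrow> 'b \<Rightarrow> complex)
      \<Rightarrow> ('a \<times> 'b \<Rightarrow> complex) \<Rightarrow> bool" where
  "L2_tensor_rep \<mu> \<nu> f g F \<longleftrightarrow>
     (\<forall>n. f n \<in> L2_fun \<mu> \<and> g n \<in> L2_fun \<nu>) \<and>
     summable (\<lambda>n. L2_norm \<mu> (f n) * L2_norm \<nu> (g n)) \<and>
     mae \<mu> \<nu> (\<lambda>(x, y). (\<lambda>n. f n x * g n y) sums F (x, y))"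

definition L2_tensor :: "'a measure \<Rightarrow> 'b measure \<Rightarrow> ('a \<times> 'b \<Rightarrow> complex) set" where
  "L2_tensor \<mu> \<nu> = {F. \<exists>f g. L2_tensor_rep \<mu> \<nu> f g F}"

definition L2_tensor_norm :: "'a measure \<Rightarrow> 'b measure \<Rightarrow> ('a \<times> 'b \<Rightarrow> complex) \<Rightarrow> real" where
  "L2_tensor_norm \<mu> \<nu> F =
     Inf {s. \<exists>f g. L2_tensor_rep \<mu> \<nu> f g F \<and> s = (\<Sum>n. L2_norm \<mu> (f n) * L2_norm \<nu> (g n))}"

definition vanishes_on ::
    "'a measure \<Rightarrow> 'b measure \<Rightarrow> ('a \<times> 'b) set \<Rightarrow> ('a \<times> 'b \<Rightarrow> complex) \<Rightarrow> bool" where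
  "vanishes_on \<mu> \<nu> K F \<longleftrightarrow> mae \<mu> \<nu> (\<lambda>p. F p * indicator K p = 0)"

definition Phi_set :: "'a measure \<Rightarrow> 'b measure \<Rightarrow> ('a \<times> 'b) set \<Rightarrow> ('a \<times> 'b \<Rightarrow> complex) set" where
  "Phi_set \<mu> \<nu> K = {F \<in> L2_tensor \<mu> \<nu>. vanishes_on \<mu> \<nu> K F}"

definition Phi0_set :: "'a measure \<Rightarrow> 'b measure \<Rightarrow> ('a \<times> 'b) set \<Rightarrow> ('a \<times> 'b \<Rightarrow> complex) set" where
  "Phi0_set \<mu> \<nu> K =
     {F \<in> L2_tensor \<mu> \<nu>. \<exists>G.
        (\<forall>n. G n \<in> L2_tensor \<mu> \<nu> \<and>
             (\<exists>U. pseudo_open \<mu> \<nu> U \<and> K \<subseteq> U \<and> vanishes_on \<mu> \<nu> U (G n))) \<and>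
        (\<lambda>n. L2_tensor_norm \<mu> \<nu> (\<lambda>p. F p - G n p)) \<longlonglongrightarrow> 0}"

definition operator_synthesis :: "'a measure \<Rightarrow> 'b measure \<Rightarrow> ('a \<times> 'b) set \<Rightarrow> bool" where
  "operator_synthesis \<mu> \<nu> K \<longleftrightarrow> pseudo_closed \<mu> \<nu> K \<and> Phi0_set \<mu> \<nu> K = Phi_set \<mu> \<nu> K"

end

theory Submission
  imports Defs
begin

text \<open>Suppose that \<open>\<Phi>\<close> vanishes on \<open>E\<close> but has distance at least \<open>d > 0\<close>, in the norm of
  \<open>V(X, Y)\<close>, from all functions that vanish near \<open>E\<close>. The idea is to turn this distance into a
  lower bound for square integrals with respect to a suitable pair of measures, and to contradict
  that bound with operator synthesis for this pair.
  
  Consider finite sums \<open>\<Sum> p\<^sub>i \<otimes> q\<^sub>i\<close> of continuous functions (lists, evaluated by \<open>tens\<close>) that represent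
  some \<open>\<Phi> - \<psi>\<close>, with \<open>\<psi>\<close> vanishing near \<open>E\<close>, up to an error \<open>d / 2\<close>. By Grothendieck's inequality, in
  the form that the projective tensor norm is at most a constant times the Haagerup norm
  (\<open>Grothendieck\<close>), \<open>\<Sum> |p\<^sub>i|\<^sup>2\<close> or \<open>\<Sum> |q\<^sub>i|\<^sup>2\<close> must be at least \<open>d / 16\<close> somewhere. The pairs
  \<open>(\<Sum> |p\<^sub>i|\<^sup>2, \<Sum> |q\<^sub>i|\<^sup>2)\<close> form a convex set, because lists can be scaled and concatenated. The
  Hahn-Banach theorem (\<open>Mazur_Orlicz\<close>) and the Riesz theorem (\<open>Riesz_Markov_compact\<close>) therefore
  give finite measures \<open>\<mu>\<close>, \<open>\<nu>\<close> with \<open>\<integral> \<Sum> |p\<^sub>i|\<^sup>2 d\<mu> + \<integral> \<Sum> |q\<^sub>i|\<^sup>2 d\<nu> \<ge> d / 16\<close> for all these sums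
  (\<open>measures_bounding_distance\<close>). This bound plays the role of the domination of a bounded
  bilinear form on \<open>C(X) \<times> C(Y)\<close> by two \<open>L\<^sub>2\<close> norms.
  
  Operator synthesis for \<open>\<mu>\<close>, \<open>\<nu>\<close> provides \<open>G\<close> vanishing on a pseudo-open set around \<open>E\<close> such that
  \<open>\<Phi> - G = \<Sum> f\<^sub>n \<otimes> g\<^sub>n\<close> marginally almost everywhere with small square sums. Write also
  \<open>\<Phi> = \<Sum> a\<^sub>n \<otimes> b\<^sub>n\<close> with continuous factors. Then the interleaved families \<open>a\<^sub>0, -f\<^sub>0, a\<^sub>1, -f\<^sub>1, ...\<close> and
  \<open>b\<^sub>0, g\<^sub>0, b\<^sub>1, g\<^sub>1, ...\<close> represent \<open>G\<close>. They can be approximated, in the square-summable sense, by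
  continuous families \<open>h\<close>, \<open>k\<close> whose sum \<open>\<psi>\<close> vanishes near \<open>E\<close> (\<open>continuous_approximation\<close>), and
  \<open>\<Phi> - \<psi> = \<Sum> (a\<^sub>n - h\<^sub>2\<^sub>n) \<otimes> b\<^sub>n + h\<^sub>2\<^sub>n \<otimes> (b\<^sub>n - k\<^sub>2\<^sub>n) - h\<^sub>2\<^sub>n\<^sub>+\<^sub>1 \<otimes> k\<^sub>2\<^sub>n\<^sub>+\<^sub>1\<close>. In the first two groups
  one factor is small, in the third both are, so after rescaling the factors the square integrals of
  a partial sum fall below \<open>d / 16\<close> (\<open>operator_synthesis_small_corrections\<close>).
  
  The approximation rests on a compactness argument. By regularity there are closed sets \<open>S\<close>, \<open>T\<close> of
  almost full measure on which the countably many rectangles making up the pseudo-open set are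
  relatively open, so that finitely many of them cover the compact set \<open>E \<inter> (S \<times> T)\<close>. Cut \<open>S\<close> and
  \<open>T\<close> into finitely many cells that decide membership in the sides of these rectangles and on which
  the families are nearly constant, and replace each function by its values at sample points, spread
  out by bump functions. On the product of the cells of \<open>x\<close> and \<open>y\<close> the coefficient of the new sum is
  \<open>\<Sum> f\<^sub>n(x) g\<^sub>n(y)\<close>. It is zero if that product lies in one of the rectangles, and otherwise the
  product is disjoint from \<open>E\<close>, so the bumps can be kept away from \<open>E\<close>.\<close>

section \<open>The Hahn-Banach theorem for sublinear functionals\<close>

definition sublinear :: "('v::real_vector \<Rightarrow> real) \<Rightarrow> bool" where
  "sublinear p \<longleftrightarrow> (\<forall>x y. p (x + y) \<le> p x + p y) \<and> (\<forall>c x. 0 \<le> c \<longrightarrow> p (c *\<^sub>R x) = c * p x)"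

lemma sublinearD:
  assumes "sublinear p"
  shows "p (x + y) \<le> p x + p y" and "0 \<le> c \<Longrightarrow> p (c *\<^sub>R x) = c * p x" and "p 0 = 0"
    and "- p (- x) \<le> p x"
proof -
  have sub: "p (x + y) \<le> p x + p y" for x y
    using assms by (auto simp: sublinear_def)
  have hom: "0 \<le> c \<Longrightarrow> p (c *\<^sub>R x) = c * p x" for c x
    using assms by (auto simp: sublinear_def)
  show zero: "p 0 = 0" using hom[of 0 0] by simp
  show "p (x + y) \<le> p x + p y" "0 \<le> c \<Longrightarrow> p (c *\<^sub>R x) = c * p x"
    using sub hom by auto
  show "- p (- x) \<le> p x" using sub[of x "- x"] zero by simp
qed

lemma sublinearI:
  assumes sub: "\<And>x y. p (x + y) \<le> p x + p y"
    and le: "\<And>c x. 0 < c \<Longrightarrow> p (c *\<^sub>R x) \<le> c * p x" and z: "p 0 = 0"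
  shows "sublinear p"
  unfolding sublinear_def
proof (intro conjI allI impI)
  fix c :: real and x
  assume "0 \<le> c"
  show "p (c *\<^sub>R x) = c * p x"
  proof (cases "c = 0")
    case True
    then show ?thesis by (simp add: z)
  next
    case False
    then have c: "0 < c" using \<open>0 \<le> c\<close> by simp
    have "p x = p (inverse c *\<^sub>R (c *\<^sub>R x))" using c by simp
    also have "\<dots> \<le> inverse c * p (c *\<^sub>R x)" by (rule le) (use c in simp)
    finally have "c * p x \<le> p (c *\<^sub>R x)" using c by (simp add: field_simps)
    then show ?thesis using le[OF c, of x] by simp
  qed
qed (rule sub)

text \<open>Subadditivity survives the infimum only because any two members have a common lower bound among
  them; this is what makes Zorn's lemma applicable to sublinear functionals.\<close>

lemma sublinear_INF:
  fixes C :: "('v::real_vector \<Rightarrow> real) set"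
  assumes ne: "C \<noteq> {}" and sl: "\<And>q. q \<in> C \<Longrightarrow> sublinear q"
    and bd: "\<And>x. bdd_below ((\<lambda>q. q x) ` C)"
    and dir: "\<And>q r. q \<in> C \<Longrightarrow> r \<in> C \<Longrightarrow> q \<le> r \<or> r \<le> q"
  shows "sublinear (\<lambda>x. INF q\<in>C. q x)"
proof (rule sublinearI)
  fix x y
  have *: "(INF q\<in>C. q (x + y)) \<le> q x + r y" if q: "q \<in> C" and r: "r \<in> C" for q r
  proof -
    obtain s where s: "s \<in> C" "s \<le> q" "s \<le> r"
      using dir[OF q r] q r by auto
    have "(INF q\<in>C. q (x + y)) \<le> s (x + y)" by (rule cINF_lower[OF bd s(1)])
    also have "\<dots> \<le> s x + s y" by (rule sublinearD(1)[OF sl[OF s(1)]])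
    also have "\<dots> \<le> q x + r y" using s by (auto simp: le_fun_def intro: add_mono)
    finally show ?thesis .
  qed
  have "(INF q\<in>C. q (x + y)) - r y \<le> (INF q\<in>C. q x)" if r: "r \<in> C" for r
    using *[OF _ r] by (intro cINF_greatest[OF ne]) (simp add: algebra_simps)
  then have "(INF q\<in>C. q (x + y)) - (INF q\<in>C. q x) \<le> (INF q\<in>C. q y)"
    by (intro cINF_greatest[OF ne]) (smt (verit))
  then show "(INF q\<in>C. q (x + y)) \<le> (INF q\<in>C. q x) + (INF q\<in>C. q y)" by simp
next
  fix c :: real and x
  assume c: "0 < c"
  have "(INF q\<in>C. q (c *\<^sub>R x)) / c \<le> q x" if q: "q \<in> C" for q
    using cINF_lower[OF bd q, of "c *\<^sub>R x"] sublinearD(2)[OF sl[OF q], of c x] c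
    by (simp add: field_simps)
  then have "(INF q\<in>C. q (c *\<^sub>R x)) / c \<le> (INF q\<in>C. q x)" by (rule cINF_greatest[OF ne])
  then show "(INF q\<in>C. q (c *\<^sub>R x)) \<le> c * (INF q\<in>C. q x)" using c by (simp add: field_simps)
next
  have "(\<lambda>q. q 0) ` C = {0}" using sublinearD(3)[OF sl] ne by force
  then show "(INF q\<in>C. q 0) = 0" by simp
qed

text \<open>Making a sublinear \<open>q\<close> as additive as possible in the direction \<open>v\<close> leads to the functional
  \<open>w \<mapsto> inf {q (w + t v) - t q v | t \<ge> 0}\<close>, again sublinear and below \<open>q\<close>. For minimal \<open>q\<close> it equals
  \<open>q\<close>, and \<open>t = 1\<close> then gives \<open>q w + q v \<le> q (w + v)\<close>.\<close>

lemma minimal_sublinear_linear: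
  assumes q: "sublinear q" and min: "\<And>r. sublinear r \<Longrightarrow> r \<le> q \<Longrightarrow> r = q"
  shows "linear q"
proof -
  have add: "q (w + v) = q w + q v" for w v
  proof -
    define S where "S w = (\<lambda>t. q (w + t *\<^sub>R v) - t * q v) ` {0..}" for w
    define r where "r w = Inf (S w)" for w
    have lb: "- q (- w) \<le> q (w + t *\<^sub>R v) - t * q v" if "0 \<le> t" for t w
      using sublinearD(1)[OF q, of "w + t *\<^sub>R v" "- w"] sublinearD(2)[OF q that, of v] by simp
    have bd: "bdd_below (S w)" for w
      using lb by (auto simp: S_def intro!: bdd_belowI)
    have ne: "S w \<noteq> {}" for w by (auto simp: S_def)
    have le: "r w \<le> q (w + t *\<^sub>R v) - t * q v" if "0 \<le> t" for t w
      unfolding r_def using that by (intro cInf_lower bd) (auto simp: S_def)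
    have "sublinear r"
    proof (rule sublinearI)
      fix x y
      have *: "r (x + y) \<le> a + b" if "a \<in> S x" "b \<in> S y" for a b
      proof -
        obtain s t where s: "0 \<le> s" "a = q (x + s *\<^sub>R v) - s * q v"
          and t: "0 \<le> t" "b = q (y + t *\<^sub>R v) - t * q v"
          using \<open>a \<in> S x\<close> \<open>b \<in> S y\<close> by (auto simp: S_def)
        have "r (x + y) \<le> q ((x + y) + (s + t) *\<^sub>R v) - (s + t) * q v"
          using s t by (intro le) auto
        also have "(x + y) + (s + t) *\<^sub>R v = (x + s *\<^sub>R v) + (y + t *\<^sub>R v)"
          by (simp add: algebra_simps)
        also have "q \<dots> \<le> q (x + s *\<^sub>R v) + q (y + t *\<^sub>R v)" by (rule sublinearD(1)[OF q])
        finally show ?thesis using s t by (simp add: algebra_simps)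
      qed
      have "r (x + y) - b \<le> r x" if "b \<in> S y" for b
        unfolding r_def[of x] using *[OF _ that] by (intro cInf_greatest[OF ne]) (simp add: algebra_simps)
      then have "r (x + y) - r x \<le> r y"
        unfolding r_def[of y] by (intro cInf_greatest[OF ne]) (smt (verit))
      then show "r (x + y) \<le> r x + r y" by simp
    next
      fix c :: real and x
      assume c: "0 < c"
      have "r (c *\<^sub>R x) / c \<le> a" if "a \<in> S x" for a
      proof -
        obtain t where t: "0 \<le> t" "a = q (x + t *\<^sub>R v) - t * q v"
          using \<open>a \<in> S x\<close> by (auto simp: S_def)
        have "r (c *\<^sub>R x) \<le> q (c *\<^sub>R x + (c * t) *\<^sub>R v) - (c * t) * q v"
          using c t by (intro le) auto
        also have "c *\<^sub>R x + (c * t) *\<^sub>R v = c *\<^sub>R (x + t *\<^sub>R v)" by (simp add: algebra_simps)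
        also have "q \<dots> = c * q (x + t *\<^sub>R v)" using c by (simp add: sublinearD(2)[OF q])
        also have "c * q (x + t *\<^sub>R v) - c * t * q v = c * a" unfolding t(2) by (simp add: right_diff_distrib)
        finally show ?thesis using c by (simp add: field_simps)
      qed
      then have "r (c *\<^sub>R x) / c \<le> r x" unfolding r_def[of x] by (intro cInf_greatest[OF ne])
      then show "r (c *\<^sub>R x) \<le> c * r x" using c by (simp add: field_simps)
    next
      have "S 0 = {0}" using sublinearD(2,3)[OF q] by (force simp: S_def)
      then show "r 0 = 0" by (simp add: r_def)
    qed
    moreover have "r \<le> q" using le[of 0] by (auto simp: le_fun_def)
    ultimately have "r = q" by (rule min)
    then have "q w \<le> q (w + v) - q v" using le[of 1 w] by simp
    then show ?thesis using sublinearD(1)[OF q, of w v] by simp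
  qed
  have neg: "q (- x) = - q x" for x using add[of x "- x"] sublinearD(3)[OF q] by simp
  show "linear q"
  proof (rule linearI)
    fix c :: real and x
    show "q (c *\<^sub>R x) = c *\<^sub>R q x"
    proof (cases "0 \<le> c")
      case True
      then show ?thesis by (simp add: sublinearD(2)[OF q])
    next
      case False
      then have "q ((- c) *\<^sub>R (- x)) = (- c) * q (- x)" by (intro sublinearD(2)[OF q]) auto
      then show ?thesis by (simp add: neg)
    qed
  qed (rule add)
qed

theorem Hahn_Banach_sublinear:
  assumes p: "sublinear p"
  obtains L where "linear L" "\<And>x. L x \<le> p x"
proof -
  define A where "A = {q. sublinear q \<and> q \<le> p}"
  have pA: "p \<in> A" using p by (simp add: A_def)
  have po: "partial_order_on A (relation_of (\<ge>) A)"
    by (auto simp: partial_order_on_def preorder_on_def refl_on_def trans_def antisym_def relation_of_def)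
  have "\<exists>m\<in>A. \<forall>a\<in>A. m \<ge> a \<longrightarrow> a = m"
  proof (rule predicate_Zorn[OF po])
    fix C
    assume C: "C \<in> Chains (relation_of (\<ge>) A)"
    have CA: "C \<subseteq> A" and dir: "\<And>q r. q \<in> C \<Longrightarrow> r \<in> C \<Longrightarrow> q \<le> r \<or> r \<le> q"
      using C by (auto simp: Chains_def relation_of_def)
    show "\<exists>u\<in>A. \<forall>a\<in>C. a \<ge> u"
    proof (cases "C = {}")
      case True
      then show ?thesis using pA by auto
    next
      case False
      have sl: "sublinear q" and qp: "q \<le> p" if "q \<in> C" for q
        using that CA by (auto simp: A_def)
      have "- p (- x) \<le> q x" if "q \<in> C" for q x
        using sublinearD(4)[OF sl[OF that], of x] qp[OF that] by (auto simp: le_fun_def intro: order_trans[rotated])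
      then have bd: "bdd_below ((\<lambda>q. q x) ` C)" for x
        by (auto intro!: bdd_belowI)
      let ?u = "\<lambda>x. INF q\<in>C. q x"
      have u: "?u \<le> q" if "q \<in> C" for q
        unfolding le_fun_def using cINF_lower[OF bd that] by auto
      obtain q where "q \<in> C" using False by auto
      then have "?u \<le> p" using u qp order_trans by blast
      moreover have "sublinear ?u" by (rule sublinear_INF[OF False sl bd dir])
      ultimately have "?u \<in> A" by (simp add: A_def)
      then show ?thesis using u by blast
    qed
  qed
  then obtain m where m: "m \<in> A" "\<And>a. a \<in> A \<Longrightarrow> a \<le> m \<Longrightarrow> a = m" by blast
  have "linear m"
  proof (rule minimal_sublinear_linear)
    show "sublinear m" using m(1) by (simp add: A_def)
    fix r assume "sublinear r" "r \<le> m"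
    then show "r = m" using m(1) by (intro m(2)) (auto simp: A_def)
  qed
  then show ?thesis using m(1) that by (auto simp: A_def le_fun_def)
qed

text \<open>A separation theorem without topology: the Hahn-Banach theorem is applied to
  \<open>p w = inf {S (w + t r) - t c | t \<ge> 0, r \<in> R}\<close>, which lies below \<open>S\<close> and satisfies \<open>p (- r) \<le> - c\<close>.
  Convexity of \<open>R\<close> makes \<open>p\<close> subadditive, and the bound \<open>S \<ge> c\<close> on \<open>R\<close> keeps it finite.\<close>

theorem Mazur_Orlicz:
  fixes S :: "'v::real_vector \<Rightarrow> real"
  assumes S: "sublinear S" and R: "convex R" "\<And>r. r \<in> R \<Longrightarrow> c \<le> S r"
  obtains L where "linear L" "\<And>x. L x \<le> S x" "\<And>r. r \<in> R \<Longrightarrow> c \<le> L r"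
proof (cases "R = {}")
  case True
  obtain L where "linear L" "\<And>x. L x \<le> S x" using Hahn_Banach_sublinear[OF S] by blast
  then show ?thesis using that True by blast
next
  case False
  define T where "T w = (\<lambda>(t, r). S (w + t *\<^sub>R r) - t * c) ` ({0..} \<times> R)" for w
  define p where "p w = Inf (T w)" for w
  have ne: "T w \<noteq> {}" for w using False by (auto simp: T_def)
  have lb: "- S (- w) \<le> S (w + t *\<^sub>R r) - t * c" if "0 \<le> t" "r \<in> R" for t r w
    using sublinearD(1)[OF S, of "w + t *\<^sub>R r" "- w"] sublinearD(2)[OF S \<open>0 \<le> t\<close>, of r]
      mult_left_mono[OF R(2)[OF \<open>r \<in> R\<close>] \<open>0 \<le> t\<close>] by simp
  have bd: "bdd_below (T w)" for w using lb by (auto simp: T_def intro!: bdd_belowI)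
  have le: "p w \<le> S (w + t *\<^sub>R r) - t * c" if "0 \<le> t" "r \<in> R" for t r w
    unfolding p_def using that by (intro cInf_lower bd) (auto simp: T_def)
  obtain r0 where r0: "r0 \<in> R" using False by auto
  have pS: "p w \<le> S w" for w using le[of 0 r0 w] r0 by simp
  have "sublinear p"
  proof (rule sublinearI)
    fix x y
    have *: "p (x + y) \<le> a + b" if "a \<in> T x" "b \<in> T y" for a b
    proof -
      obtain s q where s: "0 \<le> s" "q \<in> R" "a = S (x + s *\<^sub>R q) - s * c"
        using \<open>a \<in> T x\<close> by (auto simp: T_def)
      obtain t r where t: "0 \<le> t" "r \<in> R" "b = S (y + t *\<^sub>R r) - t * c"
        using \<open>b \<in> T y\<close> by (auto simp: T_def)
      have "\<exists>z\<in>R. (s + t) *\<^sub>R z = s *\<^sub>R q + t *\<^sub>R r"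
      proof (cases "s + t = 0")
        case True
        then have "s = 0" "t = 0" using s(1) t(1) by linarith+
        then show ?thesis using r0 by (intro bexI[of _ r0]) auto
      next
        case False
        then have "0 < s + t" using s t by auto
        then have "(s / (s + t)) *\<^sub>R q + (t / (s + t)) *\<^sub>R r \<in> R"
          using s t by (intro convexD[OF R(1)]) (auto simp: add_divide_distrib[symmetric])
        then show ?thesis using False by (intro bexI) (auto simp: scaleR_right_distrib)
      qed
      then obtain z where z: "z \<in> R" "(s + t) *\<^sub>R z = s *\<^sub>R q + t *\<^sub>R r" by blast
      have "p (x + y) \<le> S ((x + y) + (s + t) *\<^sub>R z) - (s + t) * c"
        using s t z by (intro le) auto
      also have "(x + y) + (s + t) *\<^sub>R z = (x + s *\<^sub>R q) + (y + t *\<^sub>R r)"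
        unfolding z(2) by simp
      also have "S \<dots> \<le> S (x + s *\<^sub>R q) + S (y + t *\<^sub>R r)" by (rule sublinearD(1)[OF S])
      finally show ?thesis using s t by (simp add: algebra_simps)
    qed
    have "p (x + y) - b \<le> p x" if "b \<in> T y" for b
      unfolding p_def[of x] using *[OF _ that] by (intro cInf_greatest[OF ne]) (simp add: algebra_simps)
    then have "p (x + y) - p x \<le> p y"
      unfolding p_def[of y] by (intro cInf_greatest[OF ne]) (smt (verit))
    then show "p (x + y) \<le> p x + p y" by simp
  next
    fix k :: real and x
    assume k: "0 < k"
    have "p (k *\<^sub>R x) / k \<le> a" if "a \<in> T x" for a
    proof -
      obtain t r where t: "0 \<le> t" "r \<in> R" "a = S (x + t *\<^sub>R r) - t * c"
        using \<open>a \<in> T x\<close> by (auto simp: T_def)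
      have "p (k *\<^sub>R x) \<le> S (k *\<^sub>R x + (k * t) *\<^sub>R r) - (k * t) * c"
        using k t by (intro le) auto
      also have "k *\<^sub>R x + (k * t) *\<^sub>R r = k *\<^sub>R (x + t *\<^sub>R r)" by (simp add: algebra_simps)
      also have "S \<dots> = k * S (x + t *\<^sub>R r)" using k by (simp add: sublinearD(2)[OF S])
      also have "k * S (x + t *\<^sub>R r) - k * t * c = k * a" unfolding t(3) by (simp add: right_diff_distrib)
      finally show ?thesis using k by (simp add: field_simps)
    qed
    then have "p (k *\<^sub>R x) / k \<le> p x" unfolding p_def[of x] by (intro cInf_greatest[OF ne])
    then show "p (k *\<^sub>R x) \<le> k * p x" using k by (simp add: field_simps)
  next
    have "0 \<le> p 0" unfolding p_def
    proof (rule cInf_greatest[OF ne])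
      fix a assume "a \<in> T 0"
      then show "0 \<le> a" using lb[where w = 0] sublinearD(3)[OF S] by (auto simp: T_def)
    qed
    then show "p 0 = 0" using pS[of 0] sublinearD(3)[OF S] by simp
  qed
  then obtain L where L: "linear L" "\<And>x. L x \<le> p x" by (rule Hahn_Banach_sublinear) blast
  have "c \<le> L r" if "r \<in> R" for r
    using L(2)[of "- r"] le[of 1 r "- r"] that sublinearD(3)[OF S] linear_neg[OF L(1), of r] by simp
  then show ?thesis using that L pS order_trans by blast
qed

section \<open>The Riesz representation theorem on a compact metric space\<close>

lemma apply_Bcontfun_compact:
  fixes f :: "'a::topological_space \<Rightarrow> 'b::metric_space"
  assumes "compact (UNIV :: 'a set)" "continuous_on UNIV f"
  shows "apply_bcontfun (Bcontfun f) = f"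
  using assms compact_continuous_image[OF assms(2,1)]
  by (intro Bcontfun_inverse) (auto simp: bcontfun_def compact_imp_bounded)

text \<open>The outer measure of Daniell's construction: a set is covered by series of nonnegative continuous
  functions instead of by sets. Countable subadditivity then follows by merging series.\<close>

definition daniell :: "(('a::metric_space \<Rightarrow>\<^sub>C real) \<Rightarrow> real) \<Rightarrow> 'a set \<Rightarrow> ennreal" where
  "daniell L A = (INF f\<in>{f. (\<forall>n x. 0 \<le> apply_bcontfun (f n) x) \<and>
      (\<forall>x\<in>A. 1 \<le> (\<Sum>n. ennreal (apply_bcontfun (f n) x)))}. \<Sum>n::nat. ennreal (L (f n)))"

lemma daniell_le:
  assumes "\<And>n x. 0 \<le> apply_bcontfun (f n) x"
    and "\<And>x. x \<in> A \<Longrightarrow> 1 \<le> (\<Sum>n. ennreal (apply_bcontfun (f n) x))"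
  shows "daniell L A \<le> (\<Sum>n. ennreal (L (f n)))"
  unfolding daniell_def using assms by (intro INF_lower) auto

lemma daniell_greatest:
  assumes "\<And>f. (\<And>n x. 0 \<le> apply_bcontfun (f n) x) \<Longrightarrow>
      (\<And>x. x \<in> A \<Longrightarrow> 1 \<le> (\<Sum>n. ennreal (apply_bcontfun (f n) x))) \<Longrightarrow> c \<le> (\<Sum>n. ennreal (L (f n)))"
  shows "c \<le> daniell L A"
  unfolding daniell_def using assms by (intro INF_greatest) auto

lemma suminf_prod_decode_ennreal:
  fixes F :: "nat \<Rightarrow> nat \<Rightarrow> ennreal"
  shows "(\<Sum>n. case_prod F (prod_decode n)) = (\<Sum>i. \<Sum>j. F i j)"
  using suminf_ennreal_2dimen[of "\<lambda>i. \<Sum>j. F i j" "case_prod F"] by (simp add: comp_def)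

lemma daniell_le_2dimen:
  assumes "\<And>i j x. 0 \<le> apply_bcontfun (f i j) x"
    and "\<And>x. x \<in> A \<Longrightarrow> 1 \<le> (\<Sum>i. \<Sum>j. ennreal (apply_bcontfun (f i j) x))"
  shows "daniell L A \<le> (\<Sum>i. \<Sum>j. ennreal (L (f i j)))"
proof -
  let ?g = "\<lambda>n. case_prod f (prod_decode n)"
  have eq: "(\<Sum>n. ennreal (h (?g n))) = (\<Sum>i. \<Sum>j. ennreal (h (f i j)))" for h
    using suminf_prod_decode_ennreal[of "\<lambda>i j. ennreal (h (f i j))"]
    by (simp add: case_prod_unfold)
  have "daniell L A \<le> (\<Sum>n. ennreal (L (?g n)))"
  proof (rule daniell_le)
    show "0 \<le> apply_bcontfun (?g n) x" for n x
      using assms(1) by (simp add: case_prod_unfold)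
    show "1 \<le> (\<Sum>n. ennreal (apply_bcontfun (?g n) x))" if "x \<in> A" for x
      using assms(2)[OF that] eq[of "\<lambda>u. apply_bcontfun u x"] by simp
  qed
  then show ?thesis using eq[of L] by simp
qed

lemma daniell_mono: "A \<subseteq> B \<Longrightarrow> daniell L A \<le> daniell L B"
  by (rule daniell_greatest, rule daniell_le) auto

lemma daniell_empty:
  assumes "linear L" shows "daniell L {} = 0"
proof -
  have "daniell L {} \<le> (\<Sum>n::nat. ennreal (L 0))" by (rule daniell_le) auto
  then show ?thesis by (simp add: linear_0[OF assms])
qed

lemma daniell_subadditive:
  "daniell L (\<Union>i. A i) \<le> (\<Sum>i::nat. daniell L (A i))"
proof (cases "(\<Sum>i. daniell L (A i)) = top")
  case True
  then show ?thesis by simp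
next
  case False
  then have fin: "daniell L (A i) < top" for i
    using ennreal_suminf_lessD[of "\<lambda>i. daniell L (A i)" top i] by (simp add: top.not_eq_extremum)
  show ?thesis
  proof (rule ennreal_le_epsilon)
    fix e :: real
    assume e: "0 < e"
    have "\<exists>f. (\<forall>n x. 0 \<le> apply_bcontfun (f n) x) \<and> (\<forall>x\<in>A i. 1 \<le> (\<Sum>n. ennreal (apply_bcontfun (f n) x)))
        \<and> (\<Sum>n::nat. ennreal (L (f n))) < daniell L (A i) + ennreal (e * (1/2) ^ Suc i)" for i
    proof -
      have "daniell L (A i) < daniell L (A i) + ennreal (e * (1/2) ^ Suc i)"
        using fin[of i] e by (simp add: ennreal_zero_less_mult_iff)
      then show ?thesis
        unfolding daniell_def[of L "A i"] by (subst (asm) INF_less_iff) auto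
    qed
    then obtain f where f: "\<And>i n x. 0 \<le> apply_bcontfun (f i n) x"
        "\<And>i x. x \<in> A i \<Longrightarrow> 1 \<le> (\<Sum>n. ennreal (apply_bcontfun (f i n) x))"
        "\<And>i. (\<Sum>n::nat. ennreal (L (f i n))) < daniell L (A i) + ennreal (e * (1/2) ^ Suc i)"
      by metis
    have "daniell L (\<Union>i. A i) \<le> (\<Sum>i. \<Sum>n. ennreal (L (f i n)))"
    proof (rule daniell_le_2dimen)
      fix x assume "x \<in> (\<Union>i. A i)"
      then obtain i where "x \<in> A i" by auto
      then have "1 \<le> (\<Sum>n. ennreal (apply_bcontfun (f i n) x))" by (rule f)
      also have "\<dots> = (\<Sum>i\<in>{i}. \<Sum>n. ennreal (apply_bcontfun (f i n) x))" by simp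
      also have "\<dots> \<le> (\<Sum>i. \<Sum>n. ennreal (apply_bcontfun (f i n) x))"
        by (rule sum_le_suminf) auto
      finally show "1 \<le> (\<Sum>i. \<Sum>n. ennreal (apply_bcontfun (f i n) x))" .
    qed (rule f)
    also have "\<dots> \<le> (\<Sum>i. daniell L (A i) + ennreal (e * (1/2) ^ Suc i))"
      using f(3) by (intro suminf_le) (auto intro: less_imp_le)
    also have "\<dots> = (\<Sum>i. daniell L (A i)) + (\<Sum>i. ennreal (e * (1/2) ^ Suc i))"
      by (rule suminf_add[symmetric]) auto
    also have "(\<Sum>i. ennreal (e * (1/2) ^ Suc i)) = ennreal e"
      using sums_mult[OF power_half_series, of e] e
      by (intro suminf_ennreal_eq) auto
    finally show "daniell L (\<Union>i. A i) \<le> (\<Sum>i. daniell L (A i)) + ennreal e" .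
  qed
qed

lemma daniell_outer_measure_space:
  "linear L \<Longrightarrow> outer_measure_space (Pow UNIV) (daniell L)"
  by (auto simp: outer_measure_space_def positive_def increasing_def countably_subadditive_def
      daniell_empty daniell_mono daniell_subadditive)

locale positive_functional =
  fixes L :: "('a::metric_space \<Rightarrow>\<^sub>C real) \<Rightarrow> real"
  assumes compact_UNIV: "compact (UNIV :: 'a set)"
    and linear: "linear L"
    and nonneg: "\<And>u. (\<And>x. 0 \<le> apply_bcontfun u x) \<Longrightarrow> 0 \<le> L u"
begin

lemma mono: "(\<And>x. apply_bcontfun u x \<le> apply_bcontfun v x) \<Longrightarrow> L u \<le> L v"
  using nonneg[of "v - u"] by (simp add: linear_diff[OF linear])

text \<open>The Caratheodory condition for a closed set \<open>C\<close>. The cut-offs \<open>\<theta> k\<close> vanish on \<open>C\<close> and increase to 1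
  off \<open>C\<close>. Given a cover \<open>f\<close> of \<open>A\<close>, the functions \<open>f n (1 - \<theta> k)\<close> cover \<open>A \<inter> C\<close> for each \<open>k\<close>, while the
  increments \<open>f n (\<theta> (k + 1) - \<theta> k)\<close>, over all \<open>n\<close> and \<open>k\<close>, cover \<open>A - C\<close> and have total weight
  \<open>\<Sum>\<^sub>n sup\<^sub>k L (f n \<theta> k)\<close>.\<close>

lemma daniell_closed_split:
  assumes C: "closed C" "C \<noteq> {}"
  shows "daniell L (A - C) + daniell L (A \<inter> C) \<le> daniell L A"
proof (rule daniell_greatest)
  fix f :: "nat \<Rightarrow> 'a \<Rightarrow>\<^sub>C real"
  assume f: "\<And>n x. 0 \<le> apply_bcontfun (f n) x"
    "\<And>x. x \<in> A \<Longrightarrow> 1 \<le> (\<Sum>n. ennreal (apply_bcontfun (f n) x))"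
  define \<theta> where "\<theta> k x = min 1 (real k * infdist x C)" for k x
  have \<theta>: "0 \<le> \<theta> k x" "\<theta> k x \<le> 1" "\<theta> k x \<le> \<theta> (Suc k) x" "\<theta> 0 x = 0" for k x
    using infdist_nonneg[of x C] by (auto simp: \<theta>_def min_def mult_right_mono algebra_simps)
  have \<theta>C: "x \<in> C \<Longrightarrow> \<theta> k x = 0" for k x by (simp add: \<theta>_def)
  have lim: "(\<lambda>k. \<theta> k x) \<longlonglongrightarrow> 1" if "x \<notin> C" for x
  proof -
    have "0 < infdist x C"
      using that C infdist_nonneg[of x C] in_closed_iff_infdist_zero by (metis order_le_less)
    then obtain K where K: "1 < real K * infdist x C" using ex_less_of_nat_mult by blast
    have "\<forall>\<^sub>F k in sequentially. \<theta> k x = 1"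
      using eventually_ge_at_top[of K]
    proof eventually_elim
      case (elim k)
      then have "real K * infdist x C \<le> real k * infdist x C" by (intro mult_right_mono infdist_nonneg) auto
      then show ?case using K by (simp add: \<theta>_def)
    qed
    then show ?thesis by (rule tendsto_eventually)
  qed
  define F where "F n k = Bcontfun (\<lambda>x. apply_bcontfun (f n) x * \<theta> k x)" for n k
  have F: "apply_bcontfun (F n k) x = apply_bcontfun (f n) x * \<theta> k x" for n k x
    unfolding F_def \<theta>_def
    by (subst apply_Bcontfun_compact[OF compact_UNIV]) (auto intro!: continuous_intros)
  have LF: "0 \<le> L (F n k)" "L (F n k) \<le> L (F n (Suc k))" "0 \<le> L (f n - F n k)" "L (F n 0) = 0"
    for n k
  proof -
    show "0 \<le> L (F n k)" "L (F n k) \<le> L (F n (Suc k))" "0 \<le> L (f n - F n k)"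
      using f(1) \<theta> by (auto intro!: nonneg mono mult_left_mono simp: F mult_left_le)
    have "F n 0 = 0" by (rule bcontfun_eqI) (simp add: F \<theta>)
    then show "L (F n 0) = 0" by (simp add: linear_0[OF linear])
  qed
  have open_part: "daniell L (A - C) \<le> (\<Sum>n. SUP k. ennreal (L (F n k)))"
  proof -
    have le: "daniell L (A - C) \<le> (\<Sum>n. \<Sum>k. ennreal (L (F n (Suc k) - F n k)))"
    proof (rule daniell_le_2dimen)
      show "0 \<le> apply_bcontfun (F n (Suc k) - F n k) x" for n k x
        using f(1) \<theta> by (auto intro!: mult_left_mono simp: F)
      fix x assume x: "x \<in> A - C"
      have "(\<lambda>k. apply_bcontfun (F n (Suc k) - F n k) x) sums (apply_bcontfun (f n) x - 0)" for n
        using telescope_sums[OF tendsto_mult_left[OF lim[of x], of "apply_bcontfun (f n) x"]] x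
        by (simp add: F \<theta>)
      then have "(\<Sum>k. ennreal (apply_bcontfun (F n (Suc k) - F n k) x)) = ennreal (apply_bcontfun (f n) x)" for n
        using f(1) \<theta> by (intro suminf_ennreal_eq) (auto intro!: mult_left_mono simp: F)
      then show "1 \<le> (\<Sum>n. \<Sum>k. ennreal (apply_bcontfun (F n (Suc k) - F n k) x))"
        using f(2)[of x] x by simp
    qed
    have tele: "(\<Sum>k. ennreal (L (F n (Suc k) - F n k))) = (SUP k. ennreal (L (F n k)))" for n
    proof -
      have "(\<Sum>k<K. ennreal (L (F n (Suc k) - F n k))) = ennreal (L (F n K))" for K
        using LF sum_lessThan_telescope[of "\<lambda>k. L (F n k)" K]
        by (subst sum_ennreal) (auto simp: linear_diff[OF linear])
      then show ?thesis by (simp add: suminf_eq_SUP)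
    qed
    show ?thesis using le by (simp only: tele)
  qed
  have closed_part: "daniell L (A \<inter> C) \<le> (\<Sum>n. ennreal (L (f n - F n k)))" for k
  proof (rule daniell_le)
    show "0 \<le> apply_bcontfun (f n - F n k) x" for n x
      using f(1) \<theta> by (auto simp: F mult_left_le)
    show "1 \<le> (\<Sum>n. ennreal (apply_bcontfun (f n - F n k) x))" if "x \<in> A \<inter> C" for x
      using f(2)[of x] that by (simp add: F \<theta>C)
  qed
  have split: "(\<Sum>n. ennreal (L (F n k))) + daniell L (A \<inter> C) \<le> (\<Sum>n. ennreal (L (f n)))" for k
  proof -
    have "(\<Sum>n. ennreal (L (F n k))) + daniell L (A \<inter> C)
        \<le> (\<Sum>n. ennreal (L (F n k))) + (\<Sum>n. ennreal (L (f n - F n k)))"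
      by (intro add_left_mono closed_part)
    also have "\<dots> = (\<Sum>n. ennreal (L (F n k)) + ennreal (L (f n - F n k)))"
      by (rule suminf_add) auto
    also have "\<dots> = (\<Sum>n. ennreal (L (f n)))"
      using LF by (simp add: ennreal_plus[symmetric] linear_diff[OF linear] del: ennreal_plus)
    finally show ?thesis .
  qed
  have "(\<Sum>n. SUP k. ennreal (L (F n k))) = (SUP k. \<Sum>n. ennreal (L (F n k)))"
    using LF by (intro ennreal_suminf_SUP_eq) (auto intro!: incseq_SucI)
  then have "(\<Sum>n. SUP k. ennreal (L (F n k))) + daniell L (A \<inter> C)
      = (SUP k. (\<Sum>n. ennreal (L (F n k))) + daniell L (A \<inter> C))"
    by (simp add: ennreal_SUP_add_left)
  also have "\<dots> \<le> (\<Sum>n. ennreal (L (f n)))" using split by (intro SUP_least)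
  finally show "daniell L (A - C) + daniell L (A \<inter> C) \<le> (\<Sum>n. ennreal (L (f n)))"
    using open_part by (meson add_right_mono order_trans)
qed

definition M :: "'a measure" where
  "M = measure_of UNIV (sets borel) (daniell L)"

lemma borel_subset_lambda_system: "sets borel \<subseteq> lambda_system UNIV (Pow UNIV) (daniell L)"
proof -
  interpret P: sigma_algebra UNIV "Pow UNIV :: 'a set set" by (rule sigma_algebra_Pow)
  have ms: "measure_space UNIV (lambda_system UNIV (Pow UNIV) (daniell L)) (daniell L)"
    by (rule P.caratheodory_lemma[OF daniell_outer_measure_space[OF linear]])
  have "C \<in> lambda_system UNIV (Pow UNIV) (daniell L)" if C: "closed C" for C
  proof (cases "C = {}")
    case True
    then show ?thesis by (auto simp: lambda_system_def daniell_empty[OF linear])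
  next
    case False
    have "daniell L (A \<inter> C) + daniell L (A - C) = daniell L A" for A
    proof (rule antisym)
      have "daniell L A \<le> daniell L (\<Union>i. binaryset (A \<inter> C) (A - C) i)"
        by (rule daniell_mono) (auto simp: UN_binaryset_eq)
      also have "\<dots> \<le> daniell L (A \<inter> C) + daniell L (A - C)"
        using daniell_subadditive[of L "binaryset (A \<inter> C) (A - C)"]
          suminf_binaryset_eq[of "daniell L", OF daniell_empty[OF linear]] by simp
      finally show "daniell L A \<le> daniell L (A \<inter> C) + daniell L (A - C)" .
      show "daniell L (A \<inter> C) + daniell L (A - C) \<le> daniell L A"
        using daniell_closed_split[OF C False, of A] by (simp add: add.commute)
    qed
    then show ?thesis by (auto simp: lambda_system_def Int_commute Diff_eq)
  qed
  then have "sigma_sets UNIV (Collect closed) \<subseteq> lambda_system UNIV (Pow UNIV) (daniell L)"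
    using ms unfolding measure_space_def by (intro sigma_algebra.sigma_sets_subset) auto
  then show ?thesis by (simp add: borel_eq_closed)
qed

lemma sets_M [simp]: "sets M = sets borel"
  by (simp add: M_def sets.sigma_sets_eq[of borel, simplified])

lemma space_M [simp]: "space M = UNIV"
  by (simp add: M_def)

lemma emeasure_M: "A \<in> sets borel \<Longrightarrow> emeasure M A = daniell L A"
proof -
  assume A: "A \<in> sets borel"
  interpret P: sigma_algebra UNIV "Pow UNIV :: 'a set set" by (rule sigma_algebra_Pow)
  have "measure_space UNIV (sets borel) (daniell L)"
    by (rule measure_down[OF P.caratheodory_lemma[OF daniell_outer_measure_space[OF linear]] _
          borel_subset_lambda_system])
       (use sets.sigma_algebra_axioms[of borel] in simp)
  then show ?thesis
    using A sets.sigma_sets_eq[of borel] unfolding M_def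
    by (intro emeasure_measure_of_sigma)
       (auto simp: measure_space_def intro!: sets.sigma_algebra_axioms)
qed

text \<open>This is where compactness enters, in the manner of Dini's theorem: a series that reaches \<open>g\<close>
  pointwise reaches \<open>g - e\<close> everywhere after finitely many terms, and to finite sums the positive
  functional \<open>L\<close> can be applied.\<close>

lemma functional_le_daniell:
  assumes g: "\<And>x. 0 \<le> apply_bcontfun g x" "\<And>x. apply_bcontfun g x \<le> indicator A x"
  shows "ennreal (L g) \<le> daniell L A"
proof (rule daniell_greatest)
  fix f :: "nat \<Rightarrow> 'a \<Rightarrow>\<^sub>C real"
  assume f: "\<And>n x. 0 \<le> apply_bcontfun (f n) x"
    "\<And>x. x \<in> A \<Longrightarrow> 1 \<le> (\<Sum>n. ennreal (apply_bcontfun (f n) x))"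
  let ?one = "const_bcontfun 1 :: 'a \<Rightarrow>\<^sub>C real"
  have main: "L g \<le> r" if r: "(\<Sum>n. ennreal (L (f n))) = ennreal r" "0 \<le> r" for r
  proof -
    have "L g \<le> r + e * L ?one" if e: "0 < e" for e
    proof -
      define V where "V N = {x. apply_bcontfun g x - e < (\<Sum>n<N. apply_bcontfun (f n) x)}" for N
      have "open (V N)" for N
        unfolding V_def by (intro open_Collect_less continuous_intros) auto
      moreover have "UNIV \<subseteq> (\<Union>N. V N)"
      proof
        fix x
        show "x \<in> (\<Union>N. V N)"
        proof (cases "x \<in> A")
          case True
          have "ennreal (apply_bcontfun g x - e) < 1"
            using g(2)[of x] e True by (simp add: ennreal_less_one_iff)
          also have "1 \<le> (\<Sum>n. ennreal (apply_bcontfun (f n) x))" by (rule f(2)[OF True])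
          also have "\<dots> = (SUP N. \<Sum>n<N. ennreal (apply_bcontfun (f n) x))" by (rule suminf_eq_SUP)
          finally obtain N where "ennreal (apply_bcontfun g x - e) < (\<Sum>n<N. ennreal (apply_bcontfun (f n) x))"
            by (auto simp: less_SUP_iff)
          then have "ennreal (apply_bcontfun g x - e) < ennreal (\<Sum>n<N. apply_bcontfun (f n) x)"
            using f(1) by (simp add: sum_ennreal)
          then have "apply_bcontfun g x - e < (\<Sum>n<N. apply_bcontfun (f n) x)"
            by (metis ennreal_leI linorder_not_le)
          then show ?thesis by (auto simp: V_def)
        next
          case False
          then have "x \<in> V 0" using g(2)[of x] e by (simp add: V_def)
          then show ?thesis by blast
        qed
      qed
      ultimately obtain I where I: "finite I" "UNIV \<subseteq> (\<Union>N\<in>I. V N)"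
        using compactE_image[OF compact_UNIV, of UNIV V] by (metis subset_UNIV)
      define K where "K = Max (insert 0 I)"
      have gK: "apply_bcontfun g x \<le> (\<Sum>n<K. apply_bcontfun (f n) x) + e" for x
      proof -
        obtain N where N: "N \<in> I" "x \<in> V N" using I by auto
        have "N \<le> K" using I N by (simp add: K_def)
        then have "(\<Sum>n<N. apply_bcontfun (f n) x) \<le> (\<Sum>n<K. apply_bcontfun (f n) x)"
          using f(1) by (intro sum_mono2) auto
        then show ?thesis using N(2) by (simp add: V_def)
      qed
      have app_sum: "apply_bcontfun (\<Sum>n<K. f n) x = (\<Sum>n<K. apply_bcontfun (f n) x)" for K x
        by (induction K) auto
      have "L g \<le> L ((\<Sum>n<K. f n) + e *\<^sub>R ?one)"
        using gK by (intro mono) (simp add: app_sum)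
      also have "\<dots> = (\<Sum>n<K. L (f n)) + e * L ?one"
        by (simp add: linear_add[OF linear] linear_sum[OF linear] linear_cmul[OF linear])
      also have "(\<Sum>n<K. L (f n)) \<le> r"
      proof -
        have "ennreal (\<Sum>n<K. L (f n)) = (\<Sum>n<K. ennreal (L (f n)))"
          using nonneg f(1) by (simp add: sum_ennreal)
        also have "\<dots> \<le> (\<Sum>n. ennreal (L (f n)))" by (rule sum_le_suminf) auto
        finally show ?thesis using r by (simp add: ennreal_le_iff)
      qed
      finally show ?thesis by simp
    qed
    then have "\<forall>\<^sub>F e in at_right 0. L g \<le> r + e * L ?one"
      by (auto simp: eventually_at_right_less eventually_at intro: exI[of _ 1])
    moreover have "((\<lambda>e. r + e * L ?one) \<longlongrightarrow> r + 0 * L ?one) (at_right 0)"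
      by (intro tendsto_intros)
    ultimately show ?thesis
      using tendsto_lowerbound[of "\<lambda>e. r + e * L ?one" "r + 0 * L ?one" "at_right 0" "L g"] by simp
  qed
  show "ennreal (L g) \<le> (\<Sum>n. ennreal (L (f n)))"
  proof (cases "(\<Sum>n. ennreal (L (f n))) = top")
    case False
    then obtain r where "0 \<le> r" "(\<Sum>n. ennreal (L (f n))) = ennreal r"
      by (cases "\<Sum>n. ennreal (L (f n))") auto
    then show ?thesis using main[of r] by (simp add: ennreal_leI)
  qed simp
qed

lemma emeasure_M_UNIV: "emeasure M UNIV \<le> ennreal (L (const_bcontfun 1))"
proof -
  let ?f = "\<lambda>n::nat. if n = 0 then const_bcontfun 1 else 0 :: 'a \<Rightarrow>\<^sub>C real"
  have "daniell L UNIV \<le> (\<Sum>n. ennreal (L (?f n)))"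
  proof (rule daniell_le)
    fix x :: 'a
    have "(\<Sum>n. ennreal (apply_bcontfun (?f n) x)) = (\<Sum>n\<in>{0}. ennreal (apply_bcontfun (?f n) x))"
      by (rule suminf_finite) auto
    then show "1 \<le> (\<Sum>n. ennreal (apply_bcontfun (?f n) x))" by simp
  qed auto
  also have "\<dots> = (\<Sum>n\<in>{0}. ennreal (L (?f n)))"
    by (rule suminf_finite) (auto simp: linear_0[OF linear])
  finally show ?thesis by (simp add: emeasure_M)
qed

lemma finite_measure_M: "finite_measure M"
  using emeasure_M_UNIV by (intro finite_measureI) (auto simp: top_unique)

lemma borel_measurable_bcontfun [measurable]: "apply_bcontfun u \<in> borel_measurable M"
  using borel_measurable_continuous_onI[of "apply_bcontfun u"]
  by (simp cong: measurable_cong_sets)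

lemma integrable_bcontfun: 
  fixes u :: "'a \<Rightarrow>\<^sub>C real"
  shows "integrable M (apply_bcontfun u)"
proof -
  interpret finite_measure M by (rule finite_measure_M)
  show ?thesis using norm_bounded[of u] by (intro integrable_const_bound[of _ "norm u"]) auto
qed

lemma sum_min_max_eq:
  fixes t :: real
  assumes "0 \<le> t"
  shows "(\<Sum>k<K. min 1 (max 0 (t - real k))) = min (real K) t"
  by (induction K) (use assms in \<open>auto simp: min_def max_def\<close>)

text \<open>Layer cake: \<open>N h\<close> is the sum of its layers \<open>g k\<close> between the heights \<open>k\<close> and \<open>k + 1\<close>, the layer \<open>g k\<close>
  is at most the indicator of \<open>U k = {N h > k}\<close>, and \<open>\<Sum> indicator (U k) \<le> N h + 1\<close>. Dividing by \<open>N\<close>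
  leaves as an error the total mass divided by \<open>N\<close>.\<close>

lemma functional_le_integral:
  assumes h: "\<And>x. 0 \<le> apply_bcontfun h x"
  shows "L h \<le> (\<integral>x. apply_bcontfun h x \<partial>M)"
proof -
  interpret finite_measure M by (rule finite_measure_M)
  let ?I = "\<integral>x. apply_bcontfun h x \<partial>M"
  have step: "real N * L h \<le> real N * ?I + measure M UNIV" for N :: nat
  proof -
    obtain K where K: "real N * norm h \<le> real K" using real_arch_simple by blast
    define g where "g k = Bcontfun (\<lambda>x. min 1 (max 0 (real N * apply_bcontfun h x - real k)))" for k :: nat
    have g: "apply_bcontfun (g k) x = min 1 (max 0 (real N * apply_bcontfun h x - real k))" for k x
      unfolding g_def
      by (subst apply_Bcontfun_compact[OF compact_UNIV]) (auto intro!: continuous_intros)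
    define U where "U k = {x. real k < real N * apply_bcontfun h x}" for k :: nat
    have U: "U k \<in> sets borel" for k
      unfolding U_def by (intro borel_open open_Collect_less continuous_intros) auto
    have Lg: "L (g k) \<le> measure M (U k)" for k
    proof -
      have "ennreal (L (g k)) \<le> daniell L (U k)"
        by (rule functional_le_daniell) (auto simp: g U_def indicator_def)
      also have "\<dots> = ennreal (measure M (U k))"
        using emeasure_M[OF U] by (simp add: emeasure_eq_measure)
      finally show ?thesis by simp
    qed
    have app_sum: "apply_bcontfun (\<Sum>k<K. g k) x = (\<Sum>k<K. apply_bcontfun (g k) x)" for K x
      by (induction K) auto
    have "real N *\<^sub>R h = (\<Sum>k<K. g k)"
    proof (rule bcontfun_eqI)
      fix x
      have "real N * apply_bcontfun h x \<le> real N * norm h"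
        using norm_bounded[of h x] by (intro mult_left_mono) auto
      then show "apply_bcontfun (real N *\<^sub>R h) x = apply_bcontfun (\<Sum>k<K. g k) x"
        using sum_min_max_eq[of "real N * apply_bcontfun h x" K] h[of x] K
        by (simp add: app_sum g)
    qed
    then have "real N * L h = (\<Sum>k<K. L (g k))"
      by (metis linear_cmul[OF linear] linear_sum[OF linear] real_scaleR_def)
    also have "\<dots> \<le> (\<Sum>k<K. measure M (U k))" by (intro sum_mono Lg)
    also have "\<dots> = (\<integral>x. (\<Sum>k<K. indicator (U k) x) \<partial>M)"
      using U by (subst Bochner_Integration.integral_sum) (auto simp: integrable_indicator_iff emeasure_eq_measure)
    also have "\<dots> \<le> (\<integral>x. real N * apply_bcontfun h x + 1 \<partial>M)"
    proof (rule integral_mono)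
      show "integrable M (\<lambda>x. \<Sum>k<K. indicator (U k) x :: real)"
        using U by (intro Bochner_Integration.integrable_sum) (auto simp: integrable_indicator_iff emeasure_eq_measure)
      show "integrable M (\<lambda>x. real N * apply_bcontfun h x + 1)"
        using integrable_bcontfun by auto
      fix x
      define t where "t = real N * apply_bcontfun h x"
      have t: "0 \<le> t" using h by (simp add: t_def)
      have "(\<Sum>k<K. indicator (U k) x) = (\<Sum>k<K. if real k < t then 1 else 0 :: real)"
        by (intro sum.cong) (auto simp: U_def t_def)
      also have "\<dots> \<le> t + 1"
      proof -
        have "(\<Sum>k<K. if real k < t then 1 else 0 :: real) \<le> (\<Sum>k<K. min 1 (max 0 (t + 1 - real k)))"
          by (intro sum_mono) auto
        then show ?thesis using sum_min_max_eq[of "t + 1" K] t by simp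
      qed
      finally show "(\<Sum>k<K. indicator (U k) x) \<le> real N * apply_bcontfun h x + 1" by (simp add: t_def)
    qed
    also have "\<dots> = real N * ?I + measure M UNIV"
      using integrable_bcontfun by simp
    finally show ?thesis .
  qed
  show ?thesis
  proof (rule ccontr)
    assume "\<not> L h \<le> ?I"
    then have "0 < L h - ?I" by simp
    then obtain N where "measure M UNIV < real N * (L h - ?I)" using ex_less_of_nat_mult by blast
    then show False using step[of N] by (simp add: algebra_simps)
  qed
qed

end

theorem Riesz_Markov_compact:
  fixes L :: "('a::metric_space \<Rightarrow>\<^sub>C real) \<Rightarrow> real"
  assumes "compact (UNIV :: 'a set)" "linear L"
    and "\<And>u. (\<And>x. 0 \<le> apply_bcontfun u x) \<Longrightarrow> 0 \<le> L u"
  obtains M :: "'a measure" where "finite_measure M" "sets M = sets borel"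
    "\<And>u. L u = (\<integral>x. apply_bcontfun u x \<partial>M)"
proof -
  interpret positive_functional L by (rule positive_functional.intro[OF assms])
  interpret finite_measure M by (rule finite_measure_M)
  let ?one = "const_bcontfun 1 :: 'a \<Rightarrow>\<^sub>C real"
  have "0 \<le> L ?one" by (rule nonneg) simp
  then have mass: "measure M UNIV \<le> L ?one"
    using emeasure_M_UNIV by (simp add: emeasure_eq_measure)
  \<comment> \<open>Adding a large constant reduces to nonnegative functions; the constant costs nothing because \<open>M\<close> has mass at most \<open>L 1\<close>. Replacing \<open>u\<close> by \<open>- u\<close> gives equality.\<close>
  have le: "L u \<le> (\<integral>x. apply_bcontfun u x \<partial>M)" for u
  proof -
    have "L (u + norm u *\<^sub>R ?one) \<le> (\<integral>x. apply_bcontfun (u + norm u *\<^sub>R ?one) x \<partial>M)"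
    proof (rule functional_le_integral)
      show "0 \<le> apply_bcontfun (u + norm u *\<^sub>R ?one) x" for x
        using norm_bounded[of u x] by simp
    qed
    then have "L u + norm u * L ?one \<le> (\<integral>x. apply_bcontfun u x \<partial>M) + norm u * measure M UNIV"
      using integrable_bcontfun by (simp add: linear_add[OF linear] linear_cmul[OF linear] mult.commute)
    then show ?thesis using mult_left_mono[OF mass norm_ge_zero[of u]] by simp
  qed
  have "L u = (\<integral>x. apply_bcontfun u x \<partial>M)" for u
    using le[of u] le[of "- u"] linear_neg[OF linear, of u] by simp
  then show ?thesis using that finite_measure_M sets_M by blast
qed

section \<open>Bounds in the Varopoulos algebra\<close>

text \<open>\<open>vbound F s\<close> says that \<open>F\<close> has a representation of total weight at most \<open>s\<close>; the norm of
  \<open>V(X, Y)\<close> is the infimum of such \<open>s\<close>. Stating this for plain functions avoids having to produce an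
  element of \<open>C(X \<times> Y)\<close> first.\<close>

definition vbound :: "('a::topological_space \<times> 'b::topological_space \<Rightarrow> complex) \<Rightarrow> real \<Rightarrow> bool" where
  "vbound F s \<longleftrightarrow> (\<exists>(f :: nat \<Rightarrow> 'a \<Rightarrow>\<^sub>C complex) (g :: nat \<Rightarrow> 'b \<Rightarrow>\<^sub>C complex).
     summable (\<lambda>i. norm (f i) * norm (g i)) \<and> (\<Sum>i. norm (f i) * norm (g i)) \<le> s \<and>
     (\<forall>x y. (\<lambda>i. apply_bcontfun (f i) x * apply_bcontfun (g i) y) sums F (x, y)))"

lemma vbound_mono: "vbound F s \<Longrightarrow> s \<le> t \<Longrightarrow> vbound F t"
  unfolding vbound_def using order_trans by blast

lemma vbound_nonneg:
  fixes F :: "'a::topological_space \<times> 'b::topological_space \<Rightarrow> complex"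
  assumes "vbound F s" shows "0 \<le> s"
proof -
  obtain f :: "nat \<Rightarrow> 'a \<Rightarrow>\<^sub>C complex" and g :: "nat \<Rightarrow> 'b \<Rightarrow>\<^sub>C complex"
    where "summable (\<lambda>i. norm (f i) * norm (g i))" "(\<Sum>i. norm (f i) * norm (g i)) \<le> s"
    using assms unfolding vbound_def by blast
  then show ?thesis using suminf_nonneg[of "\<lambda>i. norm (f i) * norm (g i)"] by force
qed

lemma vbound_rank_one:
  "vbound (\<lambda>z. apply_bcontfun p (fst z) * apply_bcontfun q (snd z)) (norm p * norm q)"
proof -
  let ?f = "\<lambda>i::nat. if i = 0 then p else 0"
  let ?g = "\<lambda>i::nat. if i = 0 then q else 0"
  have "(\<lambda>i. norm (?f i) * norm (?g i)) sums (norm p * norm q)"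
    using sums_single[of 0 "\<lambda>i. norm p * norm q"] by (rule sums_cong[THEN iffD1, rotated]) auto
  moreover have "(\<lambda>i. apply_bcontfun (?f i) x * apply_bcontfun (?g i) y) sums (apply_bcontfun p x * apply_bcontfun q y)" for x y
    using sums_single[of 0 "\<lambda>i. apply_bcontfun p x * apply_bcontfun q y"] by (rule sums_cong[THEN iffD1, rotated]) auto
  ultimately show ?thesis
    unfolding vbound_def by (intro exI[of _ ?f] exI[of _ ?g]) (auto simp: sums_iff)
qed

lemma vbound_zero: "vbound (\<lambda>z. 0) 0"
  using vbound_rank_one[of 0 0] by simp

lemma vbound_scaleR:
  assumes "vbound F s" shows "vbound (\<lambda>z. c *\<^sub>R F z) (\<bar>c\<bar> * s)"
proof -
  obtain f g where fg: "summable (\<lambda>i. norm (f i) * norm (g i))"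
    "(\<Sum>i. norm (f i) * norm (g i)) \<le> s"
    "\<And>x y. (\<lambda>i. apply_bcontfun (f i) x * apply_bcontfun (g i) y) sums F (x, y)"
    using assms unfolding vbound_def by blast
  have "(\<lambda>i. norm (c *\<^sub>R f i) * norm (g i)) sums (\<bar>c\<bar> * (\<Sum>i. norm (f i) * norm (g i)))"
    using sums_mult[OF summable_sums[OF fg(1)], of "\<bar>c\<bar>"] by (simp add: mult.assoc)
  moreover have "(\<lambda>i. apply_bcontfun (c *\<^sub>R f i) x * apply_bcontfun (g i) y) sums (c *\<^sub>R F (x, y))" for x y
    using sums_scaleR_right[OF fg(3)[of x y], of c] by simp
  ultimately show ?thesis
    unfolding vbound_def using mult_left_mono[OF fg(2), of "\<bar>c\<bar>"]
    by (intro exI[of _ "\<lambda>i. c *\<^sub>R f i"] exI[of _ g]) (auto simp: sums_iff)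
qed

lemma vbound_norm_le:
  assumes "vbound F s" shows "cmod (F z) \<le> s"
proof -
  obtain x y where z: "z = (x, y)" by fastforce
  obtain f g where fg: "summable (\<lambda>i. norm (f i) * norm (g i))"
    "(\<Sum>i. norm (f i) * norm (g i)) \<le> s"
    "\<And>x y. (\<lambda>i. apply_bcontfun (f i) x * apply_bcontfun (g i) y) sums F (x, y)"
    using assms unfolding vbound_def by blast
  have le: "cmod (apply_bcontfun (f i) x * apply_bcontfun (g i) y) \<le> norm (f i) * norm (g i)" for i
    by (simp add: norm_mult norm_bounded mult_mono)
  have "cmod (F z) \<le> (\<Sum>i. norm (f i) * norm (g i))"
    using norm_suminf_le[OF le fg(1)] sums_unique[OF fg(3)[of x y]] by (simp add: z)
  then show ?thesis using fg(2) by simp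
qed

text \<open>Completeness of \<open>V(X, Y)\<close>, in the form needed for the iteration in Grothendieck's inequality: the
  representations of the terms are merged into one by enumerating pairs of indices.\<close>

lemma vbound_sums:
  fixes F :: "nat \<Rightarrow> 'a::topological_space \<times> 'b::topological_space \<Rightarrow> complex"
  assumes F: "\<And>i. vbound (F i) (s i)" and s: "summable s" and G: "\<And>z. (\<lambda>i. F i z) sums G z"
  shows "vbound G (suminf s)"
proof -
  define P where "P i f g \<longleftrightarrow> summable (\<lambda>j. norm (f j) * norm (g j)) \<and>
      (\<Sum>j. norm (f j) * norm (g j)) \<le> s i \<and>
      (\<forall>x y. (\<lambda>j. apply_bcontfun (f j) x * apply_bcontfun (g j) y) sums F i (x, y))"
    for i and f :: "nat \<Rightarrow> 'a \<Rightarrow>\<^sub>C complex" and g :: "nat \<Rightarrow> 'b \<Rightarrow>\<^sub>C complex"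
  have "\<forall>i. \<exists>f g. P i f g" using F unfolding vbound_def P_def by blast
  then obtain f g where P: "\<And>i. P i (f i) (g i)" by metis
  have fg: "summable (\<lambda>j. norm (f i j) * norm (g i j))"
    "(\<Sum>j. norm (f i j) * norm (g i j)) \<le> s i"
    "(\<lambda>j. apply_bcontfun (f i j) x * apply_bcontfun (g i j) y) sums F i (x, y)" for i x y
    using P[of i] by (simp_all add: P_def)
  define N where "N = (\<lambda>(i, j). norm (f i j) * norm (g i j))"
  define T where "T i = (\<Sum>j. norm (f i j) * norm (g i j))" for i
  have T0: "0 \<le> T i" for i unfolding T_def by (intro suminf_nonneg fg) auto
  have Tsum: "summable T"
    using s by (rule summable_comparison_test_ev[rotated]) (use T0 fg(2) in \<open>auto simp: T_def\<close>)
  have rows: "((\<lambda>j. N (i, j)) has_sum T i) UNIV" for i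
    unfolding N_def T_def using summable_sums[OF fg(1)[of i]] by (intro sums_nonneg_imp_has_sum) auto
  have Ths: "(T has_sum suminf T) UNIV"
    using summable_sums[OF Tsum] T0 by (intro sums_nonneg_imp_has_sum)
  have Nsummable: "N summable_on UNIV \<times> UNIV"
    using rows has_sum_imp_summable[OF Ths]
    by (rule summable_on_SigmaI) (auto simp: N_def)
  then have "(N has_sum suminf T) (UNIV \<times> UNIV)"
    using rows Ths by (intro has_sum_SigmaI) auto
  then have "((\<lambda>n. N (prod_decode n)) has_sum suminf T) UNIV"
    using has_sum_reindex_bij_betw[OF bij_prod_decode, of N] by simp
  then have Nsums: "(\<lambda>n. N (prod_decode n)) sums suminf T" by (rule has_sum_imp_sums)
  define f' where "f' n = f (fst (prod_decode n)) (snd (prod_decode n))" for n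
  define g' where "g' n = g (fst (prod_decode n)) (snd (prod_decode n))" for n
  have N_eq: "N (prod_decode n) = norm (f' n) * norm (g' n)" for n
    by (simp add: N_def f'_def g'_def case_prod_unfold)
  have val: "(\<lambda>n. apply_bcontfun (f' n) x * apply_bcontfun (g' n) y) sums G (x, y)" for x y
  proof -
    define h where "h = (\<lambda>(i, j). apply_bcontfun (f i j) x * apply_bcontfun (g i j) y)"
    have hN: "norm (h p) \<le> N p" for p
      by (auto simp: h_def N_def norm_mult norm_bounded mult_mono split: prod.split)
    have h_row: "((\<lambda>j. h (i, j)) has_sum F i (x, y)) UNIV" for i
    proof (rule norm_summable_imp_has_sum)
      show "summable (\<lambda>j. norm (h (i, j)))"
        using fg(1)[of i] by (rule summable_comparison_test_ev[rotated]) (use hN in \<open>auto simp: N_def\<close>)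
      show "(\<lambda>j. h (i, j)) sums F i (x, y)" using fg(3)[of i x y] by (simp add: h_def)
    qed
    have F_hs: "((\<lambda>i. F i (x, y)) has_sum G (x, y)) UNIV"
    proof (rule norm_summable_imp_has_sum)
      show "summable (\<lambda>i. norm (F i (x, y)))"
        using s by (rule summable_comparison_test_ev[rotated]) (use vbound_norm_le[OF F] in auto)
    qed (rule G)
    have "(\<lambda>p. norm (h p)) summable_on UNIV \<times> UNIV"
      using Nsummable hN by (rule Infinite_Sum.abs_summable_on_comparison_test')
    then have "h summable_on UNIV \<times> UNIV" by (rule abs_summable_summable)
    then have "(h has_sum G (x, y)) (UNIV \<times> UNIV)"
      using h_row F_hs by (intro has_sum_SigmaI) auto
    then have "((\<lambda>n. h (prod_decode n)) has_sum G (x, y)) UNIV"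
      using has_sum_reindex_bij_betw[OF bij_prod_decode, of h] by simp
    then show ?thesis
      by (intro has_sum_imp_sums) (simp add: h_def f'_def g'_def case_prod_unfold)
  qed
  have "suminf T \<le> suminf s" using Tsum s fg(2) by (intro suminf_le) (auto simp: T_def)
  then show ?thesis
    unfolding vbound_def using Nsums val N_eq
    by (intro exI[of _ f'] exI[of _ g']) (auto simp: sums_iff)
qed

lemma vbound_add:
  assumes "vbound F s" "vbound G t"
  shows "vbound (\<lambda>z. F z + G z) (s + t)"
proof -
  let ?F = "\<lambda>i::nat. if i = 0 then F else if i = 1 then G else (\<lambda>z. 0)"
  let ?s = "\<lambda>i::nat. if i = 0 then s else if i = 1 then t else 0"
  have "?s sums (\<Sum>i\<in>{0, 1}. ?s i)" by (rule sums_finite) auto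
  moreover have "(\<lambda>i. ?F i z) sums (\<Sum>i\<in>{0, 1}. ?F i z)" for z by (rule sums_finite) auto
  moreover have "vbound (?F i) (?s i)" for i by (simp add: assms vbound_zero)
  ultimately show ?thesis using vbound_sums[of ?F ?s "\<lambda>z. F z + G z"] by (simp add: sums_iff)
qed

lemma vbound_diff:
  assumes "vbound F s" "vbound G t"
  shows "vbound (\<lambda>z. F z - G z) (s + t)"
  using vbound_add[OF assms(1) vbound_scaleR[OF assms(2), of "-1"]] by simp

lemma vbound_sum:
  assumes "\<And>i. i \<in> I \<Longrightarrow> vbound (F i) (s i)"
  shows "vbound (\<lambda>z. \<Sum>i\<in>I. F i z) (\<Sum>i\<in>I. s i)"
  using assms by (induction I rule: infinite_finite_induct) (auto intro: vbound_add vbound_zero)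

section \<open>Grothendieck's inequality\<close>

definition tens :: "(('a::topological_space \<Rightarrow>\<^sub>C complex) \<times> ('b::topological_space \<Rightarrow>\<^sub>C complex)) list \<Rightarrow> 'a \<times> 'b \<Rightarrow> complex" where
  "tens l z = (\<Sum>(p, q)\<leftarrow>l. apply_bcontfun p (fst z) * apply_bcontfun q (snd z))"

lemma tens_simps [simp]:
  "tens [] z = 0"
  "tens ((p, q) # l) z = apply_bcontfun p (fst z) * apply_bcontfun q (snd z) + tens l z"
  "tens (l @ m) z = tens l z + tens m z"
  by (simp_all add: tens_def)

lemma vbound_tens: "vbound (tens l) (\<Sum>(p, q)\<leftarrow>l. norm p * norm q)"
proof (induction l)
  case Nil
  then show ?case using vbound_zero by (simp add: tens_def)
next
  case (Cons pq l)
  obtain p q where "pq = (p, q)" by fastforce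
  then show ?case using vbound_add[OF vbound_rank_one[of p q] Cons] by (simp add: tens_def)
qed

definition sqsum :: "('a::topological_space \<Rightarrow>\<^sub>C complex) list \<Rightarrow> 'a \<Rightarrow> real" where
  "sqsum ps x = (\<Sum>p\<leftarrow>ps. (cmod (apply_bcontfun p x))\<^sup>2)"

lemma sqsum_simps [simp]:
  "sqsum [] x = 0"
  "sqsum (p # ps) x = (cmod (apply_bcontfun p x))\<^sup>2 + sqsum ps x"
  "sqsum (ps @ qs) x = sqsum ps x + sqsum qs x"
  by (simp_all add: sqsum_def)

lemma sqsum_nonneg: "0 \<le> sqsum ps x"
  by (induction ps) auto

lemma norm_tens_le: "2 * cmod (tens l (x, y)) \<le> sqsum (map fst l) x + sqsum (map snd l) y"
proof (induction l)
  case (Cons pq l)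
  obtain p q where pq: "pq = (p, q)" by fastforce
  let ?a = "cmod (apply_bcontfun p x)" and ?b = "cmod (apply_bcontfun q y)"
  have "cmod (tens (pq # l) (x, y)) \<le> ?a * ?b + cmod (tens l (x, y))"
    by (simp add: pq norm_mult norm_triangle_le)
  moreover have "2 * (?a * ?b) \<le> ?a\<^sup>2 + ?b\<^sup>2"
    using sum_squares_bound[of ?a ?b] by simp
  ultimately show ?case using Cons by (simp add: pq)
qed simp

text \<open>All \<open>2\<^sup>n\<close> values of the Rademacher sum \<open>\<Sum> \<plusminus> v\<^sub>i\<close>. Averages over sign choices become finite sums over
  this list; applied to a list of pairs it uses the same signs in both components.\<close>

fun signed_sums :: "'v::ab_group_add list \<Rightarrow> 'v list" where
  "signed_sums [] = [0]"
| "signed_sums (v # vs) = map (\<lambda>w. w + v) (signed_sums vs) @ map (\<lambda>w. w - v) (signed_sums vs)"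

lemma length_signed_sums: "length (signed_sums vs) = 2 ^ length vs"
  by (induction vs) auto

lemma map_signed_sums:
  assumes "h 0 = 0" "\<And>v w. h (v + w) = h v + h w" "\<And>v w. h (v - w) = h v - h w"
  shows "map h (signed_sums vs) = signed_sums (map h vs)"
proof (induction vs)
  case (Cons v vs)
  then show ?case using assms by (simp add: comp_def flip: Cons)
qed (use assms in simp)

lemma sum_list_signed_sums_sq:
  "(\<Sum>z\<leftarrow>signed_sums cs. (cmod z)\<^sup>2) = 2 ^ length cs * (\<Sum>c\<leftarrow>cs. (cmod c)\<^sup>2)"
proof (induction cs)
  case (Cons c cs)
  have "(\<Sum>z\<leftarrow>signed_sums (c # cs). (cmod z)\<^sup>2)
      = (\<Sum>z\<leftarrow>signed_sums cs. (cmod (z + c))\<^sup>2 + (cmod (z - c))\<^sup>2)"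
    by (simp add: comp_def sum_list_addf)
  also have "\<dots> = (\<Sum>z\<leftarrow>signed_sums cs. 2 * (cmod z)\<^sup>2 + 2 * (cmod c)\<^sup>2)"
    unfolding cmod_power2
    by (intro arg_cong[of _ _ sum_list] map_cong refl) (simp add: power2_eq_square algebra_simps)
  also have "\<dots> = 2 * (\<Sum>z\<leftarrow>signed_sums cs. (cmod z)\<^sup>2) + 2 ^ length cs * (2 * (cmod c)\<^sup>2)"
    by (simp add: sum_list_addf sum_list_const_mult sum_list_triv length_signed_sums)
  finally show ?case using Cons by (simp add: algebra_simps)
qed simp

lemma parallelogram_fourth_le:
  "(cmod (z + c)) ^ 4 + (cmod (z - c)) ^ 4
     \<le> 2 * (cmod z) ^ 4 + 12 * (cmod c)\<^sup>2 * (cmod z)\<^sup>2 + 2 * (cmod c) ^ 4"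
proof -
  define t where "t = Re z * Re c + Im z * Im c"
  have p: "(cmod (z + c))\<^sup>2 = (cmod z)\<^sup>2 + (cmod c)\<^sup>2 + 2 * t"
    and m: "(cmod (z - c))\<^sup>2 = (cmod z)\<^sup>2 + (cmod c)\<^sup>2 - 2 * t"
    unfolding t_def cmod_power2 by (simp_all add: power2_eq_square algebra_simps)
  have t: "t\<^sup>2 \<le> (cmod z)\<^sup>2 * (cmod c)\<^sup>2"
  proof -
    have "(cmod z)\<^sup>2 * (cmod c)\<^sup>2 - t\<^sup>2 = (Re z * Im c - Im z * Re c)\<^sup>2"
      unfolding t_def cmod_power2 by (simp add: power2_eq_square algebra_simps)
    then show ?thesis by (metis diff_ge_0_iff_ge zero_le_power2)
  qed
  have four: "w ^ 4 = (w\<^sup>2)\<^sup>2" for w :: real by (simp flip: power_mult)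
  have "(cmod (z + c)) ^ 4 + (cmod (z - c)) ^ 4 = 2 * ((cmod z)\<^sup>2 + (cmod c)\<^sup>2)\<^sup>2 + 8 * t\<^sup>2"
    unfolding four p m by (simp add: power2_eq_square algebra_simps)
  also have "\<dots> \<le> 2 * ((cmod z)\<^sup>2 + (cmod c)\<^sup>2)\<^sup>2 + 8 * ((cmod z)\<^sup>2 * (cmod c)\<^sup>2)" using t by simp
  also have "\<dots> = 2 * (cmod z) ^ 4 + 12 * (cmod c)\<^sup>2 * (cmod z)\<^sup>2 + 2 * (cmod c) ^ 4"
    unfolding four by (simp add: power2_eq_square algebra_simps)
  finally show ?thesis .
qed

text \<open>The Khinchine inequality for the fourth moment. In the induction, the cross term of
  \<open>parallelogram_fourth_le\<close> is controlled by the second moment, and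
  \<open>3 S\<^sup>2 + 6 S |c|\<^sup>2 + 3 |c|\<^sup>4 = 3 (S + |c|\<^sup>2)\<^sup>2\<close>.\<close>

lemma sum_list_signed_sums_fourth:
  "(\<Sum>z\<leftarrow>signed_sums cs. (cmod z) ^ 4) \<le> 2 ^ length cs * (3 * (\<Sum>c\<leftarrow>cs. (cmod c)\<^sup>2)\<^sup>2)"
proof (induction cs)
  case (Cons c cs)
  let ?S = "\<Sum>c\<leftarrow>cs. (cmod c)\<^sup>2" and ?n = "2 ^ length cs :: real"
  have "(\<Sum>z\<leftarrow>signed_sums (c # cs). (cmod z) ^ 4)
      = (\<Sum>z\<leftarrow>signed_sums cs. (cmod (z + c)) ^ 4 + (cmod (z - c)) ^ 4)"
    by (simp add: comp_def sum_list_addf)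
  also have "\<dots> \<le> (\<Sum>z\<leftarrow>signed_sums cs. 2 * (cmod z) ^ 4 + 12 * (cmod c)\<^sup>2 * (cmod z)\<^sup>2 + 2 * (cmod c) ^ 4)"
    by (intro sum_list_mono parallelogram_fourth_le)
  also have "\<dots> = 2 * (\<Sum>z\<leftarrow>signed_sums cs. (cmod z) ^ 4)
      + 12 * (cmod c)\<^sup>2 * (\<Sum>z\<leftarrow>signed_sums cs. (cmod z)\<^sup>2) + ?n * (2 * (cmod c) ^ 4)"
    by (simp add: sum_list_addf sum_list_const_mult sum_list_triv length_signed_sums)
  also have "\<dots> \<le> 2 * (?n * (3 * ?S\<^sup>2)) + 12 * (cmod c)\<^sup>2 * (?n * ?S) + ?n * (6 * (cmod c) ^ 4)"
    using Cons by (intro add_mono mult_left_mono) (auto simp: sum_list_signed_sums_sq)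
  also have "\<dots> = 2 ^ length (c # cs) * (3 * (\<Sum>c\<leftarrow>(c # cs). (cmod c)\<^sup>2)\<^sup>2)"
  proof -
    have "(cmod c) ^ 4 = ((cmod c)\<^sup>2)\<^sup>2" by (simp flip: power_mult)
    then show ?thesis by (simp add: power2_eq_square algebra_simps)
  qed
  finally show ?case .
qed simp

text \<open>The radial retraction onto the disc of radius 2. By the fourth moment bound a Rademacher sum
  whose square sum is at most 1 exceeds this radius rarely enough for the second moment of its clipped
  remainder to be at most \<open>3 / 64\<close>.\<close>

definition clip :: "complex \<Rightarrow> complex" where
  "clip z = (1 / max 1 (cmod z / 2)) *\<^sub>R z"

lemma continuous_on_clip [continuous_intros]:
  "continuous_on S f \<Longrightarrow> continuous_on S (\<lambda>x. clip (f x))"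
  unfolding clip_def by (intro continuous_intros) (auto simp: max_def)

lemma norm_clip: "cmod (clip z) \<le> 2" "cmod (clip z) \<le> cmod z"
  by (auto simp: clip_def max_def divide_simps)

lemma norm_clip_remainder: "(cmod (z - clip z))\<^sup>2 \<le> (cmod z) ^ 4 / 64"
proof (cases "cmod z \<le> 2")
  case True
  then have "clip z = z" by (simp add: clip_def max_def)
  then show ?thesis by simp
next
  case False
  then have "z - clip z = (1 - 2 / cmod z) *\<^sub>R z"
    by (simp add: clip_def max_def scaleR_diff_left)
  moreover have "0 \<le> 1 - 2 / cmod z" using False by (simp add: divide_le_eq_1)
  ultimately have "cmod (z - clip z) = (1 - 2 / cmod z) * cmod z" by simp
  also have "\<dots> = cmod z - 2" using False by (auto simp: field_simps)
  \<comment> \<open>This is \<open>(|z| - 4)\<^sup>2 \<ge> 0\<close>.\<close>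
  also have "\<dots> \<le> (cmod z)\<^sup>2 / 8"
    using zero_le_power2[of "cmod z - 4"] by (simp add: power2_eq_square algebra_simps)
  finally have "(cmod (z - clip z))\<^sup>2 \<le> ((cmod z)\<^sup>2 / 8)\<^sup>2" by (intro power_mono) auto
  also have "\<dots> = (cmod z) ^ 4 / 64" by (simp add: power_divide flip: power_mult)
  finally show ?thesis .
qed

definition bclip :: "('a::topological_space \<Rightarrow>\<^sub>C complex) \<Rightarrow> 'a \<Rightarrow>\<^sub>C complex" where
  "bclip p = Bcontfun (\<lambda>x. clip (apply_bcontfun p x))"

lemma apply_bclip [simp]: "apply_bcontfun (bclip p) x = clip (apply_bcontfun p x)"
  unfolding bclip_def
  by (subst Bcontfun_inverse)
     (auto intro!: bcontfun_normI[of _ 2] continuous_intros simp: norm_clip)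

lemma norm_bclip: "norm (bclip p) \<le> 2"
  by (rule norm_bound) (simp add: norm_clip)

lemma scaleR_sum_list:
  fixes f :: "'c \<Rightarrow> 'v::real_vector"
  shows "c *\<^sub>R (\<Sum>x\<leftarrow>xs. f x) = (\<Sum>x\<leftarrow>xs. c *\<^sub>R f x)"
  by (induction xs) (simp_all add: scaleR_add_right)

text \<open>For a sum \<open>\<Sum> p\<^sub>i \<otimes> q\<^sub>i\<close> given by the list \<open>l\<close>, orthogonality of the signs expresses it as the average
  of \<open>a \<otimes> b\<close> over the signed sums \<open>(a, b)\<close>. With clipped parts \<open>a'\<close>, \<open>b'\<close> one has
  \<open>a b = a' b' + a' (b - b') + (a - a') b\<close>. The products \<open>a' b'\<close> are bounded and form \<open>main_part\<close>.
  The other two form \<open>rest_part\<close>, whose weights are chosen such that \<open>rest_part l\<close> represents twice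
  the remainder and still has square sums at most 1 if \<open>l\<close> has: they are at most
  \<open>1 / 2 + 8 \<cdot> 3 / 64 = 7 / 8\<close>.\<close>

definition main_part where
  "main_part l = map (\<lambda>(a, b). ((1 / 2 ^ length l) *\<^sub>R bclip a, bclip b)) (signed_sums l)"

definition rest_part where
  "rest_part l = (let w = 2 ^ length l in
     map (\<lambda>(a, b). ((1 / sqrt (2 * w)) *\<^sub>R bclip a, sqrt (8 / w) *\<^sub>R (b - bclip b))) (signed_sums l) @
     map (\<lambda>(a, b). (sqrt (8 / w) *\<^sub>R (a - bclip a), (1 / sqrt (2 * w)) *\<^sub>R b)) (signed_sums l))"

lemma tens_signed_sums: "tens (signed_sums l) z = 2 ^ length l * tens l z"
proof (induction l)
  case (Cons pq l)
  obtain p q where pq: "pq = (p, q)" by fastforce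
  let ?P = "apply_bcontfun p (fst z)" and ?Q = "apply_bcontfun q (snd z)"
  have "tens (signed_sums (pq # l)) z = (\<Sum>w\<leftarrow>signed_sums l.
        (apply_bcontfun (fst w) (fst z) + ?P) * (apply_bcontfun (snd w) (snd z) + ?Q)
      + (apply_bcontfun (fst w) (fst z) - ?P) * (apply_bcontfun (snd w) (snd z) - ?Q))"
    by (simp add: tens_def pq comp_def case_prod_unfold sum_list_addf)
  also have "\<dots> = (\<Sum>w\<leftarrow>signed_sums l.
        2 * (apply_bcontfun (fst w) (fst z) * apply_bcontfun (snd w) (snd z)) + 2 * (?P * ?Q))"
    by (intro arg_cong[of _ _ sum_list] map_cong refl) (simp add: algebra_simps)
  also have "\<dots> = 2 * tens (signed_sums l) z + 2 ^ length l * (2 * (?P * ?Q))"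
    by (simp add: sum_list_addf sum_list_const_mult sum_list_triv length_signed_sums tens_def case_prod_unfold)
  finally show ?case using Cons by (simp add: pq algebra_simps)
qed (simp add: tens_def zero_prod_def)

lemma tens_main_rest: "tens l z = tens (main_part l) z + (1 / 2) *\<^sub>R tens (rest_part l) z"
proof -
  let ?w = "2 ^ length l :: real"
  have sq: "(1 / sqrt (2 * ?w)) * sqrt (8 / ?w) = 2 / ?w"
  proof -
    have "sqrt (8 / ?w) = 2 * sqrt (2 / ?w)"
      using real_sqrt_mult[of 4 "2 / ?w"] by simp
    then have "(1 / sqrt (2 * ?w)) * sqrt (8 / ?w) = 2 * (sqrt (2 / ?w) / sqrt (2 * ?w))" by simp
    also have "sqrt (2 / ?w) / sqrt (2 * ?w) = sqrt (1 / ?w\<^sup>2)"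
      by (simp add: power2_eq_square flip: real_sqrt_divide)
    also have "\<dots> = 1 / ?w" by (simp add: real_sqrt_divide)
    finally show ?thesis by simp
  qed
  let ?A = "\<lambda>c. apply_bcontfun (fst c) (fst z)" and ?B = "\<lambda>c. apply_bcontfun (snd c) (snd z)"
  have main: "tens (main_part l) z = (\<Sum>c\<leftarrow>signed_sums l. (1 / ?w) *\<^sub>R (clip (?A c) * clip (?B c)))"
    by (simp add: tens_def main_part_def comp_def case_prod_unfold)
  have rest: "(1 / 2) *\<^sub>R tens (rest_part l) z = (\<Sum>c\<leftarrow>signed_sums l.
      (1 / ?w) *\<^sub>R (clip (?A c) * (?B c - clip (?B c)) + (?A c - clip (?A c)) * ?B c))"
  proof -
    have "tens (rest_part l) z = (\<Sum>c\<leftarrow>signed_sums l.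
        ((1 / sqrt (2 * ?w)) * sqrt (8 / ?w)) *\<^sub>R (clip (?A c) * (?B c - clip (?B c)) + (?A c - clip (?A c)) * ?B c))"
      by (simp add: tens_def rest_part_def Let_def comp_def case_prod_unfold algebra_simps flip: sum_list_addf)
    also have "(1 / sqrt (2 * ?w)) * sqrt (8 / ?w) = 2 / ?w" by (rule sq)
    finally show ?thesis by (simp only: scaleR_sum_list scaleR_scaleR) simp
  qed
  have "tens (main_part l) z + (1 / 2) *\<^sub>R tens (rest_part l) z = (\<Sum>c\<leftarrow>signed_sums l. (1 / ?w) *\<^sub>R (?A c * ?B c))"
    unfolding main rest by (simp add: algebra_simps flip: sum_list_addf)
  also have "\<dots> = (1 / ?w) *\<^sub>R tens (signed_sums l) z"
    by (simp add: tens_def case_prod_unfold scaleR_sum_list)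
  also have "\<dots> = tens l z" by (simp add: tens_signed_sums scaleR_conv_of_real)
  finally show ?thesis ..
qed

lemma vbound_main_part: "vbound (tens (main_part l)) 4"
proof (rule vbound_mono[OF vbound_tens])
  have "(\<Sum>(p, q)\<leftarrow>main_part l. norm p * norm q)
      = (\<Sum>c\<leftarrow>signed_sums l. (norm (bclip (fst c)) / 2 ^ length l) * norm (bclip (snd c)))"
    by (simp add: main_part_def comp_def case_prod_unfold)
  also have "\<dots> \<le> (\<Sum>c\<leftarrow>signed_sums l. (2 / 2 ^ length l) * 2)"
    by (intro sum_list_mono mult_mono divide_right_mono norm_bclip) auto
  also have "\<dots> = 4" by (simp add: sum_list_triv length_signed_sums)
  finally show "(\<Sum>(p, q)\<leftarrow>main_part l. norm p * norm q) \<le> 4" .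
qed

lemma sqsum_signed_sums:
  assumes "sqsum ps x \<le> 1"
  shows "sqsum (signed_sums ps) x \<le> 2 ^ length ps"
    and "sqsum (map bclip (signed_sums ps)) x \<le> 2 ^ length ps"
    and "sqsum (map (\<lambda>p. p - bclip p) (signed_sums ps)) x \<le> 3 / 64 * 2 ^ length ps"
proof -
  let ?cs = "map (\<lambda>p. apply_bcontfun p x) ps"
  have eval: "map (\<lambda>p. apply_bcontfun p x) (signed_sums ps) = signed_sums ?cs"
    by (rule map_signed_sums) auto
  have S: "sqsum ps x = (\<Sum>c\<leftarrow>?cs. (cmod c)\<^sup>2)" by (simp add: sqsum_def comp_def)
  have "sqsum (signed_sums ps) x = (\<Sum>c\<leftarrow>signed_sums ?cs. (cmod c)\<^sup>2)"
    by (simp add: sqsum_def comp_def flip: eval)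
  then have E: "sqsum (signed_sums ps) x = 2 ^ length ps * sqsum ps x"
    by (simp only: sum_list_signed_sums_sq S length_map)
  then show 1: "sqsum (signed_sums ps) x \<le> 2 ^ length ps" using assms by simp
  have "sqsum (map bclip (signed_sums ps)) x \<le> sqsum (signed_sums ps) x"
    by (auto simp: sqsum_def comp_def norm_clip intro!: sum_list_mono power_mono)
  then show "sqsum (map bclip (signed_sums ps)) x \<le> 2 ^ length ps" using 1 by simp
  have "sqsum (map (\<lambda>p. p - bclip p) (signed_sums ps)) x
      \<le> (\<Sum>p\<leftarrow>signed_sums ps. 1 / 64 * (cmod (apply_bcontfun p x)) ^ 4)"
    using norm_clip_remainder by (auto simp: sqsum_def comp_def intro!: sum_list_mono)
  also have "\<dots> = 1 / 64 * (\<Sum>c\<leftarrow>signed_sums ?cs. (cmod c) ^ 4)"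
    unfolding sum_list_const_mult by (simp add: comp_def flip: eval)
  also have "\<dots> \<le> 1 / 64 * (2 ^ length ?cs * (3 * (sqsum ps x)\<^sup>2))"
    using sum_list_signed_sums_fourth[of ?cs] unfolding S by (intro mult_left_mono) auto
  also have "\<dots> \<le> 1 / 64 * (2 ^ length ?cs * (3 * 1\<^sup>2))"
    using assms sqsum_nonneg[of ps x] by (intro mult_left_mono power_mono) auto
  finally show "sqsum (map (\<lambda>p. p - bclip p) (signed_sums ps)) x \<le> 3 / 64 * 2 ^ length ps" by simp
qed

lemma sqsum_scaleR: "sqsum (map (\<lambda>p. c *\<^sub>R h p) ps) x = c\<^sup>2 * sqsum (map h ps) x"
  by (simp add: sqsum_def comp_def power_mult_distrib sum_list_const_mult)

lemma sqsum_rest_part: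
  fixes l :: "(('a::topological_space \<Rightarrow>\<^sub>C complex) \<times> ('b::topological_space \<Rightarrow>\<^sub>C complex)) list"
  shows "sqsum (map fst l) x \<le> 1 \<Longrightarrow> sqsum (map fst (rest_part l)) x \<le> 1"
    and "sqsum (map snd l) y \<le> 1 \<Longrightarrow> sqsum (map snd (rest_part l)) y \<le> 1"
proof -
  let ?w = "2 ^ length l :: real"
  have F: "map fst (signed_sums l) = signed_sums (map fst l)"
    and G: "map snd (signed_sums l) = signed_sums (map snd l)"
    by (rule map_signed_sums; simp)+
  have "map fst (rest_part l) = map (\<lambda>a. (1 / sqrt (2 * ?w)) *\<^sub>R bclip a) (map fst (signed_sums l)) @
      map (\<lambda>a. sqrt (8 / ?w) *\<^sub>R (a - bclip a)) (map fst (signed_sums l))"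
    by (simp add: rest_part_def Let_def comp_def case_prod_unfold)
  then have 1: "sqsum (map fst (rest_part l)) x = 1 / (2 * ?w) * sqsum (map bclip (signed_sums (map fst l))) x
      + 8 / ?w * sqsum (map (\<lambda>a. a - bclip a) (signed_sums (map fst l))) x"
    by (simp only: F sqsum_simps sqsum_scaleR) (simp add: power_divide)
  have "map snd (rest_part l) = map (\<lambda>b. sqrt (8 / ?w) *\<^sub>R (b - bclip b)) (map snd (signed_sums l)) @
      map (\<lambda>b. (1 / sqrt (2 * ?w)) *\<^sub>R id b) (map snd (signed_sums l))"
    by (simp add: rest_part_def Let_def comp_def case_prod_unfold)
  then have 2: "sqsum (map snd (rest_part l)) y = 8 / ?w * sqsum (map (\<lambda>a. a - bclip a) (signed_sums (map snd l))) y
      + 1 / (2 * ?w) * sqsum (signed_sums (map snd l)) y"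
    by (simp only: G sqsum_simps sqsum_scaleR) (simp add: power_divide)
  have half: "1 / (2 * ?w) * s + 8 / ?w * t \<le> 1" if "s \<le> ?w" "t \<le> 3 / 64 * ?w" for s t
  proof -
    have "s / (2 * ?w) \<le> 1 / 2" "8 * t / ?w \<le> 3 / 8" using that by (simp_all add: divide_le_eq)
    moreover have "1 / (2 * ?w) * s + 8 / ?w * t = s / (2 * ?w) + 8 * t / ?w" by simp
    ultimately show ?thesis by linarith
  qed
  show "sqsum (map fst (rest_part l)) x \<le> 1" if "sqsum (map fst l) x \<le> 1"
    unfolding 1 using sqsum_signed_sums[OF that] by (intro half) auto
  show "sqsum (map snd (rest_part l)) y \<le> 1" if "sqsum (map snd l) y \<le> 1"
    unfolding 2 using sqsum_signed_sums[OF that] by (subst add.commute) (intro half, auto)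
qed

text \<open>Splitting off \<open>main_part\<close> again and again gives a geometric series with terms of weight
  \<open>4 \<cdot> (1 / 2)\<^sup>k\<close>. The remainders tend to 0 only pointwise, but this is all that a representation in
  \<open>V(X, Y)\<close> asks for.\<close>

lemma Grothendieck_normalized:
  assumes "\<And>x. sqsum (map fst l) x \<le> 1" "\<And>y. sqsum (map snd l) y \<le> 1"
  shows "vbound (tens l) 8"
proof -
  define m where "m k = (rest_part ^^ k) l" for k
  have m: "sqsum (map fst (m k)) x \<le> 1" "sqsum (map snd (m k)) y \<le> 1" for k x y
    by (induction k) (auto simp: m_def assms sqsum_rest_part)
  define F where "F k z = (1/2) ^ k *\<^sub>R tens (main_part (m k)) z" for k z
  have part: "tens l z = (\<Sum>k<n. F k z) + (1/2) ^ n *\<^sub>R tens (m n) z" for n z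
  proof (induction n)
    case (Suc n)
    then show ?case using tens_main_rest[of "m n" z]
      by (simp add: F_def m_def algebra_simps)
  qed (simp add: m_def)
  have lim: "(\<lambda>n. (1/2) ^ n *\<^sub>R tens (m n) z) \<longlonglongrightarrow> 0" for z
  proof (rule tendsto_0_le[of "\<lambda>n. (1/2) ^ n" _ _ 1])
    show "(\<lambda>n. (1/2) ^ n :: real) \<longlonglongrightarrow> 0" by (rule LIMSEQ_realpow_zero) auto
    have "cmod (tens (m n) z) \<le> 1" for n
      using norm_tens_le[of "m n" "fst z" "snd z"] m(1)[of n "fst z"] m(2)[of n "snd z"] by simp
    then show "\<forall>\<^sub>F n in sequentially. norm ((1/2) ^ n *\<^sub>R tens (m n) z) \<le> norm ((1/2) ^ n :: real) * 1"
      by (auto intro!: always_eventually mult_left_mono)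
  qed
  have "(\<lambda>k. F k z) sums tens l z" for z
  proof -
    have "(\<lambda>n. tens l z - (1/2) ^ n *\<^sub>R tens (m n) z) \<longlonglongrightarrow> tens l z - 0"
      by (intro tendsto_intros lim)
    moreover have "tens l z - (1/2) ^ n *\<^sub>R tens (m n) z = (\<Sum>k<n. F k z)" for n
      using part[of z n] by simp
    ultimately show ?thesis by (simp add: sums_def)
  qed
  moreover have "vbound (F k) ((1/2) ^ k * 4)" for k
    using vbound_scaleR[OF vbound_main_part[of "m k"], of "(1/2) ^ k"] by (simp add: F_def[abs_def])
  moreover have "(\<lambda>k. (1/2) ^ k * 4 :: real) sums 8"
    using sums_mult2[OF geometric_sums[of "1/2 :: real"], of 4] by simp
  ultimately show ?thesis using vbound_sums[of F "\<lambda>k. (1/2) ^ k * 4" "tens l"] by (auto simp: sums_iff)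
qed

text \<open>The bound depends neither on the length of the list nor on the spaces. This is the dual form of
  Grothendieck's inequality for \<open>C(X) \<times> C(Y)\<close>.\<close>

theorem Grothendieck:
  assumes t: "0 < t" and "\<And>x. sqsum (map fst l) x \<le> t" "\<And>y. sqsum (map snd l) y \<le> t"
  shows "vbound (tens l) (8 * t)"
proof -
  define k where "k = map (\<lambda>(p, q). ((1 / sqrt t) *\<^sub>R p, (1 / sqrt t) *\<^sub>R q)) l"
  have "map fst k = map (\<lambda>p. (1 / sqrt t) *\<^sub>R id p) (map fst l)"
    "map snd k = map (\<lambda>p. (1 / sqrt t) *\<^sub>R id p) (map snd l)"
    by (auto simp: k_def)
  then have "sqsum (map fst k) x \<le> 1" "sqsum (map snd k) y \<le> 1" for x y
    using assms by (simp_all only: sqsum_scaleR) (simp_all add: power_divide field_simps)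
  then have "vbound (tens k) 8" by (rule Grothendieck_normalized)
  from vbound_scaleR[OF this, of t] have "vbound (\<lambda>z. t *\<^sub>R tens k z) (8 * t)"
    using t by (simp add: mult.commute)
  moreover have "t *\<^sub>R tens k z = tens l z" for z
  proof -
    have "tens k z = (\<Sum>c\<leftarrow>l. (1 / t) *\<^sub>R (apply_bcontfun (fst c) (fst z) * apply_bcontfun (snd c) (snd z)))"
      using t by (simp add: tens_def k_def comp_def case_prod_unfold)
    also have "\<dots> = (1 / t) *\<^sub>R tens l z"
      by (simp add: tens_def case_prod_unfold scaleR_sum_list)
    finally show ?thesis using t by simp
  qed
  ultimately show ?thesis by simp
qed

section \<open>Measures from a convex family of square sums\<close>

definition bsup :: "('a::metric_space \<Rightarrow>\<^sub>C real) \<Rightarrow> real" where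
  "bsup u = (SUP x. apply_bcontfun u x)"

lemma bdd_above_range_bcontfun: "bdd_above (range (apply_bcontfun (u :: 'a::metric_space \<Rightarrow>\<^sub>C real)))"
  by (rule bounded_imp_bdd_above) simp

lemma le_bsup: "apply_bcontfun u x \<le> bsup u"
  unfolding bsup_def by (rule cSUP_upper[OF _ bdd_above_range_bcontfun]) simp

lemma bsup_le: "(\<And>x. apply_bcontfun u x \<le> c) \<Longrightarrow> bsup u \<le> c"
  unfolding bsup_def by (rule cSUP_least) auto

lemma sublinear_bsup: "sublinear bsup"
proof (rule sublinearI)
  show "bsup (u + v) \<le> bsup u + bsup v" for u v :: "'a \<Rightarrow>\<^sub>C real"
    by (rule bsup_le) (simp add: add_mono le_bsup)
  show "bsup (c *\<^sub>R u) \<le> c * bsup u" if "0 < c" for c and u :: "'a \<Rightarrow>\<^sub>C real"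
    using that by (intro bsup_le) (simp add: le_bsup)
  show "bsup (0 :: 'a \<Rightarrow>\<^sub>C real) = 0" by (simp add: bsup_def)
qed

lemma sublinear_max_bsup: "sublinear (\<lambda>(u, v). max (bsup u) (bsup v))"
proof (rule sublinearI; clarsimp simp: zero_prod_def)
  note sl = sublinearD[OF sublinear_bsup]
  show "(bsup (u + u') \<le> max (bsup u) (bsup v) + max (bsup u') (bsup v')) \<and>
      (bsup (v + v') \<le> max (bsup u) (bsup v) + max (bsup u') (bsup v'))"
    for u u' :: "'a \<Rightarrow>\<^sub>C real" and v v' :: "'b \<Rightarrow>\<^sub>C real"
    using sl(1)[of u u'] sl(1)[of v v'] by (smt (verit))
  show "bsup (c *\<^sub>R u) \<le> c * max (bsup u) (bsup v) \<and> bsup (c *\<^sub>R v) \<le> c * max (bsup u) (bsup v)"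
    if "0 < c" for c and u :: "'a \<Rightarrow>\<^sub>C real" and v :: "'b \<Rightarrow>\<^sub>C real"
    using that sl(2)[of c u] sl(2)[of c v] by simp
  show "max (bsup (0 :: 'a \<Rightarrow>\<^sub>C real)) (bsup (0 :: 'b \<Rightarrow>\<^sub>C real)) = 0"
    by (simp add: sublinearD(3)[OF sublinear_bsup])
qed

lemma continuous_on_sqsum: "continuous_on S (sqsum ps)"
  unfolding sqsum_def by (induction ps) (auto intro!: continuous_intros)

definition scale_both :: "real \<Rightarrow> ('u::real_vector \<times> 'v::real_vector) list \<Rightarrow> ('u \<times> 'v) list" where
  "scale_both c = map (\<lambda>(p, q). (c *\<^sub>R p, c *\<^sub>R q))"

lemma tens_scale_both: "tens (scale_both c l) z = c\<^sup>2 *\<^sub>R tens l z"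
  by (induction l) (auto simp: scale_both_def algebra_simps power2_eq_square)

lemma sqsum_scale_both:
  "sqsum (map fst (scale_both c l)) x = c\<^sup>2 * sqsum (map fst l) x"
  "sqsum (map snd (scale_both c l)) y = c\<^sup>2 * sqsum (map snd l) y"
  by (induction l) (auto simp: scale_both_def algebra_simps power_mult_distrib)

text \<open>Minimax: a family of square sums that cannot be uniformly small on both spaces cannot be small on
  average either, for one pair of measures that serves the whole family. The separation
  takes place in \<open>C(X) \<times> C(Y)\<close> with the sublinear functional \<open>max (sup u) (sup v)\<close>. A linear functional
  below it is positive in each component and so consists of two measures.\<close>

theorem dominating_measures:
  fixes \<L> :: "(('a::metric_space \<Rightarrow>\<^sub>C complex) \<times> ('b::metric_space \<Rightarrow>\<^sub>C complex)) list set"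
  assumes X: "compact (UNIV :: 'a set)" and Y: "compact (UNIV :: 'b set)"
    and conv: "\<And>l m t. l \<in> \<L> \<Longrightarrow> m \<in> \<L> \<Longrightarrow> 0 \<le> t \<Longrightarrow> t \<le> 1 \<Longrightarrow>
      scale_both (sqrt t) l @ scale_both (sqrt (1 - t)) m \<in> \<L>"
    and large: "\<And>l. l \<in> \<L> \<Longrightarrow> (\<exists>x. c \<le> sqsum (map fst l) x) \<or> (\<exists>y. c \<le> sqsum (map snd l) y)"
  obtains \<mu> :: "'a measure" and \<nu> :: "'b measure"
  where "finite_measure \<mu>" "sets \<mu> = sets borel" "finite_measure \<nu>" "sets \<nu> = sets borel"
    "\<And>l. l \<in> \<L> \<Longrightarrow> c \<le> (\<integral>x. sqsum (map fst l) x \<partial>\<mu>) + (\<integral>y. sqsum (map snd l) y \<partial>\<nu>)"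
proof -
  define S where "S = (\<lambda>(u :: 'a \<Rightarrow>\<^sub>C real, v :: 'b \<Rightarrow>\<^sub>C real). max (bsup u) (bsup v))"
  define U where "U l = Bcontfun (sqsum (map fst l))" for l :: "(('a \<Rightarrow>\<^sub>C complex) \<times> ('b \<Rightarrow>\<^sub>C complex)) list"
  define V where "V l = Bcontfun (sqsum (map snd l))" for l :: "(('a \<Rightarrow>\<^sub>C complex) \<times> ('b \<Rightarrow>\<^sub>C complex)) list"
  have U: "apply_bcontfun (U l) = sqsum (map fst l)" for l
    unfolding U_def by (rule apply_Bcontfun_compact[OF X continuous_on_sqsum])
  have V: "apply_bcontfun (V l) = sqsum (map snd l)" for l
    unfolding V_def by (rule apply_Bcontfun_compact[OF Y continuous_on_sqsum])
  define R where "R = (\<lambda>l. (U l, V l)) ` \<L>"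
  have convR: "convex R"
  proof (rule convexI)
    fix r s :: "('a \<Rightarrow>\<^sub>C real) \<times> ('b \<Rightarrow>\<^sub>C real)" and a b :: real
    assume r: "r \<in> R" and s: "s \<in> R" and ab: "0 \<le> a" "0 \<le> b" "a + b = 1"
    obtain l m where lm: "l \<in> \<L>" "m \<in> \<L>" "r = (U l, V l)" "s = (U m, V m)"
      using r s by (auto simp: R_def)
    define k where "k = scale_both (sqrt a) l @ scale_both (sqrt (1 - a)) m"
    have b: "b = 1 - a" using ab by simp
    have "k \<in> \<L>" using conv lm ab by (auto simp: k_def)
    moreover have "a *\<^sub>R r + b *\<^sub>R s = (U k, V k)"
      using ab by (auto simp: lm b k_def U V sqsum_scale_both intro!: bcontfun_eqI)
    ultimately show "a *\<^sub>R r + b *\<^sub>R s \<in> R" by (auto simp: R_def)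
  qed
  have cS: "c \<le> S r" if "r \<in> R" for r
  proof -
    obtain l where l: "l \<in> \<L>" "r = (U l, V l)" using \<open>r \<in> R\<close> by (auto simp: R_def)
    show ?thesis using large[OF l(1)] le_bsup[of "U l"] le_bsup[of "V l"]
      by (auto simp: S_def l(2) U V le_max_iff_disj intro: order_trans)
  qed
  have slS: "sublinear S" unfolding S_def by (rule sublinear_max_bsup)
  obtain L where L: "linear L" "\<And>w. L w \<le> S w" "\<And>r. r \<in> R \<Longrightarrow> c \<le> L r"
    by (rule Mazur_Orlicz[OF slS convR cS]) blast+
  have pos: "0 \<le> L (u, v)" if "\<And>x. 0 \<le> apply_bcontfun u x" "\<And>y. 0 \<le> apply_bcontfun v y" for u v
  proof -
    have "L (- (u, v)) \<le> S (- u, - v)" using L(2)[of "(- u, - v)"] by simp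
    also have "\<dots> \<le> 0" using that by (auto simp: S_def intro!: bsup_le)
    finally show ?thesis using linear_neg[OF L(1), of "(u, v)"] by simp
  qed
  have "linear (\<lambda>u. L (u, 0))" "linear (\<lambda>v. L (0, v))"
    using linear_compose[OF _ L(1), of "\<lambda>u. (u, 0)"] linear_compose[OF _ L(1), of "\<lambda>v. (0, v)"]
    by (auto simp: linear_iff comp_def)
  note lin = this
  have pos1: "0 \<le> L (u, 0)" if "\<And>x. 0 \<le> apply_bcontfun u x" for u using that by (intro pos) auto
  have pos2: "0 \<le> L (0, v)" if "\<And>x. 0 \<le> apply_bcontfun v x" for v using that by (intro pos) auto
  obtain \<mu> where \<mu>: "finite_measure \<mu>" "sets \<mu> = sets borel" "\<And>u. L (u, 0) = (\<integral>x. apply_bcontfun u x \<partial>\<mu>)"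
    by (rule Riesz_Markov_compact[OF X lin(1) pos1]) blast+
  obtain \<nu> where \<nu>: "finite_measure \<nu>" "sets \<nu> = sets borel" "\<And>v. L (0, v) = (\<integral>y. apply_bcontfun v y \<partial>\<nu>)"
    by (rule Riesz_Markov_compact[OF Y lin(2) pos2]) blast+
  have "c \<le> (\<integral>x. sqsum (map fst l) x \<partial>\<mu>) + (\<integral>y. sqsum (map snd l) y \<partial>\<nu>)" if "l \<in> \<L>" for l
  proof -
    have "c \<le> L (U l, V l)" using that by (intro L) (auto simp: R_def)
    also have "\<dots> = L (U l, 0) + L (0, V l)" by (simp flip: linear_add[OF L(1)])
    finally show ?thesis by (simp add: \<mu>(3) \<nu>(3) U V)
  qed
  then show ?thesis by (rule that[OF \<mu>(1,2) \<nu>(1,2)])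
qed

section \<open>Regularity of finite Borel measures on metric spaces\<close>

text \<open>The sets with this property form a \<open>\<sigma>\<close>-algebra that contains the closed sets, which are countable
  intersections of their open neighbourhoods.\<close>

lemma finite_borel_measure_regular:
  fixes M :: "'a::metric_space measure"
  assumes fin: "finite_measure M" and sets: "sets M = sets borel" and A: "A \<in> sets borel"
  shows "0 < e \<Longrightarrow> \<exists>F V. closed F \<and> open V \<and> F \<subseteq> A \<and> A \<subseteq> V \<and> measure M (V - F) < e"
proof -
  interpret finite_measure M by (rule fin)
  have op: "open V \<Longrightarrow> V \<in> sets M" and cl: "closed V \<Longrightarrow> V \<in> sets M" for V
    by (auto simp: sets)
  have sp: "space M = UNIV" using sets_eq_imp_space_eq[OF sets] by simp
  have "A \<in> sigma_sets UNIV (Collect closed)" using A by (simp add: borel_eq_closed)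
  then show "0 < e \<Longrightarrow> \<exists>F V. closed F \<and> open V \<and> F \<subseteq> A \<and> A \<subseteq> V \<and> measure M (V - F) < e"
  proof (induction arbitrary: e rule: sigma_sets.induct)
    case (Basic A)
    then have A: "closed A" by simp
    show ?case
    proof (cases "A = {}")
      case True
      then show ?thesis using Basic by (intro exI[of _ "{}"]) auto
    next
      case False
      define V where "V n = {x. infdist x A < inverse (real (Suc n))}" for n
      have V: "open (V n)" "A \<subseteq> V n" for n
        unfolding V_def by (auto intro!: open_Collect_less continuous_intros)
      have "(\<lambda>n. measure M (V n - A)) \<longlonglongrightarrow> measure M (\<Inter>n. V n - A)"
      proof (rule finite_Lim_measure_decseq)
        show "range (\<lambda>n. V n - A) \<subseteq> sets M" using V(1) op cl A by auto
        show "decseq (\<lambda>n. V n - A)"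
        proof (rule decseq_SucI)
          fix n
          have "inverse (real (Suc (Suc n))) \<le> inverse (real (Suc n))" by (rule le_imp_inverse_le) auto
          then show "V (Suc n) - A \<subseteq> V n - A" 
            unfolding V_def using less_le_trans by blast
        qed
      qed
      moreover have "(\<Inter>n. V n - A) = {}"
      proof (rule ccontr)
        assume "(\<Inter>n. V n - A) \<noteq> {}"
        then obtain x where x: "\<And>n. infdist x A < inverse (real (Suc n))" "x \<notin> A"
          by (auto simp: V_def)
        then have "0 < infdist x A"
          using in_closed_iff_infdist_zero[OF A False] infdist_nonneg[of x A] by (simp add: order_le_less)
        then show False using reals_Archimedean x(1) by (meson less_asym)
      qed
      ultimately have "(\<lambda>n. measure M (V n - A)) \<longlonglongrightarrow> 0" by (simp only: measure_empty)
      then have "\<forall>\<^sub>F n in sequentially. measure M (V n - A) < e"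
        using Basic(2) by (rule order_tendstoD(2))
      from eventually_happens'[OF sequentially_bot this]
      obtain n where "measure M (V n - A) < e" by blast
      then show ?thesis using A V by blast
    qed
  next
    case Empty
    then show ?case by (intro exI[of _ "{}"] conjI) simp_all
  next
    case (Compl A)
    obtain F V where FV: "closed F" "open V" "F \<subseteq> A" "A \<subseteq> V" "measure M (V - F) < e"
      using Compl.IH[OF Compl.prems] by blast
    have "- F - - V = V - F" by blast
    then have "closed (- V)" "open (- F)" "- V \<subseteq> UNIV - A" "UNIV - A \<subseteq> - F" "measure M (- F - - V) < e"
      using FV by auto
    then show ?case by blast
  next
    case (Union A)
    have pos: "0 < e / 2 * (1/2) ^ Suc i" for i using Union.prems by simp
    have "\<forall>i. \<exists>F V. closed F \<and> open V \<and> F \<subseteq> A i \<and> A i \<subseteq> V \<and> measure M (V - F) < e / 2 * (1/2) ^ Suc i"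
      using Union.IH[OF pos] by blast
    then obtain F V where FV: "\<And>i. closed (F i)" "\<And>i. open (V i)" "\<And>i. F i \<subseteq> A i" "\<And>i. A i \<subseteq> V i"
      "\<And>i. measure M (V i - F i) < e / 2 * (1/2) ^ Suc i"
      by metis
    have S: "V i - F i \<in> sets M" for i using op cl FV by auto
    have half: "(\<lambda>i. e / 2 * (1/2) ^ Suc i) sums (e / 2)"
      using sums_mult[OF power_half_series, of "e / 2"] by simp
    have summ: "summable (\<lambda>i. measure M (V i - F i))"
      using sums_summable[OF half]
      by (rule summable_comparison_test') (use less_imp_le[OF FV(5)] in simp)
    define W where "W n = (\<Union>i. V i) - (\<Union>i<n. F i)" for n
    have "(\<lambda>n. measure M (W n)) \<longlonglongrightarrow> measure M (\<Inter>n. W n)"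
    proof (rule finite_Lim_measure_decseq)
      show "range W \<subseteq> sets M" using op cl FV by (auto simp: W_def)
      show "decseq W" by (rule decseq_SucI) (auto simp: W_def lessThan_Suc)
    qed
    moreover have "measure M (\<Inter>n. W n) < e"
    proof -
      have "(\<Inter>n. W n) \<subseteq> (\<Union>i. V i - F i)" by (auto simp: W_def)
      then have "measure M (\<Inter>n. W n) \<le> measure M (\<Union>i. V i - F i)"
        using S by (intro finite_measure_mono) auto
      also have "\<dots> \<le> (\<Sum>i. measure M (V i - F i))"
        using S summ by (intro finite_measure_subadditive_countably) auto
      also have "\<dots> \<le> (\<Sum>i. e / 2 * (1/2) ^ Suc i)"
        using summ half FV(5) by (intro suminf_le) (auto simp: sums_iff intro: less_imp_le)
      also have "\<dots> = e / 2" using half by (simp add: sums_iff)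
      also have "\<dots> < e" using Union.prems by simp
      finally show ?thesis .
    qed
    ultimately have "\<forall>\<^sub>F n in sequentially. measure M (W n) < e" by (rule order_tendstoD(2))
    from eventually_happens'[OF sequentially_bot this]
    obtain n where n: "measure M (W n) < e" by blast
    have "closed (\<Union>i<n. F i)" "open (\<Union>i. V i)" using FV by auto
    moreover have "(\<Union>i<n. F i) \<subseteq> (\<Union>i. A i)" "(\<Union>i. A i) \<subseteq> (\<Union>i. V i)" using FV(3,4) by blast+
    ultimately show ?case using n unfolding W_def by blast
  qed
qed

corollary finite_borel_measure_inner_closed:
  fixes M :: "'a::metric_space measure"
  assumes "finite_measure M" "sets M = sets borel" "A \<in> sets borel" "0 < e"
  obtains F where "closed F" "F \<subseteq> A" "measure M (A - F) < e"
proof -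
  interpret finite_measure M by fact
  obtain F V where FV: "closed F" "open V" "F \<subseteq> A" "A \<subseteq> V" "measure M (V - F) < e"
    using finite_borel_measure_regular[OF assms] by blast
  have "measure M (A - F) \<le> measure M (V - F)"
    using FV by (intro finite_measure_mono) (auto simp: assms)
  then show ?thesis using FV that by auto
qed

corollary finite_borel_measure_outer_open:
  fixes M :: "'a::metric_space measure"
  assumes "finite_measure M" "sets M = sets borel" "A \<in> sets borel" "0 < e"
  obtains V where "open V" "A \<subseteq> V" "measure M (V - A) < e"
proof -
  interpret finite_measure M by fact
  obtain F V where FV: "closed F" "open V" "F \<subseteq> A" "A \<subseteq> V" "measure M (V - F) < e"
    using finite_borel_measure_regular[OF assms] by blast
  have "measure M (V - A) \<le> measure M (V - F)"
    using FV by (intro finite_measure_mono) (auto simp: assms)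
  then show ?thesis using FV that by auto
qed

section \<open>Sampling a square-summable family of functions\<close>

definition sqseries :: "(nat \<Rightarrow> 'a \<Rightarrow> complex) \<Rightarrow> 'a \<Rightarrow> ennreal" where
  "sqseries f x = (\<Sum>n. ennreal ((cmod (f n x))\<^sup>2))"

lemma measurable_sqseries [measurable]:
  assumes "\<And>n. f n \<in> borel_measurable M"
  shows "sqseries f \<in> borel_measurable M"
  unfolding sqseries_def using assms by measurable

lemma sqseries_tail_tendsto_0:
  assumes "sqseries f x \<noteq> top"
  shows "(\<lambda>k. sqseries (\<lambda>n. f (n + k)) x) \<longlonglongrightarrow> 0"
proof -
  let ?a = "\<lambda>n. (cmod (f n x))\<^sup>2"
  have s: "summable ?a"
    using assms unfolding sqseries_def by (intro summable_suminf_not_top) auto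
  have "sqseries (\<lambda>n. f (n + k)) x = ennreal (\<Sum>n. ?a (n + k))" for k
    unfolding sqseries_def by (intro suminf_ennreal2 summable_ignore_initial_segment s) auto
  moreover have "(\<lambda>k. ennreal (\<Sum>n. ?a (n + k))) \<longlonglongrightarrow> ennreal 0"
    by (intro tendsto_ennrealI suminf_exist_split2[OF s])
  ultimately show ?thesis by simp
qed

lemma sqseries_tail_le:
  "sqseries (\<lambda>n. f (n + Suc k)) x \<le> sqseries (\<lambda>n. f (n + k)) x"
proof -
  have gen: "(\<Sum>n. a (n + k)) \<le> (\<Sum>n. a n)" for a :: "nat \<Rightarrow> ennreal" and k
  proof (rule suminf_le_const)
    fix N
    have "(\<Sum>n<N. a (n + k)) = (\<Sum>n\<in>{0 + k..<N + k}. a n)"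
      by (simp only: sum.shift_bounds_nat_ivl lessThan_atLeast0)
    also have "\<dots> \<le> (\<Sum>n. a n)" by (rule sum_le_suminf) auto
    finally show "(\<Sum>n<N. a (n + k)) \<le> (\<Sum>n. a n)" .
  qed auto
  show "sqseries (\<lambda>n. f (n + Suc k)) x \<le> sqseries (\<lambda>n. f (n + k)) x"
    unfolding sqseries_def using gen[of "\<lambda>n. ennreal ((cmod (f (n + k) x))\<^sup>2)" 1]
    by (simp add: ac_simps)
qed

text \<open>A closed set \<open>S\<close> on which everything needed later is uniform: the null set \<open>N\<close> is avoided, the sets
  \<open>A k\<close> are relatively open, and the series of squares is bounded with a small tail. What is left
  out must be small for \<open>\<integral> \<Sum> |f n|\<^sup>2 dM\<close>, so regularity is applied to the measure with
  density \<open>\<Sum> |f n|\<^sup>2\<close>. One index \<open>j\<close> serves both as the bound and as the start of the tail.\<close>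

lemma good_closed_set:
  fixes M :: "'a::metric_space measure"
  assumes fin: "finite_measure M" and sets: "sets M = sets borel"
    and f: "\<And>n. f n \<in> borel_measurable M" and int: "(\<integral>\<^sup>+x. sqseries f x \<partial>M) \<noteq> top"
    and N: "N \<in> null_sets M" and A: "\<And>k::nat. A k \<in> sets M" and e: "0 < e"
  obtains S V j where "closed S" "\<And>k. open (V k)" "S \<inter> N = {}" "\<And>k. A k \<inter> S = V k \<inter> S"
    "\<And>x. x \<in> S \<Longrightarrow> sqseries f x \<le> of_nat j"
    "\<And>x. x \<in> S \<Longrightarrow> sqseries (\<lambda>n. f (n + j)) x \<le> ennreal e"
    "(\<integral>\<^sup>+x. sqseries f x * indicator (- S) x \<partial>M) \<le> ennreal e"
proof -
  have sp: "space M = UNIV" using sets_eq_imp_space_eq[OF sets] by simp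
  note [measurable] = f
  define D where "D = density M (sqseries f)"
  have setsD: "sets D = sets borel" by (simp add: D_def sets)
  have spD: "space D = UNIV" by (simp add: D_def sp)
  have emD: "emeasure D B = (\<integral>\<^sup>+x. sqseries f x * indicator B x \<partial>M)" if "B \<in> sets M" for B
    unfolding D_def using that by (intro emeasure_density) auto
  have finD: "finite_measure D"
    by (rule finite_measureI) (use emD[of UNIV] int sp sets.top[of M] in \<open>simp add: spD\<close>)
  interpret D: finite_measure D by (rule finD)
  have nullD: "B \<in> null_sets D" if "B \<in> null_sets M" for B
    using that AE_not_in[OF that] unfolding D_def
    by (auto simp: null_sets_density_iff)
  define G where "G j = {x. x \<notin> N \<and> sqseries f x \<le> of_nat j \<and> sqseries (\<lambda>n. f (n + j)) x \<le> ennreal e}" for j :: nat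
  have NM: "N \<in> sets M" using N by auto
  have G_meas: "G j \<in> sets M" for j
  proof -
    have "G j = {x \<in> space M. x \<notin> N \<and> sqseries f x \<le> of_nat j \<and> sqseries (\<lambda>n. f (n + j)) x \<le> ennreal e}"
      by (simp add: G_def sp)
    also have "\<dots> \<in> sets M" using NM by measurable
    finally show ?thesis .
  qed
  have "(\<lambda>j. measure D (- G j)) \<longlonglongrightarrow> measure D (\<Inter>j. - G j)"
  proof (rule D.finite_Lim_measure_decseq)
    show "range (\<lambda>j. - G j) \<subseteq> sets D"
      using G_meas by (auto simp: D_def sp[symmetric] Compl_eq_Diff_UNIV)
    show "decseq (\<lambda>j. - G j)"
    proof (rule decseq_SucI)
      fix j
      have "(of_nat j :: ennreal) \<le> of_nat (Suc j)" by (simp add: add_increasing)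
      then show "- G (Suc j) \<le> - G j"
        using sqseries_tail_le[of f j] order_trans unfolding G_def by blast
    qed
  qed
  moreover have "measure D (\<Inter>j. - G j) = 0"
  proof -
    have "AE x in M. sqseries f x \<noteq> top" 
      using nn_integral_noteq_infinite[OF measurable_sqseries, of f M] f int by simp
    then have "{x \<in> space M. sqseries f x = top} \<in> null_sets M"
      by (subst (asm) AE_iff_null) auto
    then have Z: "N \<union> {x. sqseries f x = top} \<in> null_sets M" using N by (auto simp: sp)
    have "(\<Inter>j. - G j) \<subseteq> N \<union> {x. sqseries f x = top}"
    proof (rule subsetI, rule ccontr)
      fix x assume x: "x \<in> (\<Inter>j. - G j)" "x \<notin> N \<union> {x. sqseries f x = top}"
      then obtain i :: nat where i: "sqseries f x \<le> of_nat i"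
        using ennreal_Ex_less_of_nat[of "sqseries f x"] by (auto simp: top.not_eq_extremum intro: less_imp_le)
      have "\<forall>\<^sub>F k in sequentially. sqseries (\<lambda>n. f (n + k)) x < ennreal e"
        using sqseries_tail_tendsto_0[of f x] x e by (intro order_tendstoD(2)) auto
      then have "\<forall>\<^sub>F k in sequentially. sqseries (\<lambda>n. f (n + k)) x < ennreal e \<and> i \<le> k"
        using eventually_ge_at_top[of i] by eventually_elim auto
      from eventually_happens'[OF sequentially_bot this]
      obtain k where k: "sqseries (\<lambda>n. f (n + k)) x < ennreal e" "i \<le> k" by blast
      have "(of_nat i :: ennreal) \<le> of_nat k" using k(2) by simp
      then have "sqseries f x \<le> of_nat k" using i by (rule order_trans[rotated])
      then have "x \<in> G k" using k(1) x(2) by (auto simp: G_def)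
      then show False using x by auto
    qed
    then have "measure D (\<Inter>j. - G j) \<le> measure D (N \<union> {x. sqseries f x = top})"
      using nullD[OF Z] by (intro D.finite_measure_mono) auto
    also have "\<dots> = 0" using nullD[OF Z] by (rule measure_eq_0_null_sets)
    finally show ?thesis by (simp add: measure_le_0_iff)
  qed
  ultimately have "(\<lambda>j. measure D (- G j)) \<longlonglongrightarrow> 0" by simp
  then have "\<forall>\<^sub>F j in sequentially. measure D (- G j) < e / 4"
    using e by (intro order_tendstoD(2)) auto
  from eventually_happens'[OF sequentially_bot this]
  obtain j where j: "measure D (- G j) < e / 4" by blast
  have "\<exists>V. open V \<and> A k \<subseteq> V \<and> measure D (V - A k) < e / 4 * (1/2) ^ Suc k" for k
  proof -
    have "A k \<in> sets borel" "0 < e / 4 * (1/2) ^ Suc k" using A[of k] e by (auto simp: sets)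
    from finite_borel_measure_outer_open[OF finD setsD this] show ?thesis by metis
  qed
  then obtain V where V: "\<And>k. open (V k)" "\<And>k. A k \<subseteq> V k"
    "\<And>k. measure D (V k - A k) < e / 4 * (1/2) ^ Suc k"
    by metis
  have VA: "V k - A k \<in> sets D" for k 
    using borel_open[OF V(1)[of k]] A[of k] by (simp add: setsD sets)
  define H where "H = (\<Union>k. V k - A k)"
  have H: "measure D H \<le> e / 4"
  proof -
    have quarter: "(\<lambda>i. e / 4 * (1/2) ^ Suc i) sums (e / 4)"
      using sums_mult[OF power_half_series, of "e / 4"] by simp
    have summ: "summable (\<lambda>i. measure D (V i - A i))"
      using sums_summable[OF quarter]
      by (rule summable_comparison_test') (use less_imp_le[OF V(3)] in simp)
    have "measure D H \<le> (\<Sum>i. measure D (V i - A i))"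
      unfolding H_def using VA summ by (intro D.finite_measure_subadditive_countably) auto
    also have "\<dots> \<le> (\<Sum>i. e / 4 * (1/2) ^ Suc i)"
      using summ quarter V(3) by (intro suminf_le) (auto simp: sums_iff intro: less_imp_le)
    also have "\<dots> = e / 4" using quarter by (simp add: sums_iff)
    finally show ?thesis .
  qed
  have HD: "H \<in> sets borel" using VA unfolding H_def setsD by (intro sets.countable_UN) auto
  have GD: "G j \<in> sets borel" using G_meas by (simp add: sets)
  have "G j - H \<in> sets borel" "0 < e / 4" using HD GD e by auto
  from finite_borel_measure_inner_closed[OF finD setsD this]
  obtain S where S: "closed S" "S \<subseteq> G j - H" "measure D ((G j - H) - S) < e / 4" by metis
  have SD: "S \<in> sets borel" using S by auto
  have "measure D (- S) \<le> measure D (- G j \<union> H \<union> ((G j - H) - S))"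
    using HD GD SD by (intro D.finite_measure_mono) (auto simp: setsD)
  also have "\<dots> \<le> measure D (- G j \<union> H) + measure D ((G j - H) - S)"
    using HD GD SD by (intro measure_Un_le) (auto simp: setsD)
  also have "measure D (- G j \<union> H) \<le> measure D (- G j) + measure D H"
    using HD GD by (intro measure_Un_le) (auto simp: setsD)
  finally have "measure D (- S) \<le> e" using S(3) H j e by simp
  then have "emeasure D (- S) \<le> ennreal e" by (simp add: D.emeasure_eq_measure ennreal_leI)
  moreover have "- S \<in> sets M" using SD by (simp add: sets)
  ultimately have small: "(\<integral>\<^sup>+x. sqseries f x * indicator (- S) x \<partial>M) \<le> ennreal e"
    using emD[of "- S"] by simp
  have rel_open: "A k \<inter> S = V k \<inter> S" for k using S(2) V(2)[of k] unfolding H_def by blast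
  have avoid: "S \<inter> N = {}" using S(2) unfolding G_def by blast
  have bounds: "sqseries f x \<le> of_nat j" "sqseries (\<lambda>n. f (n + j)) x \<le> ennreal e" if "x \<in> S" for x
    using that S(2) unfolding G_def by blast+
  show ?thesis by (rule that[OF S(1) V(1) avoid rel_open bounds small])
qed

lemma cmod_diff_sq_le: "(cmod (a - b))\<^sup>2 \<le> 2 * (cmod a)\<^sup>2 + 2 * (cmod b)\<^sup>2"
proof -
  have "(cmod (a - b))\<^sup>2 \<le> (cmod a + cmod b)\<^sup>2" by (intro power_mono norm_triangle_ineq4) auto
  also have "\<dots> \<le> 2 * (cmod a)\<^sup>2 + 2 * (cmod b)\<^sup>2"
    using sum_squares_bound[of "cmod a" "cmod b"] unfolding power2_sum by linarith
  finally show ?thesis .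
qed

lemma term_le_sqseries: "ennreal ((cmod (f n x))\<^sup>2) \<le> sqseries f x"
proof -
  have "(\<Sum>n\<in>{n}. ennreal ((cmod (f n x))\<^sup>2)) \<le> sqseries f x"
    unfolding sqseries_def by (rule sum_le_suminf) auto
  then show ?thesis by simp
qed

lemma sqseries_diff_le:
  "sqseries (\<lambda>n y. f n y - g n y) x \<le> 2 * sqseries f x + 2 * sqseries g x"
proof -
  have "sqseries (\<lambda>n y. f n y - g n y) x
      \<le> (\<Sum>n. ennreal (2 * (cmod (f n x))\<^sup>2) + ennreal (2 * (cmod (g n x))\<^sup>2))"
    unfolding sqseries_def using cmod_diff_sq_le
    by (intro suminf_le) (auto simp flip: ennreal_plus intro!: ennreal_leI)
  also have "\<dots> = 2 * sqseries f x + 2 * sqseries g x"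
    unfolding sqseries_def by (simp add: suminf_add[symmetric] ennreal_mult)
  finally show ?thesis .
qed

lemma sqseries_sum_le:
  assumes "finite I"
  shows "sqseries (\<lambda>n y. \<Sum>i\<in>I. g i n y) x \<le> of_nat (card I) * (\<Sum>i\<in>I. sqseries (g i) x)"
proof -
  have le: "(cmod (\<Sum>i\<in>I. g i n x))\<^sup>2 \<le> real (card I) * (\<Sum>i\<in>I. (cmod (g i n x))\<^sup>2)" for n
  proof -
    have "(cmod (\<Sum>i\<in>I. g i n x))\<^sup>2 \<le> (\<Sum>i\<in>I. cmod (g i n x))\<^sup>2"
      by (intro power_mono norm_sum) auto
    also have "\<dots> \<le> (\<Sum>i\<in>I. (cmod (g i n x))\<^sup>2) * real (card I)"
      by (rule sum_squared_le_sum_of_squares)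
    finally show ?thesis by (simp add: mult.commute)
  qed
  have "sqseries (\<lambda>n y. \<Sum>i\<in>I. g i n y) x
      \<le> (\<Sum>n. of_nat (card I) * (\<Sum>i\<in>I. ennreal ((cmod (g i n x))\<^sup>2)))"
    unfolding sqseries_def
  proof (intro suminf_le)
    fix n
    have "ennreal ((cmod (\<Sum>i\<in>I. g i n x))\<^sup>2) \<le> ennreal (real (card I) * (\<Sum>i\<in>I. (cmod (g i n x))\<^sup>2))"
      by (rule ennreal_leI[OF le])
    also have "\<dots> = of_nat (card I) * (\<Sum>i\<in>I. ennreal ((cmod (g i n x))\<^sup>2))"
      by (simp add: ennreal_mult sum_nonneg ennreal_of_nat_eq_real_of_nat sum_ennreal)
    finally show "ennreal ((cmod (\<Sum>i\<in>I. g i n x))\<^sup>2) \<le> of_nat (card I) * (\<Sum>i\<in>I. ennreal ((cmod (g i n x))\<^sup>2))" .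
  qed auto
  also have "\<dots> = of_nat (card I) * (\<Sum>n. \<Sum>i\<in>I. ennreal ((cmod (g i n x))\<^sup>2))"
    by (rule ennreal_suminf_cmult)
  also have "(\<Sum>n. \<Sum>i\<in>I. ennreal ((cmod (g i n x))\<^sup>2)) = (\<Sum>i\<in>I. sqseries (g i) x)"
    unfolding sqseries_def by (rule suminf_sum) auto
  finally show ?thesis .
qed

lemma same_floor_cmod_le:
  assumes h: "0 < h" and "\<lfloor>Re z / h\<rfloor> = \<lfloor>Re w / h\<rfloor>" "\<lfloor>Im z / h\<rfloor> = \<lfloor>Im w / h\<rfloor>"
  shows "(cmod (z - w))\<^sup>2 \<le> 2 * h\<^sup>2"
proof -
  have *: "\<bar>a - b\<bar> \<le> h" if "\<lfloor>a / h\<rfloor> = \<lfloor>b / h\<rfloor>" for a b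
  proof -
    have "\<bar>a / h - b / h\<bar> < 1" using that by linarith
    then have "\<bar>(a - b) / h\<bar> < 1" by (simp add: diff_divide_distrib)
    then show ?thesis using h by (simp add: abs_divide divide_less_eq)
  qed
  have "(Re z - Re w)\<^sup>2 \<le> h\<^sup>2" "(Im z - Im w)\<^sup>2 \<le> h\<^sup>2"
    using *[OF assms(2)] *[OF assms(3)] h by (auto simp flip: abs_le_square_iff)
  then show ?thesis unfolding cmod_power2 by simp
qed

text \<open>The points of \<open>S\<close> are classified by a label that records membership in \<open>V 0, ..., V (m - 1)\<close> and the
  values of \<open>f 0, ..., f (j - 1)\<close> on a grid of mesh \<open>h\<close>. There are finitely many labels because the
  values are bounded on \<open>S\<close>. In each label class \<open>P c\<close> a closed set \<open>F c\<close> of almost full measure is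
  chosen, and one of its points as the sample; the nonempty sets \<open>F c\<close>, indexed by their sample points,
  are the cells \<open>\<kappa> x\<close>. Within a cell, the first \<open>j\<close> functions oscillate little by the choice of the
  grid and the others are small altogether.\<close>

lemma sample_cells:
  fixes M :: "'a::metric_space measure" and V :: "nat \<Rightarrow> 'a set" and m :: nat
  assumes fin: "finite_measure M" and sets: "sets M = sets borel"
    and f: "\<And>n. f n \<in> borel_measurable M" and int: "(\<integral>\<^sup>+x. sqseries f x \<partial>M) \<noteq> top"
    and S: "closed S" and V: "\<And>k. open (V k)"
    and bound: "\<forall>x\<in>S. sqseries f x \<le> of_nat j"
    and tail: "\<forall>x\<in>S. sqseries (\<lambda>n. f (n + j)) x \<le> ennreal e"
    and e: "0 < e"
  obtains I \<kappa> where "finite I" "\<And>x. x \<in> I \<Longrightarrow> closed (\<kappa> x) \<and> x \<in> \<kappa> x \<and> \<kappa> x \<subseteq> S"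
    "\<And>x x'. x \<in> I \<Longrightarrow> x' \<in> I \<Longrightarrow> x \<noteq> x' \<Longrightarrow> \<kappa> x \<inter> \<kappa> x' = {}"
    "\<And>x y k. x \<in> I \<Longrightarrow> y \<in> \<kappa> x \<Longrightarrow> k < m \<Longrightarrow> y \<in> V k \<longleftrightarrow> x \<in> V k"
    "\<And>x y. x \<in> I \<Longrightarrow> y \<in> \<kappa> x \<Longrightarrow> sqseries (\<lambda>n z. f n z - f n x) y \<le> ennreal (5 * e)"
    "(\<integral>\<^sup>+x. sqseries f x * indicator (S - (\<Union>x\<in>I. \<kappa> x)) x \<partial>M) \<le> ennreal e"
proof -
  have sp: "space M = UNIV" using sets_eq_imp_space_eq[OF sets] by simp
  note [measurable] = f
  define D where "D = density M (sqseries f)"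
  have setsD: "sets D = sets borel" by (simp add: D_def sets)
  have emD: "emeasure D B = (\<integral>\<^sup>+x. sqseries f x * indicator B x \<partial>M)" if "B \<in> sets M" for B
    unfolding D_def using that by (intro emeasure_density) auto
  have finD: "finite_measure D"
    by (rule finite_measureI) (use emD[of UNIV] int sp sets.top[of M] in \<open>simp add: D_def\<close>)
  interpret D: finite_measure D by (rule finD)
  \<comment> \<open>The mesh is such that \<open>j\<close> terms of size \<open>2 h\<^sup>2\<close> add up to at most \<open>e\<close>.\<close>
  define h where "h = sqrt (e / (2 * real (Suc j)))"
  have h: "0 < h" "h\<^sup>2 = e / (2 * real (Suc j))" using e by (auto simp: h_def)
  define lab where "lab y = (map (\<lambda>k. y \<in> V k) [0..<m], map (\<lambda>n. \<lfloor>Re (f n y) / h\<rfloor>) [0..<j],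
      map (\<lambda>n. \<lfloor>Im (f n y) / h\<rfloor>) [0..<j])" for y
  have lab_eq: "lab y = lab x \<longleftrightarrow> (\<forall>k. k < m \<longrightarrow> (y \<in> V k \<longleftrightarrow> x \<in> V k)) \<and>
      (\<forall>n. n < j \<longrightarrow> \<lfloor>Re (f n y) / h\<rfloor> = \<lfloor>Re (f n x) / h\<rfloor> \<and> \<lfloor>Im (f n y) / h\<rfloor> = \<lfloor>Im (f n x) / h\<rfloor>)" for x y
    by (auto simp: lab_def)
  have lab_fin: "finite (lab ` S)"
  proof -
    define B where "B = {\<lfloor>- sqrt (real j) / h\<rfloor>..\<lfloor>sqrt (real j) / h\<rfloor>}"
    have fl: "\<lfloor>t / h\<rfloor> \<in> B" if "\<bar>t\<bar> \<le> sqrt (real j)" for t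
    proof -
      have "- sqrt (real j) / h \<le> t / h" "t / h \<le> sqrt (real j) / h"
        using that h(1) by (intro divide_right_mono; linarith)+
      then show ?thesis unfolding B_def atLeastAtMost_iff by (intro conjI floor_mono)
    qed
    have "cmod (f n y) \<le> sqrt (real j)" if "y \<in> S" for n y
    proof -
      have "ennreal ((cmod (f n y))\<^sup>2) \<le> ennreal (real j)"
        using order_trans[OF term_le_sqseries bound[rule_format, OF that]] by (simp add: ennreal_of_nat_eq_real_of_nat)
      then have "(cmod (f n y))\<^sup>2 \<le> real j" by simp
      then show ?thesis by (rule real_le_rsqrt)
    qed
    then have "\<bar>Re (f n y)\<bar> \<le> sqrt (real j)" "\<bar>Im (f n y)\<bar> \<le> sqrt (real j)" if "y \<in> S" for n y
      using order_trans[OF abs_Re_le_cmod] order_trans[OF abs_Im_le_cmod] that by blast+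
    then have "lab ` S \<subseteq> {xs. set xs \<subseteq> UNIV \<and> length xs = m} \<times>
        ({xs. set xs \<subseteq> B \<and> length xs = j} \<times> {xs. set xs \<subseteq> B \<and> length xs = j})"
      by (auto simp: lab_def intro!: fl)
    then show ?thesis
      by (rule finite_subset) (intro finite_cartesian_product finite_lists_length_eq; simp add: B_def)
  qed
  define P where "P c = {y \<in> S. lab y = c}" for c
  have P_meas: "P c \<in> sets borel" if "c \<in> lab ` S" for c
  proof -
    obtain x where c: "c = lab x" using \<open>c \<in> lab ` S\<close> by auto
    have [measurable]: "S \<in> sets M" "\<And>k. V k \<in> sets M" using S V by (auto simp: sets)
    have "P c = {y \<in> space M. y \<in> S \<and> (\<forall>k. k < m \<longrightarrow> (y \<in> V k \<longleftrightarrow> x \<in> V k)) \<and>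
      (\<forall>n. n < j \<longrightarrow> \<lfloor>Re (f n y) / h\<rfloor> = \<lfloor>Re (f n x) / h\<rfloor> \<and> \<lfloor>Im (f n y) / h\<rfloor> = \<lfloor>Im (f n x) / h\<rfloor>)}"
      unfolding P_def c lab_eq by (auto simp: sp)
    also have "\<dots> \<in> sets M" by measurable
    finally show ?thesis by (simp add: sets)
  qed
  define N where "N = real (Suc (card (lab ` S)))"
  have N: "0 < e / N" using e by (simp add: N_def)
  have "\<forall>c\<in>lab ` S. \<exists>F. closed F \<and> F \<subseteq> P c \<and> measure D (P c - F) < e / N"
    using finite_borel_measure_inner_closed[OF finD setsD P_meas N] by metis
  then obtain F where F: "\<And>c. c \<in> lab ` S \<Longrightarrow> closed (F c)" "\<And>c. c \<in> lab ` S \<Longrightarrow> F c \<subseteq> P c"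
    "\<And>c. c \<in> lab ` S \<Longrightarrow> measure D (P c - F c) < e / N" by metis
  define s where "s c = (SOME x. x \<in> F c)" for c
  have s: "s c \<in> F c" if "F c \<noteq> {}" for c
    unfolding s_def using that by (rule some_in_eq[THEN iffD2])
  define C where "C = {c \<in> lab ` S. F c \<noteq> {}}"
  have lab_s: "lab (s c) = c" if "c \<in> C" for c
    using that s[of c] F(2)[of c] unfolding C_def P_def by blast
  define I where "I = s ` C"
  define \<kappa> where "\<kappa> x = F (lab x)" for x
  have IC: "\<exists>c\<in>C. x = s c \<and> lab x = c" if "x \<in> I" for x using that lab_s unfolding I_def by blast
  have I_props: "closed (\<kappa> x) \<and> x \<in> \<kappa> x \<and> \<kappa> x \<subseteq> S" if "x \<in> I" for x
  proof -
    obtain c where c: "c \<in> C" "x = s c" "lab x = c" using IC[OF \<open>x \<in> I\<close>] by blast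
    then show ?thesis using F(1,2)[of c] s[of c] unfolding \<kappa>_def C_def P_def by auto
  qed
  have in_cell: "lab y = lab x \<and> y \<in> S" if "x \<in> I" "y \<in> \<kappa> x" for x y
  proof -
    obtain c where c: "c \<in> C" "x = s c" "lab x = c" using IC[OF \<open>x \<in> I\<close>] by blast
    then show ?thesis using F(2)[of c] that(2) unfolding \<kappa>_def C_def P_def by auto
  qed
  have disj: "\<kappa> x \<inter> \<kappa> x' = {}" if "x \<in> I" "x' \<in> I" "x \<noteq> x'" for x x'
  proof (rule ccontr)
    assume "\<kappa> x \<inter> \<kappa> x' \<noteq> {}"
    then obtain y where "y \<in> \<kappa> x" "y \<in> \<kappa> x'" by blast
    then have "lab x = lab x'" using in_cell[OF \<open>x \<in> I\<close>] in_cell[OF \<open>x' \<in> I\<close>] by metis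
    then show False using IC[OF that(1)] IC[OF that(2)] that(3) by auto
  qed
  have osc: "sqseries (\<lambda>n z. f n z - f n x) y \<le> ennreal (5 * e)" if x: "x \<in> I" "y \<in> \<kappa> x" for x y
  proof -
    have same: "lab y = lab x" and yS: "y \<in> S" using in_cell[OF x] by auto
    have xS: "x \<in> S" using I_props[OF x(1)] by blast
    let ?g = "\<lambda>n. ennreal ((cmod (f n y - f n x))\<^sup>2)"
    have "(\<Sum>n<j. ?g n) \<le> (\<Sum>n<j. ennreal (e / real (Suc j)))"
    proof (intro sum_mono ennreal_leI)
      fix n assume "n \<in> {..<j}"
      then have "(cmod (f n y - f n x))\<^sup>2 \<le> 2 * h\<^sup>2"
        using same unfolding lab_eq by (intro same_floor_cmod_le[OF h(1)]) auto
      also have "2 * h\<^sup>2 = e / real (Suc j)" unfolding h(2) by (simp del: of_nat_Suc)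
      finally show "(cmod (f n y - f n x))\<^sup>2 \<le> e / real (Suc j)" .
    qed
    also have "\<dots> = ennreal (real j * (e / real (Suc j)))"
      using e by (simp add: ennreal_of_nat_eq_real_of_nat ennreal_mult[symmetric])
    also have "\<dots> \<le> ennreal e" using e by (intro ennreal_leI) (simp add: field_simps)
    finally have head: "(\<Sum>n<j. ?g n) \<le> ennreal e" .
    have "(\<Sum>n. ?g (n + j)) = sqseries (\<lambda>n z. f (n + j) z - (\<lambda>_. f (n + j) x) z) y"
      by (simp add: sqseries_def)
    also have "\<dots> \<le> 2 * sqseries (\<lambda>n. f (n + j)) y + 2 * sqseries (\<lambda>n _. f (n + j) x) y"
      by (rule sqseries_diff_le)
    also have "sqseries (\<lambda>n _. f (n + j) x) y = sqseries (\<lambda>n. f (n + j)) x" by (simp add: sqseries_def)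
    also have "2 * sqseries (\<lambda>n. f (n + j)) y + 2 * sqseries (\<lambda>n. f (n + j)) x \<le> 2 * ennreal e + 2 * ennreal e"
      using tail[rule_format, OF yS] tail[rule_format, OF xS] by (intro add_mono mult_left_mono) auto
    finally have rest: "(\<Sum>n. ?g (n + j)) \<le> 2 * ennreal e + 2 * ennreal e" .
    have "sqseries (\<lambda>n z. f n z - f n x) y = (\<Sum>n<j. ?g n) + (\<Sum>n. ?g (n + j))"
      unfolding sqseries_def by (subst suminf_offset[of ?g j]) (auto simp: add.commute)
    also have "\<dots> \<le> ennreal e + (2 * ennreal e + 2 * ennreal e)" by (intro add_mono head rest)
    also have "\<dots> = ennreal e + (ennreal (2 * e) + ennreal (2 * e))" using e by (simp add: ennreal_mult)
    also have "\<dots> = ennreal (5 * e)" using e by (simp flip: ennreal_plus)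
    finally show ?thesis .
  qed
  have small: "(\<integral>\<^sup>+x. sqseries f x * indicator (S - (\<Union>x\<in>I. \<kappa> x)) x \<partial>M) \<le> ennreal e"
  proof -
    have "S - (\<Union>x\<in>I. \<kappa> x) \<subseteq> (\<Union>c\<in>lab ` S. P c - F c)"
    proof
      fix y assume y: "y \<in> S - (\<Union>x\<in>I. \<kappa> x)"
      have "y \<notin> F (lab y)"
      proof
        assume "y \<in> F (lab y)"
        then have "lab y \<in> C" using y by (auto simp: C_def)
        then have "y \<in> \<kappa> (s (lab y))" "s (lab y) \<in> I"
          using \<open>y \<in> F (lab y)\<close> lab_s by (auto simp: \<kappa>_def I_def)
        then show False using y by blast
      qed
      then show "y \<in> (\<Union>c\<in>lab ` S. P c - F c)" using y by (auto simp: P_def)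
    qed
    moreover have PF: "P c - F c \<in> sets D" if "c \<in> lab ` S" for c
      using P_meas[OF that] F(1)[OF that] by (simp add: setsD sets.Diff)
    ultimately have "measure D (S - (\<Union>x\<in>I. \<kappa> x)) \<le> measure D (\<Union>c\<in>lab ` S. P c - F c)"
      using lab_fin by (intro D.finite_measure_mono sets.finite_UN) auto
    also have "\<dots> \<le> (\<Sum>c\<in>lab ` S. measure D (P c - F c))"
      using lab_fin PF by (intro D.finite_measure_subadditive_finite) auto
    also have "\<dots> \<le> (\<Sum>c\<in>lab ` S. e / N)" using F(3) by (intro sum_mono less_imp_le) auto
    also have "\<dots> = real (card (lab ` S)) * (e / N)" by simp
    also have "\<dots> \<le> e" using e by (simp add: N_def field_simps)
    finally have "emeasure D (S - (\<Union>x\<in>I. \<kappa> x)) \<le> ennreal e"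
      by (simp add: D.emeasure_eq_measure ennreal_leI)
    moreover have "S - (\<Union>x\<in>I. \<kappa> x) \<in> sets M"
    proof -
      have "closed (\<Union>x\<in>I. \<kappa> x)"
        using lab_fin I_props by (intro closed_UN) (auto simp: I_def C_def)
      then show ?thesis using S by (auto simp: sets)
    qed
    ultimately show ?thesis using emD by simp
  qed
  have finI: "finite I" using lab_fin by (simp add: I_def C_def)
  have same: "y \<in> V k \<longleftrightarrow> x \<in> V k" if "x \<in> I" "y \<in> \<kappa> x" "k < m" for x y k
    using in_cell[OF that(1,2)] that(3) unfolding lab_eq by blast
  show ?thesis by (rule that[OF finI I_props disj same osc small])
qed

definition bump :: "real \<Rightarrow> 'a::metric_space set \<Rightarrow> 'a \<Rightarrow> real" where
  "bump r K y = max 0 (1 - infdist y K / r)"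

lemma bump_bounds: "0 < r \<Longrightarrow> 0 \<le> bump r K y \<and> bump r K y \<le> 1"
  using infdist_nonneg[of y K] by (simp add: bump_def)

lemma bump_eq_1: "y \<in> K \<Longrightarrow> bump r K y = 1"
  by (simp add: bump_def)

lemma bump_eq_0: "0 < r \<Longrightarrow> r \<le> infdist y K \<Longrightarrow> bump r K y = 0"
  by (simp add: bump_def)

lemma continuous_on_bump [continuous_intros]: "continuous_on S (bump r K)"
  unfolding bump_def divide_inverse by (intro continuous_intros)

lemma compact_closed_gap:
  fixes K E :: "'c::metric_space set"
  assumes K: "compact K" and E: "closed E" "K \<inter> E = {}"
  obtains d where "0 < d" "\<And>p q. p \<in> K \<Longrightarrow> q \<in> E \<Longrightarrow> d \<le> dist p q"
proof (cases "K = {} \<or> E = {}")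
  case True
  then show ?thesis using that[of 1] by auto
next
  case False
  then obtain p where p: "p \<in> K" "\<And>q. q \<in> K \<Longrightarrow> infdist p E \<le> infdist q E"
    using continuous_attains_inf[OF K _ continuous_on_infdist[OF continuous_on_id], of E] by auto
  have "p \<notin> E" using p(1) E(2) by auto
  then have "0 < infdist p E"
    using in_closed_iff_infdist_zero[OF E(1)] infdist_nonneg[of p E] False by (simp add: order_le_less)
  then show ?thesis using that[of "infdist p E"] p(2) infdist_le order_trans by blast
qed

lemma infdist_lessE:
  assumes "infdist x A < r" "A \<noteq> {}"
  obtains a where "a \<in> A" "dist x a < r"
  using assms cInf_lessD[of "dist x ` A" r] by (auto simp: infdist_notempty)

text \<open>The compact set \<open>K \<times> L\<close> has a positive distance \<open>d\<close> from \<open>E\<close>, so for \<open>r < d / 4\<close> the product of the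
  bumps is zero within \<open>d / 4\<close> of \<open>E\<close>.\<close>

lemma bump_product_vanishes:
  fixes K :: "'a::metric_space set" and L :: "'b::metric_space set"
  assumes K: "compact K" "K \<noteq> {}" and L: "compact L" "L \<noteq> {}" and E: "closed E" "(K \<times> L) \<inter> E = {}"
  shows "\<forall>\<^sub>F r in at_right 0. \<exists>U. open U \<and> E \<subseteq> U \<and> (\<forall>(a, b)\<in>U. bump r K a * bump r L b = 0)"
proof -
  obtain d where d: "0 < d" "\<And>p q. p \<in> K \<times> L \<Longrightarrow> q \<in> E \<Longrightarrow> d \<le> dist p q"
    using compact_closed_gap[OF compact_Times[OF K(1) L(1)] E] by blast
  have "\<exists>U. open U \<and> E \<subseteq> U \<and> (\<forall>(a, b)\<in>U. bump r K a * bump r L b = 0)" if r: "0 < r" "r < d / 4" for r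
  proof (intro exI conjI)
    let ?U = "\<Union>q\<in>E. ball q (d / 4)"
    show "open ?U" by auto
    show "E \<subseteq> ?U" using d(1) by auto
    show "\<forall>(a, b)\<in>?U. bump r K a * bump r L b = 0"
    proof (clarify, rule ccontr)
      fix a b c e
      assume q: "(c, e) \<in> E" and ab: "(a, b) \<in> ball (c, e) (d / 4)"
        and "bump r K a * bump r L b \<noteq> 0"
      then have "infdist a K < r" "infdist b L < r"
        using bump_eq_0[OF r(1), of a K] bump_eq_0[OF r(1), of b L] by force+
      then obtain a' b' where a': "a' \<in> K" "dist a a' < r" and b': "b' \<in> L" "dist b b' < r"
        using infdist_lessE K(2) L(2) by metis
      have "dist (a', b') (a, b) \<le> dist a' a + dist b' b"
        unfolding dist_Pair_Pair by (rule sqrt_sum_squares_le_sum) auto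
      then have "dist (a', b') (c, e) < r + r + d / 4"
        using dist_triangle[of "(a', b')" "(c, e)" "(a, b)"] a' b' ab by (simp add: dist_commute)
      also have "\<dots> < d" using r by simp
      finally show False using d(2)[of "(a', b')" "(c, e)"] a' b' q by simp
    qed
  qed
  then show ?thesis
    using d(1) unfolding eventually_at_right_field by (intro exI[of _ "d / 4"]) auto
qed

lemma eventually_at_right_0_le: "0 < d \<Longrightarrow> \<forall>\<^sub>F r in at_right 0. r \<le> (d::real)"
  unfolding eventually_at_right_field by (intro exI[of _ d]) auto

lemma eventually_small_collar:
  fixes M :: "'a::metric_space measure"
  assumes fin: "finite_measure M" and sets: "sets M = sets borel"
    and I: "finite I" and \<kappa>: "\<And>x. x \<in> I \<Longrightarrow> closed (\<kappa> x) \<and> \<kappa> x \<noteq> {}" and \<eta>: "0 < \<eta>"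
  shows "\<forall>\<^sub>F r in at_right 0. measure M ({y. \<exists>x\<in>I. infdist y (\<kappa> x) < r} - (\<Union>x\<in>I. \<kappa> x)) < \<eta>"
proof -
  interpret finite_measure M by (rule fin)
  let ?B = "\<Union>x\<in>I. \<kappa> x"
  define W where "W r = {y. \<exists>x\<in>I. infdist y (\<kappa> x) < r}" for r
  have W_open: "open (W r)" for r
  proof -
    have "W r = (\<Union>x\<in>I. {y. infdist y (\<kappa> x) < r})" by (auto simp: W_def)
    also have "open \<dots>" by (intro open_UN ballI open_Collect_less continuous_intros)
    finally show ?thesis .
  qed
  have B_closed: "closed ?B" using I \<kappa> by (intro closed_UN) auto
  have meas: "W r - ?B \<in> sets M" for r using W_open[of r] B_closed by (auto simp: sets)
  have W_mono: "W r - ?B \<subseteq> W r' - ?B" if "r \<le> r'" for r r'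
    using that unfolding W_def by force
  define T where "T n = W (inverse (real (Suc n))) - ?B" for n
  have "(\<lambda>n. measure M (T n)) \<longlonglongrightarrow> measure M (\<Inter>n. T n)"
  proof (rule finite_Lim_measure_decseq)
    show "range T \<subseteq> sets M" using meas by (auto simp: T_def)
    show "decseq T"
      unfolding T_def by (rule decseq_SucI, rule W_mono, rule le_imp_inverse_le) auto
  qed
  moreover have "(\<Inter>n. T n) = {}"
  proof (rule ccontr)
    assume "(\<Inter>n. T n) \<noteq> {}"
    then obtain y where y: "\<And>n. y \<in> T n" by auto
    have "\<forall>\<^sub>F r in at_right 0. \<forall>x\<in>I. r \<le> infdist y (\<kappa> x)"
    proof (rule eventually_ball_finite[OF I], intro ballI)
      fix x assume x: "x \<in> I"
      then have "y \<notin> \<kappa> x" using y[of 0] by (auto simp: T_def)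
      then have "0 < infdist y (\<kappa> x)"
        using \<kappa>[OF x] in_closed_iff_infdist_zero[of "\<kappa> x" y] infdist_nonneg[of y "\<kappa> x"]
        by (simp add: order_le_less)
      then show "\<forall>\<^sub>F r in at_right 0. r \<le> infdist y (\<kappa> x)" by (rule eventually_at_right_0_le)
    qed
    then obtain b :: real where b: "0 < b" "\<And>r. 0 < r \<Longrightarrow> r < b \<Longrightarrow> \<forall>x\<in>I. r \<le> infdist y (\<kappa> x)"
      unfolding eventually_at_right_field by blast
    obtain n where n: "inverse (real (Suc n)) < b" using reals_Archimedean[OF b(1)] by blast
    have "y \<in> W (inverse (real (Suc n)))" using y[of n] by (simp add: T_def)
    then obtain x where "x \<in> I" "infdist y (\<kappa> x) < inverse (real (Suc n))" unfolding W_def by blast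
    then show False using b(2)[OF _ n] by force
  qed
  ultimately have "(\<lambda>n. measure M (T n)) \<longlonglongrightarrow> 0" by (simp only: measure_empty)
  then have "\<forall>\<^sub>F n in sequentially. measure M (T n) < \<eta>" using \<eta> by (rule order_tendstoD(2))
  from eventually_happens'[OF sequentially_bot this]
  obtain n where n: "measure M (T n) < \<eta>" by blast
  have "\<forall>\<^sub>F r in at_right 0. r \<le> inverse (real (Suc n))" by (rule eventually_at_right_0_le) simp
  then have "\<forall>\<^sub>F r in at_right 0. measure M (W r - ?B) < \<eta>"
  proof eventually_elim
    case (elim r)
    have "measure M (W r - ?B) \<le> measure M (T n)"
      unfolding T_def using elim meas by (intro finite_measure_mono W_mono)
    then show ?case using n by simp
  qed
  then show ?thesis by (simp only: W_def)
qed

lemma eventually_separated: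
  fixes \<kappa> :: "'a::metric_space \<Rightarrow> 'a set"
  assumes X: "compact (UNIV :: 'a set)" and I: "finite I" and \<kappa>: "\<And>x. x \<in> I \<Longrightarrow> closed (\<kappa> x) \<and> \<kappa> x \<noteq> {}"
    and disj: "\<And>x x'. x \<in> I \<Longrightarrow> x' \<in> I \<Longrightarrow> x \<noteq> x' \<Longrightarrow> \<kappa> x \<inter> \<kappa> x' = {}"
  shows "\<forall>\<^sub>F r in at_right 0. \<forall>x\<in>I. \<forall>x'\<in>I. x \<noteq> x' \<longrightarrow> (\<forall>y\<in>\<kappa> x. r \<le> infdist y (\<kappa> x'))"
proof (intro eventually_ball_finite[OF I] ballI)
  fix x x' assume x: "x \<in> I" "x' \<in> I"
  show "\<forall>\<^sub>F r in at_right 0. x \<noteq> x' \<longrightarrow> (\<forall>y\<in>\<kappa> x. r \<le> infdist y (\<kappa> x'))"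
  proof (cases "x = x'")
    case False
    have "compact (\<kappa> x)" using compact_Int_closed[OF X, of "\<kappa> x"] \<kappa>[OF x(1)] by simp
    then obtain d where d: "0 < d" "\<And>p q. p \<in> \<kappa> x \<Longrightarrow> q \<in> \<kappa> x' \<Longrightarrow> d \<le> dist p q"
      using compact_closed_gap[of "\<kappa> x" "\<kappa> x'"] \<kappa>[OF x(2)] disj[OF x False] by blast
    have "d \<le> infdist y (\<kappa> x')" if "y \<in> \<kappa> x" for y
      using d(2)[OF that] \<kappa>[OF x(2)] by (auto simp: infdist_notempty intro!: cINF_greatest)
    with eventually_at_right_0_le[OF d(1)] show ?thesis
      by (auto elim!: eventually_mono intro: order_trans)
  qed auto
qed

text \<open>For small \<open>r\<close> the bumps of different cells do not meet the other cells, so on a cell the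
  approximation equals the sample value and the error is the oscillation. Outside of the cells the
  error is at most twice \<open>\<Sum> |f n|\<^sup>2\<close>, which has a small integral there, plus a multiple \<open>2 c\<close> of the
  indicator of the collar \<open>W r\<close> around the cells. The constant \<open>c\<close> is crude, but it is fixed before
  the measure of the collar tends to 0 with \<open>r\<close>.\<close>

lemma bump_approximation:
  fixes M :: "'a::metric_space measure"
  assumes X: "compact (UNIV :: 'a set)" and fin: "finite_measure M" and sets: "sets M = sets borel"
    and f: "\<And>n. f n \<in> borel_measurable M"
    and S: "closed S" and bound: "\<And>x. x \<in> S \<Longrightarrow> sqseries f x \<le> of_nat j" and e: "0 < e"
    and offS: "(\<integral>\<^sup>+x. sqseries f x * indicator (- S) x \<partial>M) \<le> ennreal e"
    and I: "finite I" and \<kappa>: "\<And>x. x \<in> I \<Longrightarrow> closed (\<kappa> x) \<and> x \<in> \<kappa> x \<and> \<kappa> x \<subseteq> S"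
    and disj: "\<And>x x'. x \<in> I \<Longrightarrow> x' \<in> I \<Longrightarrow> x \<noteq> x' \<Longrightarrow> \<kappa> x \<inter> \<kappa> x' = {}"
    and osc: "\<And>x y. x \<in> I \<Longrightarrow> y \<in> \<kappa> x \<Longrightarrow> sqseries (\<lambda>n z. f n z - f n x) y \<le> ennreal (5 * e)"
    and off\<kappa>: "(\<integral>\<^sup>+x. sqseries f x * indicator (S - (\<Union>x\<in>I. \<kappa> x)) x \<partial>M) \<le> ennreal e"
  shows "\<forall>\<^sub>F r in at_right 0.
    (\<integral>\<^sup>+y. sqseries (\<lambda>n y. f n y - (\<Sum>x\<in>I. f n x * of_real (bump r (\<kappa> x) y))) y \<partial>M)
      \<le> ennreal (5 * e * (measure M UNIV + 1))"
proof -
  interpret finite_measure M by (rule fin)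
  have sp: "space M = UNIV" using sets_eq_imp_space_eq[OF sets] by simp
  note [measurable] = f
  define B where "B = (\<Union>x\<in>I. \<kappa> x)"
  define W where "W r = {y. \<exists>x\<in>I. infdist y (\<kappa> x) < r} - B" for r
  define c where "c = real (card I) * (real (card I) * real j)"
  have c0: "0 \<le> c" by (simp add: c_def)
  have \<kappa>': "closed (\<kappa> x) \<and> \<kappa> x \<noteq> {}" if "x \<in> I" for x using \<kappa>[OF that] by blast
  have Bm [measurable]: "B \<in> sets M" using I \<kappa>' unfolding B_def sets by (intro borel_closed closed_UN) auto
  have Sm [measurable]: "S \<in> sets M" using S by (simp add: sets)
  have offB: "(\<integral>\<^sup>+y. sqseries f y * indicator (- B) y \<partial>M) \<le> ennreal (2 * e)"
  proof -
    have "(\<integral>\<^sup>+y. sqseries f y * indicator (- B) y \<partial>M)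
        \<le> (\<integral>\<^sup>+y. sqseries f y * indicator (- S) y + sqseries f y * indicator (S - B) y \<partial>M)"
      by (intro nn_integral_mono) (auto simp: indicator_def)
    also have "\<dots> = (\<integral>\<^sup>+y. sqseries f y * indicator (- S) y \<partial>M) + (\<integral>\<^sup>+y. sqseries f y * indicator (S - B) y \<partial>M)"
      by (rule nn_integral_add) (use Sm Bm sp in \<open>auto intro!: borel_measurable_times_ennreal borel_measurable_indicator simp: Compl_eq_Diff_UNIV\<close>)
    also have "\<dots> \<le> ennreal e + ennreal e" using offS off\<kappa> unfolding B_def by (rule add_mono)
    finally show ?thesis using e by (simp flip: ennreal_plus)
  qed
  have collar: "\<forall>\<^sub>F r in at_right 0. measure M (W r) < e / (2 * c + 1)"
    unfolding W_def B_def
    by (rule eventually_small_collar[OF fin sets I]) (use \<kappa>' e c0 in auto)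
  have sep: "\<forall>\<^sub>F r in at_right 0. \<forall>x\<in>I. \<forall>x'\<in>I. x \<noteq> x' \<longrightarrow> (\<forall>y\<in>\<kappa> x. r \<le> infdist y (\<kappa> x'))"
    by (rule eventually_separated[OF X I]) (use \<kappa>' disj in auto)
  have "\<forall>\<^sub>F r in at_right (0::real). 0 < r" by (rule eventually_at_right_less)
  with collar sep show ?thesis
  proof eventually_elim
    case (elim r)
    let ?g = "\<lambda>n y. \<Sum>x\<in>I. f n x * of_real (bump r (\<kappa> x) y)"
    have Wm [measurable]: "W r \<in> sets M"
    proof -
      have "{y. \<exists>x\<in>I. infdist y (\<kappa> x) < r} = (\<Union>x\<in>I. {y. infdist y (\<kappa> x) < r})" by auto
      also have "open \<dots>" by (intro open_UN ballI open_Collect_less continuous_intros)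
      finally show ?thesis using Bm unfolding W_def sets by auto
    qed
    have point: "sqseries (\<lambda>n y. f n y - ?g n y) y \<le>
        ennreal (5 * e) + (2 * (sqseries f y * indicator (- B) y) + ennreal (2 * c) * indicator (W r) y)" for y
    proof (cases "y \<in> B")
      case True
      then obtain x where x: "x \<in> I" "y \<in> \<kappa> x" by (auto simp: B_def)
      have "?g n y = f n x" for n
      proof -
        have "?g n y = f n x * of_real (bump r (\<kappa> x) y) + (\<Sum>x'\<in>I - {x}. f n x' * of_real (bump r (\<kappa> x') y))"
          by (rule sum.remove[OF I x(1)])
        also have "(\<Sum>x'\<in>I - {x}. f n x' * of_real (bump r (\<kappa> x') y)) = 0"
          using elim x by (intro sum.neutral) (auto simp: bump_eq_0)
        finally show ?thesis by (simp add: bump_eq_1[OF x(2)])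
      qed
      then have "sqseries (\<lambda>n y. f n y - ?g n y) y = sqseries (\<lambda>n z. f n z - f n x) y"
        by (simp add: sqseries_def)
      also have "\<dots> \<le> ennreal (5 * e)" by (rule osc[OF x])
      finally show ?thesis by (rule order_trans) simp
    next
      case False
      have g: "sqseries ?g y \<le> ennreal c * indicator (W r) y"
      proof (cases "y \<in> W r")
        case True
        have "sqseries ?g y \<le> of_nat (card I) * (\<Sum>x\<in>I. sqseries (\<lambda>n y. f n x * of_real (bump r (\<kappa> x) y)) y)"
          by (rule sqseries_sum_le[OF I])
        also have "\<dots> \<le> of_nat (card I) * (\<Sum>x\<in>I. of_nat j)"
        proof (intro mult_left_mono sum_mono)
          fix x assume x: "x \<in> I"
          have "sqseries (\<lambda>n y. f n x * of_real (bump r (\<kappa> x) y)) y \<le> sqseries f x"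
            unfolding sqseries_def
          proof (intro suminf_le ennreal_leI power_mono)
            fix n
            show "cmod (f n x * of_real (bump r (\<kappa> x) y)) \<le> cmod (f n x)"
              using bump_bounds[of r "\<kappa> x" y] elim by (simp add: norm_mult mult_left_le)
          qed auto
          also have "\<dots> \<le> of_nat j" using bound \<kappa>[OF x] by blast
          finally show "sqseries (\<lambda>n y. f n x * of_real (bump r (\<kappa> x) y)) y \<le> of_nat j" .
        qed auto
        also have "\<dots> = ennreal c" by (simp add: c_def ennreal_mult ennreal_of_nat_eq_real_of_nat)
        finally show ?thesis using True by simp
      next
        case outside: False
        have "bump r (\<kappa> x) y = 0" if "x \<in> I" for x
          using outside False that elim by (intro bump_eq_0) (auto simp: W_def not_less)
        then show ?thesis by (simp add: sqseries_def)
      qed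
      have "sqseries (\<lambda>n y. f n y - ?g n y) y \<le> 2 * sqseries f y + 2 * sqseries ?g y"
        by (rule sqseries_diff_le)
      also have "\<dots> \<le> 2 * (sqseries f y * indicator (- B) y) + 2 * (ennreal c * indicator (W r) y)"
        using g False by (intro add_mono mult_left_mono) auto
      also have "2 * (ennreal c * indicator (W r) y) = ennreal (2 * c) * indicator (W r) y"
        using c0 by (simp add: ennreal_mult mult.assoc)
      finally show ?thesis by (rule order_trans) simp
    qed
    have "(\<integral>\<^sup>+y. sqseries (\<lambda>n y. f n y - ?g n y) y \<partial>M)
        \<le> (\<integral>\<^sup>+y. ennreal (5 * e) + (2 * (sqseries f y * indicator (- B) y) + ennreal (2 * c) * indicator (W r) y) \<partial>M)"
      by (intro nn_integral_mono point)
    also have "\<dots> = ennreal (5 * e) * emeasure M UNIV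
        + (2 * (\<integral>\<^sup>+y. sqseries f y * indicator (- B) y \<partial>M) + ennreal (2 * c) * emeasure M (W r))"
    proof -
      have [measurable]: "- B \<in> sets M" using Bm by (simp add: sets)
      show ?thesis by (simp add: nn_integral_add nn_integral_cmult nn_integral_cmult_indicator sp)
    qed
    also have "\<dots> \<le> ennreal (5 * e * measure M UNIV) + (ennreal (4 * e) + ennreal (2 * c * measure M (W r)))"
    proof (intro add_mono)
      have "2 * (\<integral>\<^sup>+y. sqseries f y * indicator (- B) y \<partial>M) \<le> ennreal 2 * ennreal (2 * e)"
        using offB by (simp add: mult_left_mono)
      also have "\<dots> = ennreal (4 * e)" using e by (subst ennreal_mult[symmetric]) auto
      finally show "2 * (\<integral>\<^sup>+y. sqseries f y * indicator (- B) y \<partial>M) \<le> ennreal (4 * e)" .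
    qed (use e c0 in \<open>simp_all only: emeasure_eq_measure, auto simp only: ennreal_mult[of _ "measure M _"] measure_nonneg mult_nonneg_nonneg\<close>)
    also have "\<dots> = ennreal (5 * e * measure M UNIV + (4 * e + 2 * c * measure M (W r)))"
      using e c0 by (simp only: ennreal_plus measure_nonneg mult_nonneg_nonneg add_nonneg_nonneg less_imp_le zero_le_numeral)
    also have "\<dots> \<le> ennreal (5 * e * (measure M UNIV + 1))"
    proof (rule ennreal_leI)
      have "2 * c * measure M (W r) \<le> (2 * c + 1) * measure M (W r)" by (simp add: algebra_simps)
      also have "\<dots> \<le> (2 * c + 1) * (e / (2 * c + 1))" using elim c0 by (intro mult_left_mono) auto
      also have "\<dots> = e" using c0 by simp
      finally show "5 * e * measure M UNIV + (4 * e + 2 * c * measure M (W r)) \<le> 5 * e * (measure M UNIV + 1)"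
        by (simp add: algebra_simps)
    qed
    finally show ?case .
  qed
qed

section \<open>Replacing square-integrable representations by continuous ones\<close>

definition vanishes_near :: "('a::topological_space \<times> 'b::topological_space) set \<Rightarrow> ('a \<times> 'b \<Rightarrow> complex) \<Rightarrow> bool" where
  "vanishes_near E \<psi> \<longleftrightarrow> (\<exists>s. vbound \<psi> s) \<and> (\<exists>U. open U \<and> E \<subseteq> U \<and> (\<forall>p\<in>U. \<psi> p = 0))"

lemma vbound_bump_product:
  fixes K :: "'a::metric_space set" and L :: "'b::metric_space set"
  assumes r: "0 < r"
  shows "vbound (\<lambda>z. c * (of_real (bump r K (fst z)) * of_real (bump r L (snd z)))) (cmod c)"
proof -
  have b: "cmod (of_real (bump r K x)) \<le> 1" for K :: "'c::metric_space set" and x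
    using bump_bounds[OF r, of K x] by simp
  have cb: "cmod (c * of_real (bump r K x)) \<le> cmod c" for x
    using mult_left_mono[OF b[of K x] norm_ge_zero[of c]] by (simp add: norm_mult)
  define p where "p = Bcontfun (\<lambda>x. c * of_real (bump r K x))"
  define q where "q = Bcontfun (\<lambda>y. of_real (bump r L y) :: complex)"
  have p: "apply_bcontfun p = (\<lambda>x. c * of_real (bump r K x))"
    unfolding p_def by (intro Bcontfun_inverse bcontfun_normI[OF _ cb] continuous_intros)
  have q: "apply_bcontfun q = (\<lambda>y. of_real (bump r L y))"
    unfolding q_def by (intro Bcontfun_inverse bcontfun_normI[OF _ b] continuous_intros)
  have "norm p \<le> cmod c" by (rule norm_bound) (use cb in \<open>simp add: p\<close>)
  moreover have "norm q \<le> 1" by (rule norm_bound) (use b in \<open>simp add: q\<close>)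
  ultimately have "norm p * norm q \<le> cmod c * 1" by (intro mult_mono) auto
  from vbound_mono[OF vbound_rank_one this] show ?thesis by (simp add: p q mult.assoc)
qed

lemma summable_prod_of_sqseries:
  assumes "sqseries f x \<noteq> top" "sqseries g y \<noteq> top"
  shows "summable (\<lambda>n. f n x * g n y)"
proof -
  have "summable (\<lambda>n. (cmod (f n x))\<^sup>2 + (cmod (g n y))\<^sup>2)"
    using assms unfolding sqseries_def by (intro summable_add summable_suminf_not_top) auto
  then show ?thesis
  proof (rule summable_comparison_test')
    fix n
    have "2 * (cmod (f n x) * cmod (g n y)) \<le> (cmod (f n x))\<^sup>2 + (cmod (g n y))\<^sup>2"
      using sum_squares_bound[of "cmod (f n x)" "cmod (g n y)"] by simp
    moreover have "0 \<le> cmod (f n x) * cmod (g n y)" by simp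
    ultimately show "norm (f n x * g n y) \<le> (cmod (f n x))\<^sup>2 + (cmod (g n y))\<^sup>2"
      unfolding norm_mult by linarith
  qed
qed

lemma compact_finite_subfamily:
  assumes "compact K" "\<And>k::nat. open (W k)" "K \<subseteq> (\<Union>k. W k)"
  obtains m where "K \<subseteq> (\<Union>k<m. W k)"
proof -
  obtain J where J: "finite J" "K \<subseteq> (\<Union>k\<in>J. W k)"
    using compactE_image[OF assms(1), of UNIV W] assms(2,3) by (metis UNIV_I subset_UNIV)
  obtain m where "J \<subseteq> {..<m}" using finite_nat_bounded[OF J(1)] by blast
  then have "K \<subseteq> (\<Union>k<m. W k)" using J(2) by blast
  then show ?thesis by (rule that)
qed

text \<open>The families \<open>f\<close> and \<open>g\<close> represent, off null sets, a function that is zero on the pseudo-open set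
  \<open>\<Union>k. A k \<times> B k\<close> covering \<open>E\<close>. The approximating families represent
  \<open>\<psi> = \<Sum> G (x, y) bump(\<kappa> x) \<otimes> bump(\<theta> y)\<close>, a finite sum over pairs of sample points with
  \<open>G (x, y) = \<Sum> f n x \<cdot> g n y\<close>. A pair is called bad if its cell product is disjoint from \<open>E\<close>. For a
  bad pair the bumps can be kept away from \<open>E\<close>. For the other pairs the cell product meets \<open>E\<close>, hence
  one of the finitely many rectangles that cover \<open>E \<inter> (S \<times> T)\<close>; as the cells respect the sides of
  these rectangles, \<open>(x, y)\<close> itself lies in it and \<open>G (x, y) = 0\<close>. Convergence of the partial sums to
  \<open>\<psi>\<close> in the norm of \<open>V(X, Y)\<close> amounts to convergence of finitely many coefficients.\<close>

theorem continuous_approximation: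
  fixes \<mu> :: "'a::metric_space measure" and \<nu> :: "'b::metric_space measure"
  assumes X: "compact (UNIV :: 'a set)" and Y: "compact (UNIV :: 'b set)" and E: "closed E"
    and \<mu>: "finite_measure \<mu>" "sets \<mu> = sets borel" and \<nu>: "finite_measure \<nu>" "sets \<nu> = sets borel"
    and f: "\<And>n. f n \<in> borel_measurable \<mu>" "(\<integral>\<^sup>+x. sqseries f x \<partial>\<mu>) \<noteq> top"
    and g: "\<And>n. g n \<in> borel_measurable \<nu>" "(\<integral>\<^sup>+y. sqseries g y \<partial>\<nu>) \<noteq> top"
    and N: "N \<in> null_sets \<mu>" and N': "N' \<in> null_sets \<nu>"
    and A: "\<And>k::nat. A k \<in> sets \<mu>" and B: "\<And>k. B k \<in> sets \<nu>"
    and cover: "\<forall>(x, y)\<in>E. x \<notin> N \<longrightarrow> y \<notin> N' \<longrightarrow> (\<exists>k. x \<in> A k \<and> y \<in> B k)"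
    and zero: "\<forall>x\<in>- N. \<forall>y\<in>- N'. \<forall>k. x \<in> A k \<longrightarrow> y \<in> B k \<longrightarrow> (\<lambda>n. f n x * g n y) sums 0"
    and e: "0 < e"
  obtains f' :: "nat \<Rightarrow> 'a \<Rightarrow>\<^sub>C complex" and g' :: "nat \<Rightarrow> 'b \<Rightarrow>\<^sub>C complex" and \<psi>
  where "(\<integral>\<^sup>+x. sqseries (\<lambda>n x. f n x - apply_bcontfun (f' n) x) x \<partial>\<mu>) \<le> ennreal e"
    "(\<integral>\<^sup>+y. sqseries (\<lambda>n y. g n y - apply_bcontfun (g' n) y) y \<partial>\<nu>) \<le> ennreal e"
    "vanishes_near E \<psi>"
    "\<And>\<delta>. 0 < \<delta> \<Longrightarrow> \<forall>\<^sub>F m in sequentially.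
       vbound (\<lambda>z. \<psi> z - (\<Sum>n<m. apply_bcontfun (f' n) (fst z) * apply_bcontfun (g' n) (snd z))) \<delta>"
proof -
  define e1 where "e1 = e / (5 * (measure \<mu> UNIV + 1))"
  define e2 where "e2 = e / (5 * (measure \<nu> UNIV + 1))"
  have m1: "0 < measure \<mu> UNIV + 1" and m2: "0 < measure \<nu> UNIV + 1"
    by (simp_all add: add_nonneg_pos)
  have cancel: "0 < e / (5 * t) \<and> 5 * (e / (5 * t)) * t = e" if "0 < t" for t
    using e that by simp
  have e1: "0 < e1" "5 * e1 * (measure \<mu> UNIV + 1) = e" using cancel[OF m1] unfolding e1_def by blast+
  have e2: "0 < e2" "5 * e2 * (measure \<nu> UNIV + 1) = e" using cancel[OF m2] unfolding e2_def by blast+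
  obtain S V j where S: "closed S" "\<And>k. open (V k)" "S \<inter> N = {}" "\<And>k. A k \<inter> S = V k \<inter> S"
    "\<And>x. x \<in> S \<Longrightarrow> sqseries f x \<le> of_nat j"
    "\<And>x. x \<in> S \<Longrightarrow> sqseries (\<lambda>n. f (n + j)) x \<le> ennreal e1"
    "(\<integral>\<^sup>+x. sqseries f x * indicator (- S) x \<partial>\<mu>) \<le> ennreal e1"
    by (fact good_closed_set[where A = A, OF \<mu> f N A e1(1)])
  obtain T W l where T: "closed T" "\<And>k. open (W k)" "T \<inter> N' = {}" "\<And>k. B k \<inter> T = W k \<inter> T"
    "\<And>x. x \<in> T \<Longrightarrow> sqseries g x \<le> of_nat l"
    "\<And>x. x \<in> T \<Longrightarrow> sqseries (\<lambda>n. g (n + l)) x \<le> ennreal e2"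
    "(\<integral>\<^sup>+x. sqseries g x * indicator (- T) x \<partial>\<nu>) \<le> ennreal e2"
    by (fact good_closed_set[where A = B, OF \<nu> g N' B e2(1)])
  have "compact (UNIV \<times> UNIV :: ('a \<times> 'b) set)" by (rule compact_Times[OF X Y])
  then have "compact ((S \<times> T) \<inter> E)"
    using compact_Int_closed[of UNIV "(S \<times> T) \<inter> E"] closed_Int[OF closed_Times[OF S(1) T(1)] E] by simp
  moreover have "open (V k \<times> W k)" for k using S(2) T(2) by (intro open_Times)
  moreover have "(S \<times> T) \<inter> E \<subseteq> (\<Union>k. V k \<times> W k)"
  proof clarify
    fix x y assume xy: "x \<in> S" "y \<in> T" "(x, y) \<in> E"
    then obtain k where "x \<in> A k" "y \<in> B k" using cover S(3) T(3) by blast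
    then have "x \<in> V k" "y \<in> W k" using xy S(4)[of k] T(4)[of k] by auto
    then show "(x, y) \<in> (\<Union>k. V k \<times> W k)" by blast
  qed
  ultimately obtain m where m: "(S \<times> T) \<inter> E \<subseteq> (\<Union>k<m. V k \<times> W k)"
    by (rule compact_finite_subfamily)
  have S': "\<forall>x\<in>S. sqseries f x \<le> of_nat j" "\<forall>x\<in>S. sqseries (\<lambda>n. f (n + j)) x \<le> ennreal e1"
    using S(5,6) by blast+
  have T': "\<forall>x\<in>T. sqseries g x \<le> of_nat l" "\<forall>x\<in>T. sqseries (\<lambda>n. g (n + l)) x \<le> ennreal e2"
    using T(5,6) by blast+
  obtain I \<kappa> where I: "finite I" "\<And>x. x \<in> I \<Longrightarrow> closed (\<kappa> x) \<and> x \<in> \<kappa> x \<and> \<kappa> x \<subseteq> S"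
    "\<And>x x'. x \<in> I \<Longrightarrow> x' \<in> I \<Longrightarrow> x \<noteq> x' \<Longrightarrow> \<kappa> x \<inter> \<kappa> x' = {}"
    "\<And>x y k. x \<in> I \<Longrightarrow> y \<in> \<kappa> x \<Longrightarrow> k < m \<Longrightarrow> y \<in> V k \<longleftrightarrow> x \<in> V k"
    "\<And>x y. x \<in> I \<Longrightarrow> y \<in> \<kappa> x \<Longrightarrow> sqseries (\<lambda>n z. f n z - f n x) y \<le> ennreal (5 * e1)"
    "(\<integral>\<^sup>+x. sqseries f x * indicator (S - (\<Union>x\<in>I. \<kappa> x)) x \<partial>\<mu>) \<le> ennreal e1"
    by (fact sample_cells[where V = V and m = m, OF \<mu> f S(1,2) S' e1(1)])
  obtain J \<theta> where J: "finite J" "\<And>x. x \<in> J \<Longrightarrow> closed (\<theta> x) \<and> x \<in> \<theta> x \<and> \<theta> x \<subseteq> T"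
    "\<And>x x'. x \<in> J \<Longrightarrow> x' \<in> J \<Longrightarrow> x \<noteq> x' \<Longrightarrow> \<theta> x \<inter> \<theta> x' = {}"
    "\<And>x y k. x \<in> J \<Longrightarrow> y \<in> \<theta> x \<Longrightarrow> k < m \<Longrightarrow> y \<in> W k \<longleftrightarrow> x \<in> W k"
    "\<And>x y. x \<in> J \<Longrightarrow> y \<in> \<theta> x \<Longrightarrow> sqseries (\<lambda>n z. g n z - g n x) y \<le> ennreal (5 * e2)"
    "(\<integral>\<^sup>+x. sqseries g x * indicator (T - (\<Union>x\<in>J. \<theta> x)) x \<partial>\<nu>) \<le> ennreal e2"
    by (fact sample_cells[where V = W and m = m, OF \<nu> g T(1,2) T' e2(1)])
  have IS: "x \<in> S" "\<kappa> x \<subseteq> S" if "x \<in> I" for x using I(2)[OF that] by blast+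
  have JT: "y \<in> T" "\<theta> y \<subseteq> T" if "y \<in> J" for y using J(2)[OF that] by blast+
  have cpt: "compact (\<kappa> x)" if "x \<in> I" for x
    using compact_Int_closed[OF X, of "\<kappa> x"] I(2)[OF that] by simp
  have cpt': "compact (\<theta> y)" if "y \<in> J" for y
    using compact_Int_closed[OF Y, of "\<theta> y"] J(2)[OF that] by simp
  define bad where "bad = {p \<in> I \<times> J. (\<kappa> (fst p) \<times> \<theta> (snd p)) \<inter> E = {}}"
  have fin_bad: "finite bad" using I(1) J(1) by (simp add: bad_def)
  have "\<forall>\<^sub>F r in at_right 0. \<forall>p\<in>bad. \<exists>U. open U \<and> E \<subseteq> U \<and>
      (\<forall>(a, b)\<in>U. bump r (\<kappa> (fst p)) a * bump r (\<theta> (snd p)) b = 0)"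
  proof (rule eventually_ball_finite[OF fin_bad], intro ballI)
    fix p assume "p \<in> bad"
    then have p: "fst p \<in> I" "snd p \<in> J" "(\<kappa> (fst p) \<times> \<theta> (snd p)) \<inter> E = {}" by (auto simp: bad_def)
    show "\<forall>\<^sub>F r in at_right 0. \<exists>U. open U \<and> E \<subseteq> U \<and>
      (\<forall>(a, b)\<in>U. bump r (\<kappa> (fst p)) a * bump r (\<theta> (snd p)) b = 0)"
      using I(2)[OF p(1)] J(2)[OF p(2)]
      by (intro bump_product_vanishes[OF cpt[OF p(1)] _ cpt'[OF p(2)] _ E p(3)]) auto
  qed
  moreover have "\<forall>\<^sub>F r in at_right 0.
    (\<integral>\<^sup>+y. sqseries (\<lambda>n y. f n y - (\<Sum>x\<in>I. f n x * of_real (bump r (\<kappa> x) y))) y \<partial>\<mu>)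
      \<le> ennreal (5 * e1 * (measure \<mu> UNIV + 1))"
    by (rule bump_approximation[OF X \<mu> f(1) S(1) _ e1(1) S(7) I(1)]) (fact S I)+
  moreover have "\<forall>\<^sub>F r in at_right 0.
    (\<integral>\<^sup>+y. sqseries (\<lambda>n y. g n y - (\<Sum>x\<in>J. g n x * of_real (bump r (\<theta> x) y))) y \<partial>\<nu>)
      \<le> ennreal (5 * e2 * (measure \<nu> UNIV + 1))"
    by (rule bump_approximation[OF Y \<nu> g(1) T(1) _ e2(1) T(7) J(1)]) (fact T J)+
  moreover have "\<forall>\<^sub>F r in at_right (0::real). 0 < r" by (rule eventually_at_right_less)
  ultimately have "\<forall>\<^sub>F r in at_right 0. 0 < r \<and> (\<forall>p\<in>bad. \<exists>U. open U \<and> E \<subseteq> U \<and>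
      (\<forall>(a, b)\<in>U. bump r (\<kappa> (fst p)) a * bump r (\<theta> (snd p)) b = 0)) \<and>
    (\<integral>\<^sup>+y. sqseries (\<lambda>n y. f n y - (\<Sum>x\<in>I. f n x * of_real (bump r (\<kappa> x) y))) y \<partial>\<mu>) \<le> ennreal e \<and>
    (\<integral>\<^sup>+y. sqseries (\<lambda>n y. g n y - (\<Sum>x\<in>J. g n x * of_real (bump r (\<theta> x) y))) y \<partial>\<nu>) \<le> ennreal e"
    unfolding e1(2) e2(2) by eventually_elim blast
  from eventually_happens'[OF _ this]
  obtain r where r: "0 < r" and van: "\<forall>p\<in>bad. \<exists>U. open U \<and> E \<subseteq> U \<and>
      (\<forall>(a, b)\<in>U. bump r (\<kappa> (fst p)) a * bump r (\<theta> (snd p)) b = 0)"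
    and app: "(\<integral>\<^sup>+y. sqseries (\<lambda>n y. f n y - (\<Sum>x\<in>I. f n x * of_real (bump r (\<kappa> x) y))) y \<partial>\<mu>) \<le> ennreal e"
      "(\<integral>\<^sup>+y. sqseries (\<lambda>n y. g n y - (\<Sum>x\<in>J. g n x * of_real (bump r (\<theta> x) y))) y \<partial>\<nu>) \<le> ennreal e"
    by auto
  obtain U where U: "\<And>p. p \<in> bad \<Longrightarrow> open (U p)" "\<And>p. p \<in> bad \<Longrightarrow> E \<subseteq> U p"
    "\<And>p a b. p \<in> bad \<Longrightarrow> (a, b) \<in> U p \<Longrightarrow> bump r (\<kappa> (fst p)) a * bump r (\<theta> (snd p)) b = 0"
    using bchoice[OF van] by fast
  define f' where "f' n = Bcontfun (\<lambda>a. \<Sum>x\<in>I. f n x * of_real (bump r (\<kappa> x) a))" for n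
  define g' where "g' n = Bcontfun (\<lambda>b. \<Sum>y\<in>J. g n y * of_real (bump r (\<theta> y) b))" for n
  have f': "apply_bcontfun (f' n) = (\<lambda>a. \<Sum>x\<in>I. f n x * of_real (bump r (\<kappa> x) a))" for n
    unfolding f'_def by (intro apply_Bcontfun_compact[OF X] continuous_intros)
  have g': "apply_bcontfun (g' n) = (\<lambda>b. \<Sum>y\<in>J. g n y * of_real (bump r (\<theta> y) b))" for n
    unfolding g'_def by (intro apply_Bcontfun_compact[OF Y] continuous_intros)
  define F where "F m p = (\<Sum>n<m. f n (fst p) * g n (snd p))" for m p
  define G where "G p = (\<Sum>n. f n (fst p) * g n (snd p))" for p
  have lim: "(\<lambda>m. F m p) \<longlonglongrightarrow> G p" if "p \<in> I \<times> J" for p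
  proof -
    have "fst p \<in> S" "snd p \<in> T" using that IS(1) JT(1) by auto
    then have "sqseries f (fst p) \<noteq> top" "sqseries g (snd p) \<noteq> top"
      using S(5)[of "fst p"] T(5)[of "snd p"] by (auto simp: top_unique)
    then show ?thesis
      unfolding F_def G_def by (intro summable_LIMSEQ summable_prod_of_sqseries)
  qed
  have G0: "G p = 0" if p: "p \<in> I \<times> J" "p \<notin> bad" for p
  proof -
    have S': "fst p \<in> S" "snd p \<in> T" using p(1) IS(1) JT(1) by auto
    obtain a b where ab: "a \<in> \<kappa> (fst p)" "b \<in> \<theta> (snd p)" "(a, b) \<in> E"
      using p by (auto simp: bad_def)
    then have "(a, b) \<in> (S \<times> T) \<inter> E" using p(1) IS(2)[of "fst p"] JT(2)[of "snd p"] by auto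
    then obtain k where k: "k < m" "a \<in> V k" "b \<in> W k" using m by auto
    then have "fst p \<in> V k" "snd p \<in> W k"
      using I(4)[OF _ ab(1) k(1)] J(4)[OF _ ab(2) k(1)] p(1) by auto
    then have "fst p \<in> A k" "snd p \<in> B k" using S(4)[of k] T(4)[of k] S' by blast+
    then have "(\<lambda>n. f n (fst p) * g n (snd p)) sums 0"
      using zero S' S(3) T(3) by blast
    then show ?thesis by (simp add: G_def sums_iff)
  qed
  define h where "h p z = of_real (bump r (\<kappa> (fst p)) (fst z)) * (of_real (bump r (\<theta> (snd p)) (snd z)) :: complex)" for p z
  define \<psi> where "\<psi> z = (\<Sum>p\<in>I \<times> J. G p * h p z)" for z
  have vb: "vbound (\<lambda>z. \<Sum>p\<in>I \<times> J. c p * h p z) (\<Sum>p\<in>I \<times> J. cmod (c p))" for c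
    unfolding h_def by (intro vbound_sum vbound_bump_product r)
  have near: "vanishes_near E \<psi>"
    unfolding vanishes_near_def
  proof (intro conjI exI)
    show "vbound \<psi> (\<Sum>p\<in>I \<times> J. cmod (G p))" unfolding \<psi>_def by (rule vb)
    show "open (\<Inter>p\<in>bad. U p)" using fin_bad U(1) by (intro open_INT) auto
    show "E \<subseteq> (\<Inter>p\<in>bad. U p)" using U(2) by blast
    show "\<forall>z\<in>\<Inter>p\<in>bad. U p. \<psi> z = 0"
      unfolding \<psi>_def
    proof (intro ballI sum.neutral)
      fix z p assume z: "z \<in> (\<Inter>p\<in>bad. U p)" and p: "p \<in> I \<times> J"
      show "G p * h p z = 0"
      proof (cases "p \<in> bad")
        case True
        then have "bump r (\<kappa> (fst p)) (fst z) * bump r (\<theta> (snd p)) (snd z) = 0"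
          using U(3)[OF True, of "fst z" "snd z"] z by auto
        then have "h p z = 0" unfolding h_def by (metis of_real_mult of_real_0)
        then show ?thesis by simp
      qed (simp add: G0[OF p])
    qed
  qed
  have approx: "\<forall>\<^sub>F m in sequentially.
      vbound (\<lambda>z. \<psi> z - (\<Sum>n<m. apply_bcontfun (f' n) (fst z) * apply_bcontfun (g' n) (snd z))) \<delta>"
    if \<delta>: "0 < \<delta>" for \<delta>
  proof -
    have "(\<lambda>m. \<Sum>p\<in>I \<times> J. cmod (G p - F m p)) \<longlonglongrightarrow> (\<Sum>p\<in>I \<times> J. cmod (G p - G p))"
      by (intro tendsto_sum tendsto_norm tendsto_diff tendsto_const lim)
    then have "\<forall>\<^sub>F m in sequentially. (\<Sum>p\<in>I \<times> J. cmod (G p - F m p)) < \<delta>"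
      using \<delta> by (intro order_tendstoD(2)) auto
    then show ?thesis
    proof eventually_elim
      case (elim m)
      have "\<psi> z - (\<Sum>n<m. apply_bcontfun (f' n) (fst z) * apply_bcontfun (g' n) (snd z))
          = (\<Sum>p\<in>I \<times> J. (G p - F m p) * h p z)" for z
      proof -
        have "(\<Sum>n<m. apply_bcontfun (f' n) (fst z) * apply_bcontfun (g' n) (snd z))
            = (\<Sum>n<m. \<Sum>p\<in>I \<times> J. (f n (fst p) * g n (snd p)) * h p z)"
          by (simp add: f' g' sum_product sum.cartesian_product h_def case_prod_unfold ac_simps)
        also have "\<dots> = (\<Sum>p\<in>I \<times> J. F m p * h p z)"
          by (subst sum.swap) (simp add: F_def sum_distrib_right)
        finally show ?thesis by (simp add: \<psi>_def left_diff_distrib sum_subtractf)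
      qed
      then show ?case using vbound_mono[OF vb[of "\<lambda>p. G p - F m p"] less_imp_le[OF elim]] by simp
    qed
  qed
  have app': "(\<integral>\<^sup>+x. sqseries (\<lambda>n x. f n x - apply_bcontfun (f' n) x) x \<partial>\<mu>) \<le> ennreal e"
    "(\<integral>\<^sup>+y. sqseries (\<lambda>n y. g n y - apply_bcontfun (g' n) y) y \<partial>\<nu>) \<le> ennreal e"
    using app unfolding f' g' .
  show ?thesis by (rule that[OF app' near approx])
qed

section \<open>Balanced and interleaved representations\<close>

definition interleave :: "(nat \<Rightarrow> 'c) \<Rightarrow> (nat \<Rightarrow> 'c) \<Rightarrow> nat \<Rightarrow> 'c" where
  "interleave a b n = (if even n then a (n div 2) else b (n div 2))"

lemma interleave_simps [simp]:
  "interleave a b (2 * n) = a n" "interleave a b (Suc (2 * n)) = b n"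
  by (simp_all add: interleave_def)

lemma sum_interleave:
  fixes a b :: "nat \<Rightarrow> 'c::comm_monoid_add"
  shows "(\<Sum>k<n. interleave a b k) = (\<Sum>k<(n + 1) div 2. a k) + (\<Sum>k<n div 2. b k)"
proof (induction n)
  case (Suc n)
  show ?case
  proof (cases "even n")
    case True
    then obtain m where "n = 2 * m" by (elim evenE)
    then show ?thesis using Suc by (simp add: add.assoc add.commute add.left_commute)
  next
    case False
    then obtain m where "n = 2 * m + 1" by (elim oddE)
    then show ?thesis using Suc by (simp add: add.assoc add.commute add.left_commute)
  qed
qed simp

lemma sums_interleave:
  fixes a b :: "nat \<Rightarrow> 'c::topological_comm_monoid_add"
  assumes "a sums s" "b sums t"
  shows "interleave a b sums (s + t)"
proof -
  have "\<forall>\<^sub>F n in sequentially. z \<le> (n + 1) div 2" "\<forall>\<^sub>F n in sequentially. z \<le> n div 2" for z :: nat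
    using eventually_ge_at_top[of "2 * z"] by (eventually_elim, simp)+
  then have "filterlim (\<lambda>n::nat. (n + 1) div 2) at_top at_top" "filterlim (\<lambda>n::nat. n div 2) at_top at_top"
    unfolding filterlim_at_top by blast+
  note lims = this
  show ?thesis
    using assms unfolding sums_def sum_interleave
    by (intro tendsto_add filterlim_compose[OF _ lims(1)] filterlim_compose[OF _ lims(2)])
qed

lemma sqseries_interleave_le:
  "sqseries (interleave f g) x \<le> sqseries f x + sqseries g x"
  unfolding sqseries_def
proof (rule suminf_le_const)
  fix n
  let ?a = "\<lambda>n. ennreal ((cmod (f n x))\<^sup>2)" and ?b = "\<lambda>n. ennreal ((cmod (g n x))\<^sup>2)"
  have "(\<Sum>k<n. ennreal ((cmod (interleave f g k x))\<^sup>2)) = (\<Sum>k<n. interleave ?a ?b k)"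
    by (intro sum.cong) (auto simp: interleave_def)
  also have "\<dots> \<le> (\<Sum>n. ?a n) + (\<Sum>n. ?b n)"
    unfolding sum_interleave by (intro add_mono sum_le_suminf) auto
  finally show "(\<Sum>k<n. ennreal ((cmod (interleave f g k x))\<^sup>2)) \<le> (\<Sum>n. ?a n) + (\<Sum>n. ?b n)" .
qed auto

text \<open>The factor that turns \<open>\<alpha>\<close> into the geometric mean of \<open>\<alpha>\<close> and \<open>\<beta>\<close>. If one of the two is 0 the factor is
  0, by the convention for division by 0.\<close>

definition balance :: "real \<Rightarrow> real \<Rightarrow> real" where
  "balance \<alpha> \<beta> = sqrt (\<beta> / \<alpha>)"

lemma balance_square: "0 \<le> \<alpha> \<Longrightarrow> 0 \<le> \<beta> \<Longrightarrow> (balance \<alpha> \<beta> * \<alpha>)\<^sup>2 = \<alpha> * \<beta>"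
  by (cases "\<alpha> = 0") (simp_all add: balance_def power_mult_distrib power2_eq_square field_simps)

lemma balance_inverse: "0 < \<alpha> \<Longrightarrow> 0 < \<beta> \<Longrightarrow> balance \<alpha> \<beta> * balance \<beta> \<alpha> = 1"
  by (simp add: balance_def flip: real_sqrt_mult)

lemma nn_integral_sqseries:
  assumes "\<And>n. f n \<in> borel_measurable M"
  shows "(\<integral>\<^sup>+x. sqseries f x \<partial>M) = (\<Sum>n. \<integral>\<^sup>+x. ennreal ((cmod (f n x))\<^sup>2) \<partial>M)"
proof -
  note [measurable] = assms
  show ?thesis unfolding sqseries_def by (rule nn_integral_suminf) measurable
qed

lemma nn_integral_L2_norm:
  assumes "f \<in> L2_fun M"
  shows "(\<integral>\<^sup>+x. ennreal ((cmod (f x))\<^sup>2) \<partial>M) = ennreal ((L2_norm M f)\<^sup>2)"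
  using assms unfolding L2_fun_def L2_norm_def by (subst nn_integral_eq_integral) auto

lemma L2_norm_nonneg: "0 \<le> L2_norm M f"
  unfolding L2_norm_def by simp

lemma L2_fun_scale: "f \<in> L2_fun M \<Longrightarrow> (\<lambda>x. c * f x) \<in> L2_fun M"
  and L2_norm_scale: "L2_norm M (\<lambda>x. c * f x) = cmod c * L2_norm M f"
  by (auto simp: L2_fun_def L2_norm_def norm_mult power_mult_distrib real_sqrt_mult)

lemma L2_norm_zero_AE:
  assumes "f \<in> L2_fun M" "L2_norm M f = 0"
  shows "{x \<in> space M. f x \<noteq> 0} \<in> null_sets M"
proof -
  have m: "f \<in> borel_measurable M" and i: "integrable M (\<lambda>x. (cmod (f x))\<^sup>2)"
    using assms(1) by (auto simp: L2_fun_def)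
  have "AE x in M. (cmod (f x))\<^sup>2 = 0"
    using assms(2) integral_nonneg_eq_0_iff_AE[OF i] by (simp add: L2_norm_def)
  then have "AE x in M. f x = 0" by simp
  moreover have "{x \<in> space M. \<not> f x = 0} \<in> sets M" using m by measurable
  ultimately show ?thesis by (simp add: AE_iff_null)
qed

lemma maeE:
  assumes "mae \<mu> \<nu> P" "space \<mu> = UNIV" "space \<nu> = UNIV"
  obtains N M where "N \<in> null_sets \<mu>" "M \<in> null_sets \<nu>" "\<And>x y. x \<notin> N \<Longrightarrow> y \<notin> M \<Longrightarrow> P (x, y)"
proof -
  obtain N M where NM: "N \<in> null_sets \<mu>" "M \<in> null_sets \<nu>"
    "{p. \<not> P p} \<subseteq> (N \<times> UNIV) \<union> (UNIV \<times> M)"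
    using assms unfolding mae_def marginally_null_def by auto
  then have "P (x, y)" if "x \<notin> N" "y \<notin> M" for x y using that by blast
  with NM show ?thesis using that by blast
qed

lemma maeI:
  assumes "N \<in> null_sets \<mu>" "M \<in> null_sets \<nu>" "\<And>x y. x \<notin> N \<Longrightarrow> y \<notin> M \<Longrightarrow> P (x, y)"
  shows "mae \<mu> \<nu> P"
  unfolding mae_def marginally_null_def
proof (intro bexI[OF _ assms(1)] bexI[OF _ assms(2)] subsetI)
  fix p assume "p \<in> {p \<in> space \<mu> \<times> space \<nu>. \<not> P p}"
  then show "p \<in> N \<times> space \<nu> \<union> space \<mu> \<times> M"
    using assms(3)[of "fst p" "snd p"] by (cases p) auto
qed

text \<open>Multiplying \<open>f n\<close> and \<open>g n\<close> by reciprocal factors gives them equal norms, so that the weight of the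
  representation becomes a sum of squares for each factor. Terms in which one norm is 0
  are replaced by 0, which changes their products only on a marginally null set.\<close>

lemma L2_tensor_balanced:
  assumes rep: "L2_tensor_rep \<mu> \<nu> f g F" and sp: "space \<mu> = UNIV" "space \<nu> = UNIV"
    and le: "(\<Sum>n. L2_norm \<mu> (f n) * L2_norm \<nu> (g n)) \<le> \<epsilon>"
  obtains f' g' N M where "\<And>n. f' n \<in> borel_measurable \<mu>" "\<And>n. g' n \<in> borel_measurable \<nu>"
    "(\<integral>\<^sup>+x. sqseries f' x \<partial>\<mu>) \<le> ennreal \<epsilon>" "(\<integral>\<^sup>+y. sqseries g' y \<partial>\<nu>) \<le> ennreal \<epsilon>"
    "N \<in> null_sets \<mu>" "M \<in> null_sets \<nu>"
    "\<And>x y. x \<notin> N \<Longrightarrow> y \<notin> M \<Longrightarrow> (\<lambda>n. f' n x * g' n y) sums F (x, y)"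
proof -
  define \<alpha> where "\<alpha> n = L2_norm \<mu> (f n)" for n
  define \<beta> where "\<beta> n = L2_norm \<nu> (g n)" for n
  have nn: "0 \<le> \<alpha> n" "0 \<le> \<beta> n" for n by (simp_all add: \<alpha>_def \<beta>_def L2_norm_nonneg)
  have L2: "f n \<in> L2_fun \<mu>" "g n \<in> L2_fun \<nu>" for n
    using rep by (auto simp: L2_tensor_rep_def)
  have summ: "summable (\<lambda>n. \<alpha> n * \<beta> n)"
    and mae: "mae \<mu> \<nu> (\<lambda>(x, y). (\<lambda>n. f n x * g n y) sums F (x, y))"
    using rep by (auto simp: L2_tensor_rep_def \<alpha>_def \<beta>_def)
  obtain N0 M0 where NM0: "N0 \<in> null_sets \<mu>" "M0 \<in> null_sets \<nu>"
    "\<And>x y. x \<notin> N0 \<Longrightarrow> y \<notin> M0 \<Longrightarrow> (\<lambda>n. f n x * g n y) sums F (x, y)"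
    by (rule maeE[OF mae sp]) auto
  define f' where "f' n x = of_real (balance (\<alpha> n) (\<beta> n)) * f n x" for n x
  define g' where "g' n y = of_real (balance (\<beta> n) (\<alpha> n)) * g n y" for n y
  have L2': "f' n \<in> L2_fun \<mu>" "g' n \<in> L2_fun \<nu>" for n
    unfolding f'_def[abs_def] g'_def[abs_def] by (intro L2_fun_scale L2)+
  have meas: "f' n \<in> borel_measurable \<mu>" "g' n \<in> borel_measurable \<nu>" for n
    using L2'[of n] by (simp_all add: L2_fun_def)
  have nf: "(L2_norm \<mu> (f' n))\<^sup>2 = \<alpha> n * \<beta> n" for n
    using balance_square[OF nn, of n n] nn[of n]
    by (simp add: f'_def[abs_def] L2_norm_scale \<alpha>_def[symmetric] power_mult_distrib)
  have ng: "(L2_norm \<nu> (g' n))\<^sup>2 = \<alpha> n * \<beta> n" for n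
  proof -
    have "L2_norm \<nu> (g' n) = \<bar>balance (\<beta> n) (\<alpha> n)\<bar> * \<beta> n"
      unfolding g'_def[abs_def] L2_norm_scale \<beta>_def by simp
    then have "(L2_norm \<nu> (g' n))\<^sup>2 = (balance (\<beta> n) (\<alpha> n) * \<beta> n)\<^sup>2" by (simp add: power_mult_distrib)
    also have "\<dots> = \<beta> n * \<alpha> n" by (rule balance_square[OF nn(2,1)])
    finally show ?thesis by (simp add: mult.commute)
  qed
  have tot: "(\<Sum>n. ennreal (\<alpha> n * \<beta> n)) \<le> ennreal \<epsilon>"
    using le nn summ by (subst suminf_ennreal2) (auto simp: \<alpha>_def \<beta>_def intro!: ennreal_leI)
  have If: "(\<integral>\<^sup>+x. sqseries f' x \<partial>\<mu>) \<le> ennreal \<epsilon>"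
    using tot by (simp only: nn_integral_sqseries[OF meas(1)] nn_integral_L2_norm[OF L2'(1)] nf)
  have Ig: "(\<integral>\<^sup>+y. sqseries g' y \<partial>\<nu>) \<le> ennreal \<epsilon>"
    using tot by (simp only: nn_integral_sqseries[OF meas(2)] nn_integral_L2_norm[OF L2'(2)] ng)
  define N where "N = N0 \<union> (\<Union>n\<in>{n. \<alpha> n = 0}. {x \<in> space \<mu>. f n x \<noteq> 0})"
  define M where "M = M0 \<union> (\<Union>n\<in>{n. \<beta> n = 0}. {y \<in> space \<nu>. g n y \<noteq> 0})"
  have Nn: "N \<in> null_sets \<mu>"
    unfolding N_def using NM0(1) L2_norm_zero_AE[OF L2(1)]
    by (intro null_sets.Un null_sets_UN') (auto simp: \<alpha>_def)
  have Mn: "M \<in> null_sets \<nu>"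
    unfolding M_def using NM0(2) L2_norm_zero_AE[OF L2(2)]
    by (intro null_sets.Un null_sets_UN') (auto simp: \<beta>_def)
  have sums: "(\<lambda>n. f' n x * g' n y) sums F (x, y)" if xy: "x \<notin> N" "y \<notin> M" for x y
  proof -
    have "f' n x * g' n y = f n x * g n y" for n
    proof (cases "\<alpha> n = 0 \<or> \<beta> n = 0")
      case True
      then have "f n x = 0 \<or> g n y = 0" using xy by (auto simp: N_def M_def sp)
      then show ?thesis by (auto simp: f'_def g'_def)
    next
      case False
      then have "0 < \<alpha> n" "0 < \<beta> n" using nn[of n] by (auto simp: order_less_le)
      then have "complex_of_real (balance (\<alpha> n) (\<beta> n) * balance (\<beta> n) (\<alpha> n)) = 1"
        by (simp add: balance_inverse del: of_real_mult)
      then show ?thesis by (simp add: f'_def g'_def)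
    qed
    then show ?thesis using NM0(3)[of x y] xy by (simp add: N_def M_def)
  qed
  show ?thesis by (rule that[OF meas If Ig Nn Mn sums])
qed

lemma L2_tensor_diff:
  assumes "F \<in> L2_tensor \<mu> \<nu>" "G \<in> L2_tensor \<mu> \<nu>" and sp: "space \<mu> = UNIV" "space \<nu> = UNIV"
  shows "(\<lambda>p. F p - G p) \<in> L2_tensor \<mu> \<nu>"
proof -
  obtain f g where F: "L2_tensor_rep \<mu> \<nu> f g F" using assms(1) by (auto simp: L2_tensor_def)
  obtain h k where G: "L2_tensor_rep \<mu> \<nu> h k G" using assms(2) by (auto simp: L2_tensor_def)
  define h' where "h' n x = (- 1) * h n x" for n x
  have L2: "f n \<in> L2_fun \<mu>" "g n \<in> L2_fun \<nu>" "h n \<in> L2_fun \<mu>" "k n \<in> L2_fun \<nu>" for n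
    using F G by (auto simp: L2_tensor_rep_def)
  have h': "h' n \<in> L2_fun \<mu>" for n unfolding h'_def[abs_def] by (rule L2_fun_scale[OF L2(3)])
  have nh': "L2_norm \<mu> (h' n) = L2_norm \<mu> (h n)" for n unfolding h'_def[abs_def] L2_norm_scale by simp
  have "L2_tensor_rep \<mu> \<nu> (interleave f h') (interleave g k) (\<lambda>p. F p - G p)"
    unfolding L2_tensor_rep_def
  proof (intro conjI allI)
    show "interleave f h' n \<in> L2_fun \<mu>" "interleave g k n \<in> L2_fun \<nu>" for n
      using L2 h' by (auto simp: interleave_def)
    have "summable (\<lambda>n. L2_norm \<mu> (f n) * L2_norm \<nu> (g n))" "summable (\<lambda>n. L2_norm \<mu> (h n) * L2_norm \<nu> (k n))"
      using F G by (auto simp: L2_tensor_rep_def)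
    then have "summable (interleave (\<lambda>n. L2_norm \<mu> (f n) * L2_norm \<nu> (g n)) (\<lambda>n. L2_norm \<mu> (h n) * L2_norm \<nu> (k n)))"
      using sums_interleave summable_sums sums_summable by blast
    moreover have "interleave (\<lambda>n. L2_norm \<mu> (f n) * L2_norm \<nu> (g n)) (\<lambda>n. L2_norm \<mu> (h n) * L2_norm \<nu> (k n))
        = (\<lambda>n. L2_norm \<mu> (interleave f h' n) * L2_norm \<nu> (interleave g k n))"
      by (auto simp: interleave_def nh')
    ultimately show "summable (\<lambda>n. L2_norm \<mu> (interleave f h' n) * L2_norm \<nu> (interleave g k n))" by simp
    obtain N1 M1 where 1: "N1 \<in> null_sets \<mu>" "M1 \<in> null_sets \<nu>"
      "\<And>x y. x \<notin> N1 \<Longrightarrow> y \<notin> M1 \<Longrightarrow> (\<lambda>n. f n x * g n y) sums F (x, y)"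
      using F sp by (auto simp: L2_tensor_rep_def elim!: maeE)
    obtain N2 M2 where 2: "N2 \<in> null_sets \<mu>" "M2 \<in> null_sets \<nu>"
      "\<And>x y. x \<notin> N2 \<Longrightarrow> y \<notin> M2 \<Longrightarrow> (\<lambda>n. h n x * k n y) sums G (x, y)"
      using G sp by (auto simp: L2_tensor_rep_def elim!: maeE)
    show "mae \<mu> \<nu> (\<lambda>(x, y). (\<lambda>n. interleave f h' n x * interleave g k n y) sums (F (x, y) - G (x, y)))"
    proof (rule maeI[OF null_sets.Un[OF 1(1) 2(1)] null_sets.Un[OF 1(2) 2(2)]], clarsimp)
      fix x y assume "x \<notin> N1" "x \<notin> N2" "y \<notin> M1" "y \<notin> M2"
      from sums_interleave[OF 1(3)[OF this(1,3)] sums_minus[OF 2(3)[OF this(2,4)]]]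
      have "interleave (\<lambda>n. f n x * g n y) (\<lambda>n. - (h n x * k n y)) sums (F (x, y) - G (x, y))" by simp
      moreover have "interleave (\<lambda>n. f n x * g n y) (\<lambda>n. - (h n x * k n y))
          = (\<lambda>n. interleave f h' n x * interleave g k n y)"
        by (auto simp: interleave_def h'_def)
      ultimately show "(\<lambda>n. interleave f h' n x * interleave g k n y) sums (F (x, y) - G (x, y))" by simp
    qed
  qed
  then show ?thesis by (auto simp: L2_tensor_def)
qed

lemma integral_le_of_sqseries:
  assumes meas: "P \<in> borel_measurable M" "\<And>n. u n \<in> borel_measurable M" "\<And>n. a n \<in> borel_measurable M" "\<And>n. f n \<in> borel_measurable M"
    and nn: "\<And>x. 0 \<le> P x" "0 \<le> \<alpha>" "0 \<le> \<beta>" "0 \<le> \<gamma>" "0 \<le> U" "0 \<le> A" "0 \<le> F"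
    and le: "\<And>x. P x \<le> \<alpha> * (\<Sum>n<i. (cmod (u n x))\<^sup>2) + \<beta> * (\<Sum>n<m. (cmod (a n x))\<^sup>2) + \<gamma> * (\<Sum>n<m. (cmod (f n x))\<^sup>2)"
    and U: "(\<integral>\<^sup>+x. sqseries u x \<partial>M) \<le> ennreal U" and A: "(\<integral>\<^sup>+x. sqseries a x \<partial>M) \<le> ennreal A"
    and F: "(\<integral>\<^sup>+x. sqseries f x \<partial>M) \<le> ennreal F"
  shows "(\<integral>x. P x \<partial>M) \<le> \<alpha> * U + \<beta> * A + \<gamma> * F"
proof -
  note [measurable] = meas
  have part: "ennreal (\<Sum>n<i. (cmod (v n x))\<^sup>2) \<le> sqseries v x" for v :: "nat \<Rightarrow> 'a \<Rightarrow> complex" and i x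
  proof -
    have "ennreal (\<Sum>n<i. (cmod (v n x))\<^sup>2) = (\<Sum>n<i. ennreal ((cmod (v n x))\<^sup>2))"
      by (rule sum_ennreal[symmetric]) auto
    also have "\<dots> \<le> sqseries v x" unfolding sqseries_def by (rule sum_le_suminf) auto
    finally show ?thesis .
  qed
  have "ennreal (P x) \<le> ennreal \<alpha> * sqseries u x + ennreal \<beta> * sqseries a x + ennreal \<gamma> * sqseries f x" for x
  proof -
    have "ennreal (P x) \<le> ennreal \<alpha> * ennreal (\<Sum>n<i. (cmod (u n x))\<^sup>2)
        + ennreal \<beta> * ennreal (\<Sum>n<m. (cmod (a n x))\<^sup>2) + ennreal \<gamma> * ennreal (\<Sum>n<m. (cmod (f n x))\<^sup>2)"
      using ennreal_leI[OF le[of x]] nn by (simp add: ennreal_mult sum_nonneg)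
    also have "\<dots> \<le> ennreal \<alpha> * sqseries u x + ennreal \<beta> * sqseries a x + ennreal \<gamma> * sqseries f x"
      by (intro add_mono mult_left_mono part) auto
    finally show ?thesis .
  qed
  then have "(\<integral>\<^sup>+x. ennreal (P x) \<partial>M)
      \<le> (\<integral>\<^sup>+x. ennreal \<alpha> * sqseries u x + ennreal \<beta> * sqseries a x + ennreal \<gamma> * sqseries f x \<partial>M)"
    by (intro nn_integral_mono)
  also have "\<dots> = ennreal \<alpha> * (\<integral>\<^sup>+x. sqseries u x \<partial>M) + ennreal \<beta> * (\<integral>\<^sup>+x. sqseries a x \<partial>M)
      + ennreal \<gamma> * (\<integral>\<^sup>+x. sqseries f x \<partial>M)"
    by (simp add: nn_integral_add nn_integral_cmult)
  also have "\<dots> \<le> ennreal \<alpha> * ennreal U + ennreal \<beta> * ennreal A + ennreal \<gamma> * ennreal F"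
    by (intro add_mono mult_left_mono U A F) auto
  also have "\<dots> = ennreal (\<alpha> * U + \<beta> * A + \<gamma> * F)"
    using nn by (simp add: ennreal_mult)
  finally have "enn2real (\<integral>\<^sup>+x. ennreal (P x) \<partial>M) \<le> \<alpha> * U + \<beta> * A + \<gamma> * F"
    using nn by (intro enn2real_leI) auto
  then show ?thesis
    using nn(1) by (subst integral_eq_nn_integral) auto
qed

text \<open>With \<open>(h, k)\<close> approximating the interleaved families \<open>(a, - f)\<close> and \<open>(b, g)\<close>, this list represents
  the first \<open>m\<close> terms of \<open>\<Sum> a\<^sub>n \<otimes> b\<^sub>n\<close> minus the first \<open>2 m\<close> terms of \<open>\<Sum> h\<^sub>n \<otimes> k\<^sub>n\<close>. A large \<open>s\<close> makes the
  factors \<open>b\<^sub>n / s\<close> and \<open>h\<^sub>2\<^sub>n / s\<close> small, and a sufficiently good approximation then makes up for the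
  factor \<open>s\<close> in front of the differences.\<close>

definition corrections where
  "corrections s a b h k m = concat (map (\<lambda>n. [(s *\<^sub>R (a n - h (2 * n)), (1 / s) *\<^sub>R b n),
      ((1 / s) *\<^sub>R h (2 * n), s *\<^sub>R (b n - k (2 * n))),
      (- h (Suc (2 * n)), k (Suc (2 * n)))]) [0..<m])"

lemma corrections_Suc:
  "corrections s a b h k (Suc m) = corrections s a b h k m @ [(s *\<^sub>R (a m - h (2 * m)), (1 / s) *\<^sub>R b m),
      ((1 / s) *\<^sub>R h (2 * m), s *\<^sub>R (b m - k (2 * m))), (- h (Suc (2 * m)), k (Suc (2 * m)))]"
  by (simp add: corrections_def)

lemma tens_corrections:
  assumes "s \<noteq> 0"
  shows "tens (corrections s a b h k m) z =
    (\<Sum>n<m. apply_bcontfun (a n) (fst z) * apply_bcontfun (b n) (snd z))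
    - (\<Sum>n<2 * m. apply_bcontfun (h n) (fst z) * apply_bcontfun (k n) (snd z))"
proof (induction m)
  case (Suc m)
  then show ?case using assms by (simp add: corrections_Suc algebra_simps)
qed (simp add: corrections_def)

text \<open>The terms \<open>v\<close> and \<open>w\<close> of the approximation are estimated by \<open>v = c - (c - v)\<close> and
  \<open>w = d - (d - w)\<close>. The two cases are the two sides of the tensor product, where the factor divided
  by \<open>s\<close> is the approximation \<open>h\<^sub>2\<^sub>n\<close> and the given \<open>b\<^sub>n\<close>, respectively.\<close>

lemma weighted_square_le:
  fixes c d v w :: complex
  assumes s: "1 \<le> s"
  shows "s\<^sup>2 * (cmod (c - v))\<^sup>2 + (1 / s)\<^sup>2 * (cmod v)\<^sup>2 + (cmod w)\<^sup>2
      \<le> (s\<^sup>2 + 4) * ((cmod (c - v))\<^sup>2 + (cmod (d - w))\<^sup>2) + 2 / s\<^sup>2 * (cmod c)\<^sup>2 + 2 * (cmod d)\<^sup>2"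
    and "s\<^sup>2 * (cmod (c - v))\<^sup>2 + (1 / s)\<^sup>2 * (cmod c)\<^sup>2 + (cmod w)\<^sup>2
      \<le> (s\<^sup>2 + 4) * ((cmod (c - v))\<^sup>2 + (cmod (d - w))\<^sup>2) + 2 / s\<^sup>2 * (cmod c)\<^sup>2 + 2 * (cmod d)\<^sup>2"
proof -
  define C where "C = (cmod c)\<^sup>2"
  define D where "D = (cmod d)\<^sup>2"
  define V where "V = (cmod v)\<^sup>2"
  define W where "W = (cmod w)\<^sup>2"
  define P where "P = (cmod (c - v))\<^sup>2"
  define Q where "Q = (cmod (d - w))\<^sup>2"
  define q where "q = 1 / s\<^sup>2"
  note defs = C_def D_def V_def W_def P_def Q_def
  have v: "V \<le> 2 * C + 2 * P" using cmod_diff_sq_le[of c "c - v"] by (simp add: defs)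
  have w: "W \<le> 2 * D + 2 * Q" using cmod_diff_sq_le[of d "d - w"] by (simp add: defs)
  have nn: "0 \<le> C" "0 \<le> P" "0 \<le> Q" by (simp_all add: defs)
  have q: "0 \<le> q" "q \<le> 1" using s by (auto simp: q_def one_le_power)
  have qe: "(1 / s)\<^sup>2 = q" "2 / s\<^sup>2 = 2 * q" by (simp_all add: q_def power_divide)
  have "q * V \<le> q * (2 * C + 2 * P)" using v q by (intro mult_left_mono)
  also have "\<dots> = 2 * (q * C) + 2 * (q * P)" by (simp add: algebra_simps)
  also have "q * P \<le> 1 * P" using q nn by (intro mult_right_mono) auto
  finally have qv: "q * V \<le> 2 * (q * C) + 2 * P" by simp
  have sQ: "0 \<le> s\<^sup>2 * Q" and qC: "0 \<le> q * C" using nn q by auto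
  have rhs: "(s\<^sup>2 + 4) * (P + Q) + 2 * q * C + 2 * D = s\<^sup>2 * P + s\<^sup>2 * Q + 4 * P + 4 * Q + 2 * (q * C) + 2 * D"
    by (simp add: algebra_simps)
  have "s\<^sup>2 * P + q * V + W \<le> (s\<^sup>2 + 4) * (P + Q) + 2 * q * C + 2 * D"
    unfolding rhs using qv w sQ qC nn by linarith
  moreover have "s\<^sup>2 * P + q * C + W \<le> (s\<^sup>2 + 4) * (P + Q) + 2 * q * C + 2 * D"
    unfolding rhs using w sQ qC nn by linarith
  ultimately show "s\<^sup>2 * (cmod (c - v))\<^sup>2 + (1 / s)\<^sup>2 * (cmod v)\<^sup>2 + (cmod w)\<^sup>2
      \<le> (s\<^sup>2 + 4) * ((cmod (c - v))\<^sup>2 + (cmod (d - w))\<^sup>2) + 2 / s\<^sup>2 * (cmod c)\<^sup>2 + 2 * (cmod d)\<^sup>2"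
    and "s\<^sup>2 * (cmod (c - v))\<^sup>2 + (1 / s)\<^sup>2 * (cmod c)\<^sup>2 + (cmod w)\<^sup>2
      \<le> (s\<^sup>2 + 4) * ((cmod (c - v))\<^sup>2 + (cmod (d - w))\<^sup>2) + 2 / s\<^sup>2 * (cmod c)\<^sup>2 + 2 * (cmod d)\<^sup>2"
    unfolding qe defs .
qed

lemma sqsum_corrections:
  assumes s: "1 \<le> s"
  shows "sqsum (map fst (corrections s a b h k m)) x
      \<le> (s\<^sup>2 + 4) * (\<Sum>n<2 * m. (cmod (interleave (\<lambda>n. apply_bcontfun (a n)) f n x - apply_bcontfun (h n) x))\<^sup>2)
        + 2 / s\<^sup>2 * (\<Sum>n<m. (cmod (apply_bcontfun (a n) x))\<^sup>2) + 2 * (\<Sum>n<m. (cmod (f n x))\<^sup>2)"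
      (is "_ \<le> ?F m")
    and "sqsum (map snd (corrections s a b h k m)) y
      \<le> (s\<^sup>2 + 4) * (\<Sum>n<2 * m. (cmod (interleave (\<lambda>n. apply_bcontfun (b n)) g n y - apply_bcontfun (k n) y))\<^sup>2)
        + 2 / s\<^sup>2 * (\<Sum>n<m. (cmod (apply_bcontfun (b n) y))\<^sup>2) + 2 * (\<Sum>n<m. (cmod (g n y))\<^sup>2)"
      (is "_ \<le> ?G m")
proof -
  have two: "2 * Suc m = Suc (Suc (2 * m))" for m by simp
  show "sqsum (map fst (corrections s a b h k m)) x \<le> ?F m"
  proof (induction m)
    case (Suc m)
    let ?a = "apply_bcontfun (a m) x" and ?h = "apply_bcontfun (h (2 * m)) x"
      and ?h' = "apply_bcontfun (h (Suc (2 * m))) x"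
    have "sqsum (map fst (corrections s a b h k (Suc m))) x = sqsum (map fst (corrections s a b h k m)) x
        + (s\<^sup>2 * (cmod (?a - ?h))\<^sup>2 + (1 / s)\<^sup>2 * (cmod ?h)\<^sup>2 + (cmod ?h')\<^sup>2)"
      by (simp add: corrections_Suc power_mult_distrib power_divide)
    moreover have "?F (Suc m) = ?F m + ((s\<^sup>2 + 4) * ((cmod (?a - ?h))\<^sup>2 + (cmod (f m x - ?h'))\<^sup>2)
        + 2 / s\<^sup>2 * (cmod ?a)\<^sup>2 + 2 * (cmod (f m x))\<^sup>2)"
      unfolding two sum.lessThan_Suc interleave_simps by (simp add: distrib_left)
    ultimately show ?case using Suc weighted_square_le(1)[OF s, of ?a ?h ?h' "f m x"] by linarith
  qed (simp add: corrections_def)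
  show "sqsum (map snd (corrections s a b h k m)) y \<le> ?G m"
  proof (induction m)
    case (Suc m)
    let ?b = "apply_bcontfun (b m) y" and ?k = "apply_bcontfun (k (2 * m)) y"
      and ?k' = "apply_bcontfun (k (Suc (2 * m))) y"
    have "sqsum (map snd (corrections s a b h k (Suc m))) y = sqsum (map snd (corrections s a b h k m)) y
        + (s\<^sup>2 * (cmod (?b - ?k))\<^sup>2 + (1 / s)\<^sup>2 * (cmod ?b)\<^sup>2 + (cmod ?k')\<^sup>2)"
      by (simp add: corrections_Suc power_mult_distrib power_divide)
    moreover have "?G (Suc m) = ?G m + ((s\<^sup>2 + 4) * ((cmod (?b - ?k))\<^sup>2 + (cmod (g m y - ?k'))\<^sup>2)
        + 2 / s\<^sup>2 * (cmod ?b)\<^sup>2 + 2 * (cmod (g m y))\<^sup>2)"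
      unfolding two sum.lessThan_Suc interleave_simps by (simp add: distrib_left)
    ultimately show ?case using Suc weighted_square_le(2)[OF s, of ?b ?k ?k' "g m y"] by linarith
  qed (simp add: corrections_def)
qed

lemma continuous_on_vbound:
  assumes "vbound F s" shows "continuous_on UNIV F"
proof -
  obtain f g where fg: "summable (\<lambda>i. norm (f i) * norm (g i))"
    "\<And>x y. (\<lambda>i. apply_bcontfun (f i) x * apply_bcontfun (g i) y) sums F (x, y)"
    using assms unfolding vbound_def by blast
  have U: "uniform_limit UNIV (\<lambda>n z. \<Sum>i<n. apply_bcontfun (f i) (fst z) * apply_bcontfun (g i) (snd z))
      (\<lambda>z. \<Sum>i. apply_bcontfun (f i) (fst z) * apply_bcontfun (g i) (snd z)) sequentially"
    using fg(1) by (intro Weierstrass_m_test[where M = "\<lambda>i. norm (f i) * norm (g i)"])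
      (auto simp: norm_mult norm_bounded mult_mono)
  have F: "(\<lambda>z. \<Sum>i. apply_bcontfun (f i) (fst z) * apply_bcontfun (g i) (snd z)) = F"
    using sums_unique[OF fg(2)] by (auto simp: fun_eq_iff)
  have "continuous_on UNIV (\<lambda>z. \<Sum>i<n. apply_bcontfun (f i) (fst z) * apply_bcontfun (g i) (snd z))" for n
    by (intro continuous_intros continuous_on_compose2[OF continuous_on_apply_bcontfun]) auto
  then have "continuous_on UNIV (\<lambda>z. \<Sum>i. apply_bcontfun (f i) (fst z) * apply_bcontfun (g i) (snd z))"
    by (intro uniform_limit_theorem[OF _ U] always_eventually allI) auto
  then show ?thesis by (simp only: F)
qed

lemma eventually_vbound_tail:
  fixes f :: "nat \<Rightarrow> 'a::topological_space \<Rightarrow>\<^sub>C complex" and g :: "nat \<Rightarrow> 'b::topological_space \<Rightarrow>\<^sub>C complex"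
  assumes summ: "summable (\<lambda>i. norm (f i) * norm (g i))"
    and rep: "\<And>x y. (\<lambda>i. apply_bcontfun (f i) x * apply_bcontfun (g i) y) sums F (x, y)" and \<delta>: "0 < \<delta>"
  shows "\<forall>\<^sub>F m in sequentially. vbound (\<lambda>z. F z - (\<Sum>n<m. apply_bcontfun (f n) (fst z) * apply_bcontfun (g n) (snd z))) \<delta>"
proof -
  have "(\<lambda>m. \<Sum>i. norm (f (i + m)) * norm (g (i + m))) \<longlonglongrightarrow> 0"
    by (rule suminf_exist_split2[OF summ])
  then have "\<forall>\<^sub>F m in sequentially. (\<Sum>i. norm (f (i + m)) * norm (g (i + m))) < \<delta>"
    using \<delta> by (rule order_tendstoD(2))
  then show ?thesis
  proof eventually_elim
    case (elim m)
    show ?case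
      unfolding vbound_def
    proof (intro exI conjI allI)
      show "summable (\<lambda>i. norm (f (i + m)) * norm (g (i + m)))"
        by (rule summable_ignore_initial_segment[OF summ])
      show "(\<Sum>i. norm (f (i + m)) * norm (g (i + m))) \<le> \<delta>" using elim by simp
      show "(\<lambda>i. apply_bcontfun (f (i + m)) x * apply_bcontfun (g (i + m)) y) sums
          (F (x, y) - (\<Sum>n<m. apply_bcontfun (f n) (fst (x, y)) * apply_bcontfun (g n) (snd (x, y))))" for x y
        using sums_split_initial_segment[OF rep[of x y], of m] by simp
    qed
  qed
qed

lemma vbound_balanced:
  fixes F :: "'a::metric_space \<times> 'b::metric_space \<Rightarrow> complex"
  assumes "vbound F C"
  obtains a :: "nat \<Rightarrow> 'a \<Rightarrow>\<^sub>C complex" and b :: "nat \<Rightarrow> 'b \<Rightarrow>\<^sub>C complex"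
  where "summable (\<lambda>n. (norm (a n))\<^sup>2)" "summable (\<lambda>n. (norm (b n))\<^sup>2)"
    "(\<Sum>n. (norm (a n))\<^sup>2) \<le> C" "(\<Sum>n. (norm (b n))\<^sup>2) \<le> C"
    "summable (\<lambda>n. norm (a n) * norm (b n))"
    "\<And>x y. (\<lambda>n. apply_bcontfun (a n) x * apply_bcontfun (b n) y) sums F (x, y)"
proof -
  obtain f :: "nat \<Rightarrow> 'a \<Rightarrow>\<^sub>C complex" and g :: "nat \<Rightarrow> 'b \<Rightarrow>\<^sub>C complex"
    where fg: "summable (\<lambda>i. norm (f i) * norm (g i))" "(\<Sum>i. norm (f i) * norm (g i)) \<le> C"
    "\<And>x y. (\<lambda>i. apply_bcontfun (f i) x * apply_bcontfun (g i) y) sums F (x, y)"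
    using assms unfolding vbound_def by blast
  define a where "a n = balance (norm (f n)) (norm (g n)) *\<^sub>R f n" for n
  define b where "b n = balance (norm (g n)) (norm (f n)) *\<^sub>R g n" for n
  have na: "(norm (a n))\<^sup>2 = norm (f n) * norm (g n)" for n
    using balance_square[of "norm (f n)" "norm (g n)"] by (simp add: a_def power_mult_distrib)
  have nb: "(norm (b n))\<^sup>2 = norm (f n) * norm (g n)" for n
    using balance_square[of "norm (g n)" "norm (f n)"] by (simp add: b_def power_mult_distrib mult.commute)
  have prod: "norm (a n) * norm (b n) = norm (f n) * norm (g n)" for n
  proof -
    have "(norm (a n) * norm (b n))\<^sup>2 = (norm (f n) * norm (g n))\<^sup>2"
      by (simp only: power_mult_distrib na nb) (simp add: power2_eq_square)
    then show ?thesis by (rule power2_eq_imp_eq) auto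
  qed
  have val: "apply_bcontfun (a n) x * apply_bcontfun (b n) y = apply_bcontfun (f n) x * apply_bcontfun (g n) y" for n x y
  proof (cases "f n = 0 \<or> g n = 0")
    case True
    then show ?thesis by (auto simp: a_def b_def)
  next
    case False
    then have "balance (norm (f n)) (norm (g n)) * balance (norm (g n)) (norm (f n)) = 1"
      by (intro balance_inverse) auto
    then show ?thesis by (simp add: a_def b_def mult.commute)
  qed
  show ?thesis by (rule that[of a b]) (use fg in \<open>simp_all add: na nb prod val\<close>)
qed

lemma nn_integral_sqseries_bcontfun:
  fixes a :: "nat \<Rightarrow> 'a::metric_space \<Rightarrow>\<^sub>C complex"
  assumes fin: "finite_measure M" and sets: "sets M = sets borel"
    and a: "summable (\<lambda>n. (norm (a n))\<^sup>2)" "(\<Sum>n. (norm (a n))\<^sup>2) \<le> C"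
  shows "(\<integral>\<^sup>+x. sqseries (\<lambda>n. apply_bcontfun (a n)) x \<partial>M) \<le> ennreal (C * measure M UNIV)"
proof -
  interpret finite_measure M by (rule fin)
  have sp: "space M = UNIV" using sets_eq_imp_space_eq[OF sets] by simp
  have "sqseries (\<lambda>n. apply_bcontfun (a n)) x \<le> ennreal C" for x
  proof -
    have "sqseries (\<lambda>n. apply_bcontfun (a n)) x \<le> (\<Sum>n. ennreal ((norm (a n))\<^sup>2))"
      unfolding sqseries_def by (intro suminf_le ennreal_leI power_mono norm_bounded) auto
    also have "\<dots> = ennreal (\<Sum>n. (norm (a n))\<^sup>2)" using a(1) by (intro suminf_ennreal2) auto
    finally show ?thesis using ennreal_leI[OF a(2)] by (rule order_trans)
  qed
  then have "(\<integral>\<^sup>+x. sqseries (\<lambda>n. apply_bcontfun (a n)) x \<partial>M) \<le> (\<integral>\<^sup>+x. ennreal C \<partial>M)"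
    by (intro nn_integral_mono)
  also have "\<dots> = ennreal (C * measure M UNIV)"
    using suminf_nonneg[OF a(1)] a(2) by (simp add: sp emeasure_eq_measure ennreal_mult)
  finally show ?thesis .
qed

lemma bcontfun_borel_measurable:
  fixes u :: "'a::metric_space \<Rightarrow>\<^sub>C complex"
  assumes "sets M = sets borel"
  shows "apply_bcontfun u \<in> borel_measurable M"
  using borel_measurable_continuous_onI[of "apply_bcontfun u"] measurable_cong_sets[OF assms refl] by blast

lemma bcontfun_L2:
  fixes u :: "'a::metric_space \<Rightarrow>\<^sub>C complex"
  assumes "finite_measure M" "sets M = sets borel"
  shows "apply_bcontfun u \<in> L2_fun M"
proof -
  interpret finite_measure M by fact
  have m: "apply_bcontfun u \<in> borel_measurable M" by (rule bcontfun_borel_measurable[OF assms(2)])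
  have "integrable M (\<lambda>x. (cmod (apply_bcontfun u x))\<^sup>2)"
    using m by (intro integrable_const_bound[of _ "(norm u)\<^sup>2"]) (auto intro!: power_mono norm_bounded)
  with m show ?thesis by (simp add: L2_fun_def)
qed

lemma vbound_L2_tensor:
  fixes F :: "'a::metric_space \<times> 'b::metric_space \<Rightarrow> complex"
  assumes V: "vbound F C" and \<mu>: "finite_measure \<mu>" "sets \<mu> = sets borel"
    and \<nu>: "finite_measure \<nu>" "sets \<nu> = sets borel"
  shows "F \<in> L2_tensor \<mu> \<nu>"
proof -
  obtain a :: "nat \<Rightarrow> 'a \<Rightarrow>\<^sub>C complex" and b :: "nat \<Rightarrow> 'b \<Rightarrow>\<^sub>C complex" where ab:
    "summable (\<lambda>n. norm (a n) * norm (b n))"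
    "\<And>x y. (\<lambda>n. apply_bcontfun (a n) x * apply_bcontfun (b n) y) sums F (x, y)"
    using V unfolding vbound_def by blast
  have bd: "L2_norm M (apply_bcontfun u) \<le> sqrt (measure M UNIV) * norm u"
    if "finite_measure M" "sets M = sets borel" for M and u :: "'c::metric_space \<Rightarrow>\<^sub>C complex"
  proof -
    interpret finite_measure M by fact
    have sp: "space M = UNIV" using sets_eq_imp_space_eq[OF that(2)] by simp
    have "(\<integral>x. (cmod (apply_bcontfun u x))\<^sup>2 \<partial>M) \<le> (\<integral>x. (norm u)\<^sup>2 \<partial>M)"
      using bcontfun_L2[OF that, of u]
      by (intro integral_mono) (auto simp: L2_fun_def intro!: power_mono norm_bounded)
    also have "\<dots> = measure M UNIV * (norm u)\<^sup>2" by (simp add: sp)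
    finally have "L2_norm M (apply_bcontfun u) \<le> sqrt (measure M UNIV * (norm u)\<^sup>2)"
      unfolding L2_norm_def by (rule real_sqrt_le_mono)
    then show ?thesis by (simp add: real_sqrt_mult)
  qed
  have "L2_tensor_rep \<mu> \<nu> (\<lambda>n. apply_bcontfun (a n)) (\<lambda>n. apply_bcontfun (b n)) F"
    unfolding L2_tensor_rep_def
  proof (intro conjI allI)
    show "apply_bcontfun (a n) \<in> L2_fun \<mu>" "apply_bcontfun (b n) \<in> L2_fun \<nu>" for n
      by (rule bcontfun_L2[OF \<mu>], rule bcontfun_L2[OF \<nu>])
    have "summable (\<lambda>n. sqrt (measure \<mu> UNIV) * sqrt (measure \<nu> UNIV) * (norm (a n) * norm (b n)))"
      by (rule summable_mult[OF ab(1)])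
    then show "summable (\<lambda>n. L2_norm \<mu> (apply_bcontfun (a n)) * L2_norm \<nu> (apply_bcontfun (b n)))"
    proof (rule summable_comparison_test')
      fix n
      have "L2_norm \<mu> (apply_bcontfun (a n)) * L2_norm \<nu> (apply_bcontfun (b n))
          \<le> (sqrt (measure \<mu> UNIV) * norm (a n)) * (sqrt (measure \<nu> UNIV) * norm (b n))"
        by (intro mult_mono bd \<mu> \<nu>) (auto simp: L2_norm_nonneg)
      then show "norm (L2_norm \<mu> (apply_bcontfun (a n)) * L2_norm \<nu> (apply_bcontfun (b n)))
          \<le> sqrt (measure \<mu> UNIV) * sqrt (measure \<nu> UNIV) * (norm (a n) * norm (b n))"
        by (simp add: L2_norm_nonneg abs_mult ac_simps)
    qed
    show "mae \<mu> \<nu> (\<lambda>(x, y). (\<lambda>n. apply_bcontfun (a n) x * apply_bcontfun (b n) y) sums F (x, y))"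
      by (rule maeI[of "{}" _ "{}"]) (auto simp: ab(2))
  qed
  then show ?thesis by (auto simp: L2_tensor_def)
qed

lemma vanishes_near_combination:
  assumes "vanishes_near E \<psi>" "vanishes_near E \<phi>"
  shows "vanishes_near E (\<lambda>z. s *\<^sub>R \<psi> z + t *\<^sub>R \<phi> z)"
proof -
  obtain U V c d where "open U" "E \<subseteq> U" "\<And>p. p \<in> U \<Longrightarrow> \<psi> p = 0" "vbound \<psi> c"
    "open V" "E \<subseteq> V" "\<And>p. p \<in> V \<Longrightarrow> \<phi> p = 0" "vbound \<phi> d"
    using assms unfolding vanishes_near_def by metis
  then have "open (U \<inter> V)" "E \<subseteq> U \<inter> V" "\<forall>p\<in>U \<inter> V. s *\<^sub>R \<psi> p + t *\<^sub>R \<phi> p = 0"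
    "vbound (\<lambda>z. s *\<^sub>R \<psi> z + t *\<^sub>R \<phi> z) (\<bar>s\<bar> * c + \<bar>t\<bar> * d)"
    by (auto intro!: vbound_add vbound_scaleR)
  then show ?thesis unfolding vanishes_near_def by blast
qed

section \<open>From operator synthesis to spectral synthesis\<close>

text \<open>Concatenating lists that are scaled by \<open>sqrt t\<close> and
  \<open>sqrt (1 - t)\<close> forms convex combinations both of the represented functions and of the square sums.
  If all square sums of a list were below \<open>d / 16\<close>, Grothendieck's constant 8 would give the list a
  weight of at most \<open>d / 2\<close>, and \<open>\<Phi> - \<psi>\<close> one of at most \<open>d\<close>.\<close>

lemma measures_bounding_distance:
  fixes E :: "('a::metric_space \<times> 'b::metric_space) set"
  assumes X: "compact (UNIV :: 'a set)" and Y: "compact (UNIV :: 'b set)" and d: "0 < d"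
    and far: "\<And>\<psi>. vanishes_near E \<psi> \<Longrightarrow> \<not> vbound (\<lambda>z. \<Phi> z - \<psi> z) d"
  obtains \<mu> :: "'a measure" and \<nu> :: "'b measure"
  where "finite_measure \<mu>" "sets \<mu> = sets borel" "finite_measure \<nu>" "sets \<nu> = sets borel"
    "\<And>\<psi> l. vanishes_near E \<psi> \<Longrightarrow> vbound (\<lambda>z. \<Phi> z - \<psi> z - tens l z) (d / 2) \<Longrightarrow>
       d / 16 \<le> (\<integral>x. sqsum (map fst l) x \<partial>\<mu>) + (\<integral>y. sqsum (map snd l) y \<partial>\<nu>)"
proof -
  define \<L> where "\<L> = {l. \<exists>\<psi>. vanishes_near E \<psi> \<and> vbound (\<lambda>z. \<Phi> z - \<psi> z - tens l z) (d / 2)}"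
  have conv: "scale_both (sqrt t) l @ scale_both (sqrt (1 - t)) m \<in> \<L>"
    if "l \<in> \<L>" "m \<in> \<L>" "0 \<le> t" "t \<le> 1" for l m t
  proof -
    obtain \<psi> \<phi> where \<psi>: "vanishes_near E \<psi>" "vbound (\<lambda>z. \<Phi> z - \<psi> z - tens l z) (d / 2)"
      and \<phi>: "vanishes_near E \<phi>" "vbound (\<lambda>z. \<Phi> z - \<phi> z - tens m z) (d / 2)"
      using \<open>l \<in> \<L>\<close> \<open>m \<in> \<L>\<close> by (auto simp: \<L>_def)
    have V: "vbound (\<lambda>z. t *\<^sub>R (\<Phi> z - \<psi> z - tens l z) + (1 - t) *\<^sub>R (\<Phi> z - \<phi> z - tens m z))
        (\<bar>t\<bar> * (d / 2) + \<bar>1 - t\<bar> * (d / 2))"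
      by (intro vbound_add vbound_scaleR \<psi> \<phi>)
    have e1: "\<bar>t\<bar> * (d / 2) + \<bar>1 - t\<bar> * (d / 2) = d / 2" using that by (simp add: field_simps)
    have e2: "(\<lambda>z. t *\<^sub>R (\<Phi> z - \<psi> z - tens l z) + (1 - t) *\<^sub>R (\<Phi> z - \<phi> z - tens m z))
        = (\<lambda>z. \<Phi> z - (t *\<^sub>R \<psi> z + (1 - t) *\<^sub>R \<phi> z) - tens (scale_both (sqrt t) l @ scale_both (sqrt (1 - t)) m) z)"
      using that by (simp add: fun_eq_iff tens_scale_both algebra_simps)
    have "vbound (\<lambda>z. \<Phi> z - (t *\<^sub>R \<psi> z + (1 - t) *\<^sub>R \<phi> z)
        - tens (scale_both (sqrt t) l @ scale_both (sqrt (1 - t)) m) z) (d / 2)" using V unfolding e1 e2 .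
    with vanishes_near_combination[OF \<psi>(1) \<phi>(1), of t "1 - t"] show ?thesis unfolding \<L>_def by blast
  qed
  have large: "(\<exists>x. d / 16 \<le> sqsum (map fst l) x) \<or> (\<exists>y. d / 16 \<le> sqsum (map snd l) y)" if "l \<in> \<L>" for l
  proof (rule ccontr)
    assume "\<not> ?thesis"
    then have "vbound (tens l) (8 * (d / 16))"
      using d by (intro Grothendieck) (auto simp: not_le intro: less_imp_le)
    moreover obtain \<psi> where \<psi>: "vanishes_near E \<psi>" "vbound (\<lambda>z. \<Phi> z - \<psi> z - tens l z) (d / 2)"
      using \<open>l \<in> \<L>\<close> by (auto simp: \<L>_def)
    ultimately have "vbound (\<lambda>z. \<Phi> z - \<psi> z - tens l z + tens l z) (d / 2 + 8 * (d / 16))"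
      by (intro vbound_add)
    then show False using far[OF \<psi>(1)] by simp
  qed
  obtain \<mu> :: "'a measure" and \<nu> :: "'b measure"
    where *: "finite_measure \<mu>" "sets \<mu> = sets borel" "finite_measure \<nu>" "sets \<nu> = sets borel"
    "\<And>l. l \<in> \<L> \<Longrightarrow> d / 16 \<le> (\<integral>x. sqsum (map fst l) x \<partial>\<mu>) + (\<integral>y. sqsum (map snd l) y \<partial>\<nu>)"
    using dominating_measures[OF X Y conv large] by blast
  show ?thesis by (rule that[OF *(1-4)], rule *(5)) (auto simp: \<L>_def)
qed

lemma pseudo_openE:
  assumes U: "pseudo_open \<mu> \<nu> U" and sp: "space \<mu> = UNIV" "space \<nu> = UNIV"
  obtains A B N M where "\<And>k::nat. A k \<in> sets \<mu>" "\<And>k. B k \<in> sets \<nu>"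
    "N \<in> null_sets \<mu>" "M \<in> null_sets \<nu>"
    "\<And>x y. x \<notin> N \<Longrightarrow> y \<notin> M \<Longrightarrow> (x, y) \<in> U \<longleftrightarrow> (\<exists>k. x \<in> A k \<and> y \<in> B k)"
proof -
  obtain A B where AB: "range A \<subseteq> sets \<mu>" "range B \<subseteq> sets \<nu>"
    and null: "marginally_null \<mu> \<nu> (sym_diff U (\<Union>k::nat. A k \<times> B k))"
    using U unfolding pseudo_open_def by (elim conjE exE)
  obtain N M where NM: "N \<in> null_sets \<mu>" "M \<in> null_sets \<nu>"
    and sub: "sym_diff U (\<Union>k::nat. A k \<times> B k) \<subseteq> (N \<times> UNIV) \<union> (UNIV \<times> M)"
    using null unfolding marginally_null_def sp by (elim bexE)
  have iff: "(x, y) \<in> U \<longleftrightarrow> (\<exists>k. x \<in> A k \<and> y \<in> B k)" if "x \<notin> N" "y \<notin> M" for x y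
  proof -
    have "(x, y) \<notin> sym_diff U (\<Union>k::nat. A k \<times> B k)" using sub that by blast
    then show ?thesis by auto
  qed
  have "A k \<in> sets \<mu>" "B k \<in> sets \<nu>" for k using AB by auto
  from that[OF this NM iff] show ?thesis .
qed

text \<open>Operator synthesis makes \<open>\<Phi>\<close> a limit in \<open>\<Gamma>(X, Y)\<close> of functions \<open>G\<close> that vanish
  around \<open>E\<close>. The constants are chosen in the order \<open>\<epsilon>\<close> (distance of \<open>G\<close> from \<open>\<Phi>\<close>), \<open>s\<close> (scaling in
  \<open>corrections\<close>), \<open>\<eta>\<close> (accuracy of the continuous approximation, depending on \<open>s\<close>), \<open>m\<close> (length of the
  partial sum), such that the contributions add up to \<open>5 c / 8\<close>.\<close>

lemma operator_synthesis_small_corrections: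
  fixes E :: "('a::metric_space \<times> 'b::metric_space) set"
  assumes X: "compact (UNIV :: 'a set)" and Y: "compact (UNIV :: 'b set)" and E: "closed E"
    and \<mu>: "finite_measure \<mu>" "sets \<mu> = sets borel" and \<nu>: "finite_measure \<nu>" "sets \<nu> = sets borel"
    and syn: "operator_synthesis \<mu> \<nu> E"
    and \<Phi>: "vbound \<Phi> C" "\<And>p. p \<in> E \<Longrightarrow> \<Phi> p = 0" and c: "0 < c" and d: "0 < d"
  obtains \<psi> l where "vanishes_near E \<psi>" "vbound (\<lambda>z. \<Phi> z - \<psi> z - tens l z) d"
    "(\<integral>x. sqsum (map fst l) x \<partial>\<mu>) + (\<integral>y. sqsum (map snd l) y \<partial>\<nu>) < c"
proof -
  have sp: "space \<mu> = UNIV" "space \<nu> = UNIV" using sets_eq_imp_space_eq[OF \<mu>(2)] sets_eq_imp_space_eq[OF \<nu>(2)] by simp_all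
  define \<epsilon> where "\<epsilon> = c / 16"
  have \<epsilon>: "0 < \<epsilon>" using c by (simp add: \<epsilon>_def)
  have \<Phi>L: "\<Phi> \<in> L2_tensor \<mu> \<nu>" by (rule vbound_L2_tensor[OF \<Phi>(1) \<mu> \<nu>])
  moreover have "vanishes_on \<mu> \<nu> E \<Phi>"
    unfolding vanishes_on_def by (rule maeI[of "{}" _ "{}"]) (auto simp: indicator_def \<Phi>(2))
  ultimately have "\<Phi> \<in> Phi0_set \<mu> \<nu> E" using syn by (simp add: operator_synthesis_def Phi_set_def)
  then obtain G where G: "\<And>n. G n \<in> L2_tensor \<mu> \<nu>"
    "\<And>n. \<exists>U. pseudo_open \<mu> \<nu> U \<and> E \<subseteq> U \<and> vanishes_on \<mu> \<nu> U (G n)"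
    "(\<lambda>n. L2_tensor_norm \<mu> \<nu> (\<lambda>p. \<Phi> p - G n p)) \<longlonglongrightarrow> 0"
    unfolding Phi0_set_def by blast
  have "\<forall>\<^sub>F n in sequentially. L2_tensor_norm \<mu> \<nu> (\<lambda>p. \<Phi> p - G n p) < \<epsilon>"
    using G(3) \<epsilon> by (rule order_tendstoD(2))
  from eventually_happens'[OF sequentially_bot this]
  obtain i where i: "L2_tensor_norm \<mu> \<nu> (\<lambda>p. \<Phi> p - G i p) < \<epsilon>" by blast
  have "(\<lambda>p. \<Phi> p - G i p) \<in> L2_tensor \<mu> \<nu>" by (rule L2_tensor_diff[OF \<Phi>L G(1) sp])
  then obtain f0 g0 where rep0: "L2_tensor_rep \<mu> \<nu> f0 g0 (\<lambda>p. \<Phi> p - G i p)"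
    "(\<Sum>n. L2_norm \<mu> (f0 n) * L2_norm \<nu> (g0 n)) < \<epsilon>"
    using cInf_lessD[OF _ i[unfolded L2_tensor_norm_def]] unfolding L2_tensor_def by blast
  obtain f g N1 M1 where fg: "\<And>n. f n \<in> borel_measurable \<mu>" "\<And>n. g n \<in> borel_measurable \<nu>"
    "(\<integral>\<^sup>+x. sqseries f x \<partial>\<mu>) \<le> ennreal \<epsilon>" "(\<integral>\<^sup>+y. sqseries g y \<partial>\<nu>) \<le> ennreal \<epsilon>"
    "N1 \<in> null_sets \<mu>" "M1 \<in> null_sets \<nu>"
    "\<And>x y. x \<notin> N1 \<Longrightarrow> y \<notin> M1 \<Longrightarrow> (\<lambda>n. f n x * g n y) sums (\<Phi> (x, y) - G i (x, y))"
    by (rule L2_tensor_balanced[OF rep0(1) sp less_imp_le[OF rep0(2)]]) blast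
  obtain U where U: "pseudo_open \<mu> \<nu> U" "E \<subseteq> U" "vanishes_on \<mu> \<nu> U (G i)" using G(2) by blast
  obtain N2 M2 where vanG: "N2 \<in> null_sets \<mu>" "M2 \<in> null_sets \<nu>"
    "\<And>x y. x \<notin> N2 \<Longrightarrow> y \<notin> M2 \<Longrightarrow> G i (x, y) * indicator U (x, y) = 0"
    by (rule maeE[OF U(3)[unfolded vanishes_on_def] sp]) blast
  obtain A B N3 M3 where AB: "\<And>k::nat. A k \<in> sets \<mu>" "\<And>k. B k \<in> sets \<nu>"
    "N3 \<in> null_sets \<mu>" "M3 \<in> null_sets \<nu>"
    "\<And>x y. x \<notin> N3 \<Longrightarrow> y \<notin> M3 \<Longrightarrow> (x, y) \<in> U \<longleftrightarrow> (\<exists>k. x \<in> A k \<and> y \<in> B k)"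
    by (fact pseudo_openE[OF U(1) sp])
  define N where "N = N1 \<union> (N2 \<union> N3)"
  define M where "M = M1 \<union> (M2 \<union> M3)"
  have NM: "N \<in> null_sets \<mu>" "M \<in> null_sets \<nu>"
    unfolding N_def M_def by (intro null_sets.Un fg vanG AB)+
  have U_iff: "(x, y) \<in> U \<longleftrightarrow> (\<exists>k. x \<in> A k \<and> y \<in> B k)" if "x \<notin> N" "y \<notin> M" for x y
    using AB(5)[of x y] that by (simp add: N_def M_def)
  obtain a :: "nat \<Rightarrow> 'a \<Rightarrow>\<^sub>C complex" and b :: "nat \<Rightarrow> 'b \<Rightarrow>\<^sub>C complex" where ab:
    "summable (\<lambda>n. (norm (a n))\<^sup>2)" "summable (\<lambda>n. (norm (b n))\<^sup>2)"
    "(\<Sum>n. (norm (a n))\<^sup>2) \<le> C" "(\<Sum>n. (norm (b n))\<^sup>2) \<le> C"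
    "summable (\<lambda>n. norm (a n) * norm (b n))"
    "\<And>x y. (\<lambda>n. apply_bcontfun (a n) x * apply_bcontfun (b n) y) sums \<Phi> (x, y)"
    by (rule vbound_balanced[OF \<Phi>(1)]) blast
  have C0: "0 \<le> C" by (rule vbound_nonneg[OF \<Phi>(1)])
  have Ia: "(\<integral>\<^sup>+x. sqseries (\<lambda>n. apply_bcontfun (a n)) x \<partial>\<mu>) \<le> ennreal (C * measure \<mu> UNIV)"
    by (rule nn_integral_sqseries_bcontfun[OF \<mu> ab(1,3)])
  have Ib: "(\<integral>\<^sup>+y. sqseries (\<lambda>n. apply_bcontfun (b n)) y \<partial>\<nu>) \<le> ennreal (C * measure \<nu> UNIV)"
    by (rule nn_integral_sqseries_bcontfun[OF \<nu> ab(2,4)])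
  define F where "F = interleave (\<lambda>n. apply_bcontfun (a n)) (\<lambda>n x. - f n x)"
  define H where "H = interleave (\<lambda>n. apply_bcontfun (b n)) g"
  have am: "apply_bcontfun (a n) \<in> borel_measurable \<mu>" and bm: "apply_bcontfun (b n) \<in> borel_measurable \<nu>" for n
    by (rule bcontfun_borel_measurable[OF \<mu>(2)], rule bcontfun_borel_measurable[OF \<nu>(2)])
  have Fm: "F n \<in> borel_measurable \<mu>" for n
    using am fg(1) unfolding F_def interleave_def by (auto intro: borel_measurable_uminus)
  have Hm: "H n \<in> borel_measurable \<nu>" for n
    using bm fg(2) unfolding H_def interleave_def by auto
  have fneg: "sqseries (\<lambda>n x. - f n x) x = sqseries f x" for x by (simp add: sqseries_def)
  have FI: "(\<integral>\<^sup>+x. sqseries F x \<partial>\<mu>) \<noteq> top"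
  proof -
    have "(\<integral>\<^sup>+x. sqseries F x \<partial>\<mu>) \<le> (\<integral>\<^sup>+x. sqseries (\<lambda>n. apply_bcontfun (a n)) x + sqseries f x \<partial>\<mu>)"
      unfolding F_def using sqseries_interleave_le[of "\<lambda>n. apply_bcontfun (a n)" "\<lambda>n x. - f n x"]
      by (intro nn_integral_mono) (simp add: fneg)
    also have "\<dots> = (\<integral>\<^sup>+x. sqseries (\<lambda>n. apply_bcontfun (a n)) x \<partial>\<mu>) + (\<integral>\<^sup>+x. sqseries f x \<partial>\<mu>)"
      by (intro nn_integral_add measurable_sqseries am fg)
    also have "\<dots> < top"
      using order_le_less_trans[OF Ia ennreal_less_top] order_le_less_trans[OF fg(3) ennreal_less_top] by simp
    finally show ?thesis by simp
  qed
  have HI: "(\<integral>\<^sup>+y. sqseries H y \<partial>\<nu>) \<noteq> top"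
  proof -
    have "(\<integral>\<^sup>+y. sqseries H y \<partial>\<nu>) \<le> (\<integral>\<^sup>+y. sqseries (\<lambda>n. apply_bcontfun (b n)) y + sqseries g y \<partial>\<nu>)"
      unfolding H_def by (intro nn_integral_mono sqseries_interleave_le)
    also have "\<dots> = (\<integral>\<^sup>+y. sqseries (\<lambda>n. apply_bcontfun (b n)) y \<partial>\<nu>) + (\<integral>\<^sup>+y. sqseries g y \<partial>\<nu>)"
      by (intro nn_integral_add measurable_sqseries bm fg)
    also have "\<dots> < top"
      using order_le_less_trans[OF Ib ennreal_less_top] order_le_less_trans[OF fg(4) ennreal_less_top] by simp
    finally show ?thesis by simp
  qed
  have cover: "\<forall>(x, y)\<in>E. x \<notin> N \<longrightarrow> y \<notin> M \<longrightarrow> (\<exists>k. x \<in> A k \<and> y \<in> B k)"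
    using U_iff U(2) by blast
  have zero': "(\<lambda>n. F n x * H n y) sums 0" if xy: "x \<notin> N" "y \<notin> M" "x \<in> A k" "y \<in> B k" for x y k
  proof -
    have "(x, y) \<in> U" using U_iff[OF xy(1,2)] xy(3,4) by blast
    then have G0: "G i (x, y) = 0" using vanG(3)[of x y] xy(1,2) by (simp add: N_def M_def)
    have "(\<lambda>n. f n x * g n y) sums \<Phi> (x, y)" using fg(7)[of x y] xy(1,2) G0 by (simp add: N_def M_def)
    from sums_interleave[OF ab(6)[of x y] sums_minus[OF this]]
    have "interleave (\<lambda>n. apply_bcontfun (a n) x * apply_bcontfun (b n) y) (\<lambda>n. - (f n x * g n y)) sums 0" by simp
    moreover have "interleave (\<lambda>n. apply_bcontfun (a n) x * apply_bcontfun (b n) y) (\<lambda>n. - (f n x * g n y))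
        = (\<lambda>n. F n x * H n y)"
      by (auto simp: interleave_def F_def H_def)
    ultimately show ?thesis by simp
  qed
  have zero: "\<forall>x\<in>- N. \<forall>y\<in>- M. \<forall>k. x \<in> A k \<longrightarrow> y \<in> B k \<longrightarrow> (\<lambda>n. F n x * H n y) sums 0"
    using zero' by blast
  define K where "K = C * measure \<mu> UNIV + C * measure \<nu> UNIV"
  have K0: "0 \<le> C * measure \<mu> UNIV" "0 \<le> C * measure \<nu> UNIV" using C0 by simp_all
  define s where "s = sqrt (1 + 16 * K / c)"
  have s2: "s\<^sup>2 = 1 + 16 * K / c" using K0 c by (simp add: s_def K_def)
  have s1: "1 \<le> s" unfolding s_def using K0 c by (simp add: K_def)
  have s2pos: "0 < s\<^sup>2" using s1 by simp
  define \<eta> where "\<eta> = c / (8 * (s\<^sup>2 + 4))"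
  have \<eta>: "0 < \<eta>" using c s2pos by (simp add: \<eta>_def add_pos_pos)
  obtain h :: "nat \<Rightarrow> 'a \<Rightarrow>\<^sub>C complex" and k :: "nat \<Rightarrow> 'b \<Rightarrow>\<^sub>C complex" and \<psi> where hk:
    "(\<integral>\<^sup>+x. sqseries (\<lambda>n x. F n x - apply_bcontfun (h n) x) x \<partial>\<mu>) \<le> ennreal \<eta>"
    "(\<integral>\<^sup>+y. sqseries (\<lambda>n y. H n y - apply_bcontfun (k n) y) y \<partial>\<nu>) \<le> ennreal \<eta>"
    "vanishes_near E \<psi>"
    "\<And>\<delta>. 0 < \<delta> \<Longrightarrow> \<forall>\<^sub>F m in sequentially.
       vbound (\<lambda>z. \<psi> z - (\<Sum>n<m. apply_bcontfun (h n) (fst z) * apply_bcontfun (k n) (snd z))) \<delta>"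
    by (fact continuous_approximation[OF X Y E \<mu> \<nu> Fm FI Hm HI NM AB(1,2) cover zero \<eta>])
  have d2: "0 < d / 2" using d by simp
  obtain m1 where m1: "\<And>m. m1 \<le> m \<Longrightarrow>
      vbound (\<lambda>z. \<psi> z - (\<Sum>n<m. apply_bcontfun (h n) (fst z) * apply_bcontfun (k n) (snd z))) (d / 2)"
    using hk(4)[OF d2] unfolding eventually_sequentially by blast
  obtain m2 where m2: "\<And>m. m2 \<le> m \<Longrightarrow>
      vbound (\<lambda>z. \<Phi> z - (\<Sum>n<m. apply_bcontfun (a n) (fst z) * apply_bcontfun (b n) (snd z))) (d / 2)"
    using eventually_vbound_tail[OF ab(5,6) d2] unfolding eventually_sequentially by blast
  define m where "m = max m1 m2"
  define l where "l = corrections s a b h k m"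
  have "vbound (\<lambda>z. (\<Phi> z - (\<Sum>n<m. apply_bcontfun (a n) (fst z) * apply_bcontfun (b n) (snd z)))
      - (\<psi> z - (\<Sum>n<2 * m. apply_bcontfun (h n) (fst z) * apply_bcontfun (k n) (snd z)))) (d / 2 + d / 2)"
    by (intro vbound_diff m1 m2) (auto simp: m_def)
  then have close: "vbound (\<lambda>z. \<Phi> z - \<psi> z - tens l z) d"
    using s1 by (simp add: l_def tens_corrections algebra_simps)
  have sq_meas: "sqsum ps \<in> borel_measurable Q" if "sets Q = sets borel" for ps and Q :: "'c::metric_space measure"
    using borel_measurable_continuous_onI[OF continuous_on_sqsum[of UNIV ps]] measurable_cong_sets[OF that refl] by blast
  have hm: "(\<lambda>x. F n x - apply_bcontfun (h n) x) \<in> borel_measurable \<mu>" for n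
    by (intro borel_measurable_diff Fm bcontfun_borel_measurable[OF \<mu>(2)])
  have km: "(\<lambda>x. H n x - apply_bcontfun (k n) x) \<in> borel_measurable \<nu>" for n
    by (intro borel_measurable_diff Hm bcontfun_borel_measurable[OF \<nu>(2)])
  have fm: "(\<lambda>x. - f n x) \<in> borel_measurable \<mu>" for n by (intro borel_measurable_uminus fg)
  have fI: "(\<integral>\<^sup>+x. sqseries (\<lambda>n x. - f n x) x \<partial>\<mu>) \<le> ennreal \<epsilon>" using fg(3) by (simp add: fneg)
  have bX: "sqsum (map fst l) x \<le> (s\<^sup>2 + 4) * (\<Sum>n<2 * m. (cmod (F n x - apply_bcontfun (h n) x))\<^sup>2)
      + 2 / s\<^sup>2 * (\<Sum>n<m. (cmod (apply_bcontfun (a n) x))\<^sup>2) + 2 * (\<Sum>n<m. (cmod (- f n x))\<^sup>2)" for x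
    unfolding l_def F_def by (rule sqsum_corrections(1)[OF s1])
  have bY: "sqsum (map snd l) y \<le> (s\<^sup>2 + 4) * (\<Sum>n<2 * m. (cmod (H n y - apply_bcontfun (k n) y))\<^sup>2)
      + 2 / s\<^sup>2 * (\<Sum>n<m. (cmod (apply_bcontfun (b n) y))\<^sup>2) + 2 * (\<Sum>n<m. (cmod (g n y))\<^sup>2)" for y
    unfolding l_def H_def by (rule sqsum_corrections(2)[OF s1])
  have coeffs: "0 \<le> s\<^sup>2 + 4" "0 \<le> 2 / s\<^sup>2" "0 \<le> (2::real)" "0 \<le> \<eta>" "0 \<le> \<epsilon>"
    using s2pos \<eta> \<epsilon> by simp_all
  have "(\<integral>x. sqsum (map fst l) x \<partial>\<mu>) \<le> (s\<^sup>2 + 4) * \<eta> + 2 / s\<^sup>2 * (C * measure \<mu> UNIV) + 2 * \<epsilon>"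
    by (rule integral_le_of_sqseries[OF sq_meas[OF \<mu>(2)] hm am fm sqsum_nonneg
          coeffs(1-4) K0(1) coeffs(5) bX hk(1) Ia fI])
  moreover have "(\<integral>y. sqsum (map snd l) y \<partial>\<nu>) \<le> (s\<^sup>2 + 4) * \<eta> + 2 / s\<^sup>2 * (C * measure \<nu> UNIV) + 2 * \<epsilon>"
    by (rule integral_le_of_sqseries[OF sq_meas[OF \<nu>(2)] km bm fg(2) sqsum_nonneg
          coeffs(1-4) K0(2) coeffs(5) bY hk(2) Ib fg(4)])
  moreover have "(s\<^sup>2 + 4) * \<eta> = c / 8"
  proof -
    have "w * (c / (8 * w)) = c / 8" if "0 < w" for w using that by simp
    moreover have "0 < s\<^sup>2 + 4" using s2pos by linarith
    ultimately show ?thesis unfolding \<eta>_def by blast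
  qed
  moreover have "2 / s\<^sup>2 * (C * measure \<mu> UNIV) + 2 / s\<^sup>2 * (C * measure \<nu> UNIV) \<le> c / 8"
  proof -
    have "16 * K = (s\<^sup>2 - 1) * c" using c by (simp add: s2)
    also have "\<dots> \<le> s\<^sup>2 * c" using c by (simp add: algebra_simps)
    finally have "2 * K \<le> c / 8 * s\<^sup>2" by (simp add: mult.commute)
    then have "2 * K / s\<^sup>2 \<le> c / 8" using s2pos by (simp add: pos_divide_le_eq)
    then show ?thesis by (simp add: K_def add_divide_distrib distrib_left)
  qed
  ultimately have "(\<integral>x. sqsum (map fst l) x \<partial>\<mu>) + (\<integral>y. sqsum (map snd l) y \<partial>\<nu>) < c"
    using c unfolding \<epsilon>_def by linarith
  then show ?thesis by (rule that[OF hk(3) close])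
qed

lemma varopoulos_norm_bounds:
  fixes \<Phi> :: "('a::topological_space \<times> 'b::topological_space) \<Rightarrow>\<^sub>C complex"
  assumes "vbound (apply_bcontfun \<Phi>) s"
  shows "0 \<le> varopoulos_norm \<Phi>" "varopoulos_norm \<Phi> \<le> s"
proof -
  let ?S = "{s. \<exists>f g. varopoulos_rep f g \<Phi> \<and> s = (\<Sum>i. norm (f i) * norm (g i))}"
  have pos: "0 \<le> t" if "t \<in> ?S" for t
    using that by (auto simp: varopoulos_rep_def intro!: suminf_nonneg)
  obtain f g where fg: "varopoulos_rep f g \<Phi>" "(\<Sum>i. norm (f i) * norm (g i)) \<le> s"
    using assms unfolding vbound_def varopoulos_rep_def by blast
  then show "varopoulos_norm \<Phi> \<le> s"
    unfolding varopoulos_norm_def using pos by (intro cInf_lower2[of "\<Sum>i. norm (f i) * norm (g i)"] bdd_belowI[of _ 0]) auto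
  show "0 \<le> varopoulos_norm \<Phi>"
    unfolding varopoulos_norm_def using fg(1) pos by (intro cInf_greatest) auto
qed

lemma varopoulos_algebra_iff: "\<Phi> \<in> varopoulos_algebra \<longleftrightarrow> (\<exists>s. vbound (apply_bcontfun \<Phi>) s)"
  unfolding varopoulos_algebra_def varopoulos_rep_def vbound_def by auto

theorem theorem6p1:
  fixes E :: "('a::metric_space \<times> 'b::metric_space) set"
  assumes "compact (UNIV :: 'a set)"
    and "compact (UNIV :: 'b set)"
    and "closed E"
    and "\<And>(\<mu> :: 'a measure) (\<nu> :: 'b measure).
           finite_measure \<mu> \<Longrightarrow> sets \<mu> = sets borel \<Longrightarrow>
           finite_measure \<nu> \<Longrightarrow> sets \<nu> = sets borel \<Longrightarrow>
           operator_synthesis \<mu> \<nu> E"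
  shows "spectral_synthesis E"
  unfolding spectral_synthesis_def
proof (intro conjI ballI impI)
  show "closed E" by fact
  fix \<Phi> :: "('a \<times> 'b) \<Rightarrow>\<^sub>C complex"
  assume "\<Phi> \<in> varopoulos_algebra" and van: "\<forall>p\<in>E. apply_bcontfun \<Phi> p = 0"
  then obtain C where C: "vbound (apply_bcontfun \<Phi>) C" by (auto simp: varopoulos_algebra_iff)
  have "\<exists>\<psi>. vanishes_near E \<psi> \<and> vbound (\<lambda>z. apply_bcontfun \<Phi> z - \<psi> z) d" if d: "0 < d" for d
  proof (rule ccontr)
    assume "\<not> ?thesis"
    then have far: "\<And>\<psi>. vanishes_near E \<psi> \<Longrightarrow> \<not> vbound (\<lambda>z. apply_bcontfun \<Phi> z - \<psi> z) d" by blast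
    obtain \<mu> :: "'a measure" and \<nu> :: "'b measure"
      where m: "finite_measure \<mu>" "sets \<mu> = sets borel" "finite_measure \<nu>" "sets \<nu> = sets borel"
      and low: "\<And>\<psi> l. vanishes_near E \<psi> \<Longrightarrow> vbound (\<lambda>z. apply_bcontfun \<Phi> z - \<psi> z - tens l z) (d / 2) \<Longrightarrow>
       d / 16 \<le> (\<integral>x. sqsum (map fst l) x \<partial>\<mu>) + (\<integral>y. sqsum (map snd l) y \<partial>\<nu>)"
      using measures_bounding_distance[OF assms(1,2) d far] by blast
    have E0: "\<And>p. p \<in> E \<Longrightarrow> apply_bcontfun \<Phi> p = 0" using van by blast
    have pos: "0 < d / 16" "0 < d / 2" using d by simp_all
    obtain \<psi> l where "vanishes_near E \<psi>" "vbound (\<lambda>z. apply_bcontfun \<Phi> z - \<psi> z - tens l z) (d / 2)"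
      "(\<integral>x. sqsum (map fst l) x \<partial>\<mu>) + (\<integral>y. sqsum (map snd l) y \<partial>\<nu>) < d / 16"
      using operator_synthesis_small_corrections[OF assms(1-3) m assms(4)[OF m] C E0 pos] by blast
    then show False using low by fastforce
  qed
  then have "\<forall>n. \<exists>\<psi>. vanishes_near E \<psi> \<and> vbound (\<lambda>z. apply_bcontfun \<Phi> z - \<psi> z) (inverse (real (Suc n)))"
    by simp
  then obtain \<psi> where \<psi>: "\<And>n. vanishes_near E (\<psi> n)"
    "\<And>n. vbound (\<lambda>z. apply_bcontfun \<Phi> z - \<psi> n z) (inverse (real (Suc n)))" by metis
  define \<Psi> where "\<Psi> n = Bcontfun (\<psi> n)" for n
  have \<Psi>: "apply_bcontfun (\<Psi> n) = \<psi> n" for n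
  proof -
    have "compact (UNIV :: ('a \<times> 'b) set)" using compact_Times[OF assms(1,2)] by simp
    moreover have "continuous_on UNIV (\<psi> n)"
      using \<psi>(1)[of n] continuous_on_vbound unfolding vanishes_near_def by blast
    ultimately show ?thesis unfolding \<Psi>_def by (rule apply_Bcontfun_compact)
  qed
  have "\<Psi> n \<in> varopoulos_algebra \<and> (\<exists>U. open U \<and> E \<subseteq> U \<and> (\<forall>p\<in>U. apply_bcontfun (\<Psi> n) p = 0))" for n
    using \<psi>(1)[of n] by (simp add: varopoulos_algebra_iff \<Psi> vanishes_near_def)
  moreover have "(\<lambda>n. varopoulos_norm (\<Phi> - \<Psi> n)) \<longlonglongrightarrow> 0"
  proof (rule tendsto_sandwich[OF always_eventually always_eventually tendsto_const LIMSEQ_inverse_real_of_nat], safe)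
    fix n
    have "apply_bcontfun (\<Phi> - \<Psi> n) = (\<lambda>z. apply_bcontfun \<Phi> z - \<psi> n z)" by (simp add: fun_eq_iff \<Psi>)
    then have "vbound (apply_bcontfun (\<Phi> - \<Psi> n)) (inverse (real (Suc n)))" using \<psi>(2)[of n] by simp
    from varopoulos_norm_bounds[OF this]
    show "0 \<le> varopoulos_norm (\<Phi> - \<Psi> n)" "varopoulos_norm (\<Phi> - \<Psi> n) \<le> inverse (real (Suc n))" .
  qed
  ultimately show "\<exists>\<Psi>. (\<forall>n. \<Psi> n \<in> varopoulos_algebra \<and>
        (\<exists>U. open U \<and> E \<subseteq> U \<and> (\<forall>p\<in>U. apply_bcontfun (\<Psi> n) p = 0))) \<and>
      (\<lambda>n. varopoulos_norm (\<Phi> - \<Psi> n)) \<longlonglongrightarrow> 0" by blast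
qed

end
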